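(* Let $(E,d)$ be a complete metric space, $\mathcal E:E\to(-\infty,+\infty]$ an energy functional and $\kappa\in\mathbb R$, such that the assumptions "metric and energy", "weak topology", "gradient flow" and "regularized geodesics" of the context hold. Let $\lambda>0$ and let $h^\dagger,h^\ddagger\in C_b(E)$ be weakly continuous. Let $u$ be a viscosity subsolution to $f-\lambda H_\dagger f=h^\dagger$ and let $v$ be a viscosity supersolution to $f-\lambda H_\ddagger f=h^\ddagger$, where $H_\dagger,H_\ddagger$ are the operators on cylindrical test functions defined in the context. Then $$\sup_{\pi\in E}u(\pi)-v(\pi)\le\sup_{\pi\in E}h^\dagger(\pi)-h^\ddagger(\pi).$$
   Context: **Function spaces.** $C_b(E)$: bounded continuous functions on $E$. Semicontinuity is with respect to $d$ unless "weakly" is said. The functions $g^\dagger$ (resp. $g^\ddagger$) below take the value $-\infty$ (resp. $+\infty$) where $\mathcal E=+\infty$. **Assumption (metric and energy).** $(E,d)$ is geodesic: for all $\rho,\pi\in E$ there is a curve $(\zeta(t))_{t\in[0,1]}$ with $\zeta(0)=\rho$, $\zeta(1)=\pi$ and $d(\zeta(s),\zeta(t))=|t-s|d(\rho,\pi)$ for all $s,t\in[0,1]$ (such a curve is called a geodesic). $\mathcal D(\mathcal E):=\{\mathcal E<+\infty\}\ne\emptyset$ and $\mathcal E$ is lower semi-continuous. **Assumption (weak topology).** There is a topology on $E$, called the weak topology, weaker than the one generated by $d$, such that: $d(\cdot,\cdot)$ is weakly lower semi-continuous; $\mathcal E$ is weakly lower semi-continuous on metric balls; for all $\rho\in E$,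 $c,d'\in\mathbb R$ the set $K^\rho_{c,d'}:=\{\pi\in E: d(\rho,\pi)\le c,\ \mathcal E(\pi)\le d'\}$ is weakly compact. "Weakly" always refers to this topology. **Assumption (gradient flow).** There is an $EVI_\kappa$ gradient flow of $\mathcal E$ defined on all of $E$: a family of continuous maps $S(t):E\to E$, $t\ge0$, such that for every $\pi\in E$, writing $\pi(t):=S[\pi](t)$, one has $S[\pi](0)=\pi$, $S[\pi](t+s)=S[S[\pi](t)](s)$, and $\gamma(t)=\pi(t)$ is a continuous curve with $\gamma((0,\infty))\subseteq\mathcal D(\mathcal E)$ and $$\tfrac12\tfrac{d^+}{dt}d^2(\gamma(t),\rho)\le\mathcal E(\rho)-\mathcal E(\gamma(t))-\tfrac\kappa2d^2(\gamma(t),\rho)\qquad\forall\rho\in\mathcal D(\mathcal E),\ t\in[0,\infty),$$ where $\frac{d^+}{dt}$ is the upper right derivative. **Information.** $|\partial\mathcal E|(\rho)=\limsup_{\pi\to\rho}\frac{(\mathcal E(\rho)-\mathcal E(\pi))^+}{d(\rho,\pi)}$ for $\rho\in\mathcal D(\mathcal E)$ (local slope); $I(\pi):=|\partial\mathcal E|^2(\pi)$ for $\pi\in\mathcal D(\mathcal E)$, $+\infty$ otherwise. $\mathcal D(I)=\{I<\infty\}$. **Assumption (regularized geodesics).** For any $\rho,\pi\in E$ with $I(\rho)+\mathcal E(\pi)<+\infty$ there exists a geodesic $\zeta^{\rho\to\pi}$ from $\rho$ to $\pi$ such that for any $\theta>0$ there exist $\tau>0$ and a curve (not necessarily a geodesic)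 $(\zeta^{\rho\to\pi}_\theta(t))_{t\in[0,\tau]}$ satisfying $$\limsup_{t\downarrow0}\frac{d(\zeta_\theta^{\rho\to\pi}(t),\zeta^{\rho\to\pi}(t))}{t}\le\theta,\qquad\liminf_{t\downarrow0}\frac{\mathcal E(\zeta_\theta^{\rho\to\pi}(t))-\mathcal E(\rho)}{t}\le|\partial\mathcal E|(\rho)(d(\rho,\pi)+\theta),$$ and $\zeta_\theta^{\rho\to\pi}(0)=\rho$. **Cylindrical Hamiltonians.** $\mathcal T$ is the set of all smooth $\varphi:[0,\infty)^k\to\mathbb R$, $k\in\mathbb N$, with $\partial_i\varphi>0$ for $i=1,\dots,k$. For $\bm\mu=(\mu_1,\dots,\mu_k)$, $\frac12d^2(\pi,\bm\mu):=(\frac12d^2(\pi,\mu_1),\dots,\frac12d^2(\pi,\mu_k))$. $H_\dagger$ is the set of all pairs $(f^\dagger,g^\dagger)$, for $a>0$, $\varphi\in\mathcal T$, $\rho\in\mathcal D(I)$, $\mu_1,\dots,\mu_k\in\mathcal D(I)$, with $$f^\dagger(\pi)=\tfrac a2d^2(\pi,\rho)+\varphi(\tfrac12d^2(\pi,\bm\mu)),$$ $$g^\dagger(\pi)=a[\mathcal E(\rho)-\mathcal E(\pi)-\tfrac\kappa2d^2(\pi,\rho)]+\tfrac{a^2}2d^2(\pi,\rho)+\sum_{i=1}^k\partial_i\varphi(\tfrac12d^2(\pi,\bm\mu))[\mathcal E(\mu_i)-\mathcal E(\pi)-\tfrac\kappa2d^2(\pi,\mu_i)]+\tfrac12\Sigma(\pi)^2+a\,d(\pi,\rho)\Sigma(\pi),$$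 where $\Sigma(\pi)=\sum_{i=1}^k\partial_i\varphi(\tfrac12d^2(\pi,\bm\mu))d(\pi,\mu_i)$. $H_\ddagger$ is the set of all pairs $(f^\ddagger,g^\ddagger)$, for $a>0$, $\varphi\in\mathcal T$, $\gamma\in\mathcal D(I)$, $\pi_1,\dots,\pi_k\in\mathcal D(I)$, with $$f^\ddagger(\mu)=-\tfrac a2d^2(\mu,\gamma)-\varphi(\tfrac12d^2(\mu,\bm\pi)),$$ $$g^\ddagger(\mu)=a[\mathcal E(\mu)-\mathcal E(\gamma)+\tfrac\kappa2d^2(\mu,\gamma)]+\tfrac{a^2}2d^2(\gamma,\mu)+\sum_{i=1}^k\partial_i\varphi(\tfrac12d^2(\mu,\bm\pi))[\mathcal E(\mu)-\mathcal E(\pi_i)+\tfrac\kappa2d^2(\mu,\pi_i)]-\tfrac12\Sigma'(\mu)^2-a\,d(\mu,\gamma)\Sigma'(\mu),$$ where $\Sigma'(\mu)=\sum_{i=1}^k\partial_i\varphi(\tfrac12d^2(\mu,\bm\pi))d(\mu,\pi_i)$. **Viscosity solutions.** For a set $A_\dagger$ of pairs $(f,g)$, $u:E\to\mathbb R$ is a viscosity subsolution of $f-\lambda A_\dagger f=h$ if $u$ is bounded, upper semi-continuous, and for all $(f,g)\in A_\dagger$ there is a sequence $(\pi_n)$ in $E$ with $\lim_n u(\pi_n)-f(\pi_n)=\sup_\pi\{u(\pi)-f(\pi)\}$ and $\limsup_n u(\pi_n)-\lambda g(\pi_n)-h(\pi_n)\le0$. For a set $A_\ddagger$ of pairs, $v$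 is a viscosity supersolution of $f-\lambda A_\ddagger f=h$ if $v$ is bounded, lower semi-continuous, and for all $(f,g)\in A_\ddagger$ there is a sequence $(\pi_n)$ with $\lim_nv(\pi_n)-f(\pi_n)=\inf_\pi\{v(\pi)-f(\pi)\}$ and $\liminf_nv(\pi_n)-\lambda g(\pi_n)-h(\pi_n)\ge0$. *)

theory Defs
  imports "HOL-Analysis.Analysis"
begin

section \<open>Semicontinuity and derivatives\<close>

definition lsc_map :: "'a topology \<Rightarrow> ('a \<Rightarrow> 'b::linorder) \<Rightarrow> bool" where
  "lsc_map X f \<longleftrightarrow> (\<forall>c. openin X {x \<in> topspace X. c < f x})"

definition usc_map :: "'a topology \<Rightarrow> ('a \<Rightarrow> 'b::linorder) \<Rightarrow> bool" where
  "usc_map X f \<longleftrightarrow> (\<forall>c. openin X {x \<in> topspace X. f x < c})"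

definition upper_right_deriv :: "(real \<Rightarrow> real) \<Rightarrow> real \<Rightarrow> ereal" where
  "upper_right_deriv f t = Limsup (at_right 0) (\<lambda>h. ereal ((f (t + h) - f t) / h))"


section \<open>Energy, slope and information\<close>

definition energy_dom :: "('a \<Rightarrow> ereal) \<Rightarrow> 'a set" where
  "energy_dom E = {\<pi>. E \<pi> < \<infinity>}"

text \<open>The outer maximum only matters at isolated points, where \<open>Limsup\<close> along the trivial
  filter would be \<open>-\<infinity>\<close>; there the slope is 0, as usual.\<close>

definition local_slope :: "('a::metric_space \<Rightarrow> ereal) \<Rightarrow> 'a \<Rightarrow> ereal" where
  "local_slope E \<rho> = max 0 (Limsup (at \<rho>) (\<lambda>\<pi>. max 0 (E \<rho> - E \<pi>) / ereal (dist \<rho> \<pi>)))"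

definition information :: "('a::metric_space \<Rightarrow> ereal) \<Rightarrow> 'a \<Rightarrow> ereal" where
  "information E \<pi> = (if \<pi> \<in> energy_dom E then (local_slope E \<pi>)\<^sup>2 else \<infinity>)"

definition information_dom :: "('a::metric_space \<Rightarrow> ereal) \<Rightarrow> 'a set" where
  "information_dom E = {\<pi>. information E \<pi> < \<infinity>}"


section \<open>Standing assumptions\<close>

definition is_geodesic :: "(real \<Rightarrow> 'a::metric_space) \<Rightarrow> 'a \<Rightarrow> 'a \<Rightarrow> bool" where
  "is_geodesic \<zeta> \<rho> \<pi> \<longleftrightarrow> \<zeta> 0 = \<rho> \<and> \<zeta> 1 = \<pi> \<and>
     (\<forall>s\<in>{0..1}. \<forall>t\<in>{0..1}. dist (\<zeta> s) (\<zeta> t) = \<bar>t - s\<bar> * dist \<rho> \<pi>)"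

definition metric_energy_assumption :: "('a::metric_space \<Rightarrow> ereal) \<Rightarrow> bool" where
  "metric_energy_assumption E \<longleftrightarrow>
     (\<forall>\<rho> \<pi> :: 'a. \<exists>\<zeta>. is_geodesic \<zeta> \<rho> \<pi>) \<and> energy_dom E \<noteq> {} \<and> lsc_map euclidean E"

definition weak_topology_assumption ::
    "'a topology \<Rightarrow> ('a::metric_space \<Rightarrow> ereal) \<Rightarrow> bool" where
  "weak_topology_assumption W E \<longleftrightarrow>
     topspace W = UNIV \<and> (\<forall>U. openin W U \<longrightarrow> open U) \<and>
     lsc_map (prod_topology W W) (\<lambda>(x, y). dist x y) \<and>
     (\<forall>\<rho> r. lsc_map (subtopology W (cball \<rho> r)) E) \<and>
     (\<forall>\<rho> c c'. compactin W {\<pi>. dist \<rho> \<pi> \<le> c \<and> E \<pi> \<le> ereal c'})"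

text \<open>In the evolution variational inequality, \<open>t = 0\<close> is included; if the initial energy is
  infinite, the right-hand side is \<open>-\<infinity>\<close> in extended real arithmetic.\<close>

definition EVI_gradient_flow ::
    "('a::metric_space \<Rightarrow> ereal) \<Rightarrow> real \<Rightarrow> (real \<Rightarrow> 'a \<Rightarrow> 'a) \<Rightarrow> bool" where
  "EVI_gradient_flow E \<kappa> S \<longleftrightarrow>
     (\<forall>t\<ge>0. continuous_on UNIV (S t)) \<and>
     (\<forall>\<pi>. S 0 \<pi> = \<pi> \<and>
          (\<forall>t\<ge>0. \<forall>s\<ge>0. S (t + s) \<pi> = S s (S t \<pi>)) \<and>
          continuous_on {0..} (\<lambda>t. S t \<pi>) \<and>
          (\<forall>t>0. S t \<pi> \<in> energy_dom E) \<and>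
          (\<forall>\<rho>\<in>energy_dom E. \<forall>t\<ge>0.
             ereal (1/2) * upper_right_deriv (\<lambda>s. (dist (S s \<pi>) \<rho>)\<^sup>2) t
               \<le> E \<rho> - E (S t \<pi>) - ereal (\<kappa>/2 * (dist (S t \<pi>) \<rho>)\<^sup>2)))"

definition regularized_geodesics_assumption :: "('a::metric_space \<Rightarrow> ereal) \<Rightarrow> bool" where
  "regularized_geodesics_assumption E \<longleftrightarrow>
     (\<forall>\<rho> \<pi>. information E \<rho> + E \<pi> < \<infinity> \<longrightarrow>
       (\<exists>\<zeta>. is_geodesic \<zeta> \<rho> \<pi> \<and>
         (\<forall>\<theta>>0. \<exists>\<tau>>0. \<exists>\<zeta>\<theta> :: real \<Rightarrow> 'a.
            \<zeta>\<theta> 0 = \<rho> \<and>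
            Limsup (at 0 within {0<..\<tau>}) (\<lambda>t. ereal (dist (\<zeta>\<theta> t) (\<zeta> t) / t)) \<le> ereal \<theta> \<and>
            Liminf (at 0 within {0<..\<tau>}) (\<lambda>t. (E (\<zeta>\<theta> t) - E \<rho>) / ereal t)
              \<le> local_slope E \<rho> * ereal (dist \<rho> \<pi> + \<theta>))))"


section \<open>Cylindrical Hamiltonians\<close>

text \<open>Points of \<open>[0,\<infinity>)\<^sup>k\<close> are extensional functions on \<open>{..<k}\<close>; the topology they inherit
  from the function space is the Euclidean one.\<close>

definition orthant :: "nat \<Rightarrow> (nat \<Rightarrow> real) set" where
  "orthant k = {..<k} \<rightarrow>\<^sub>E {0..}"

text \<open>The partial derivative is one-sided on the face \<open>x i = 0\<close>.\<close>

definition partial :: "nat \<Rightarrow> ((nat \<Rightarrow> real) \<Rightarrow> real) \<Rightarrow> (nat \<Rightarrow> real) \<Rightarrow> real" where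
  "partial i \<phi> x = vector_derivative (\<lambda>t. \<phi> (x(i := t))) (at (x i) within {0..})"

definition smooth_on_orthant :: "nat \<Rightarrow> ((nat \<Rightarrow> real) \<Rightarrow> real) \<Rightarrow> bool" where
  "smooth_on_orthant k \<phi> \<longleftrightarrow>
     (\<forall>is. set is \<subseteq> {..<k} \<longrightarrow>
        continuous_on (orthant k) (foldr partial is \<phi>) \<and>
        (\<forall>i<k. \<forall>x\<in>orthant k.
           (\<lambda>t. foldr partial is \<phi> (x(i := t))) differentiable (at (x i) within {0..})))"

definition cyl_fun :: "nat \<Rightarrow> ((nat \<Rightarrow> real) \<Rightarrow> real) set" where
  "cyl_fun k = {\<phi>. smooth_on_orthant k \<phi> \<and> (\<forall>i<k. \<forall>x\<in>orthant k. partial i \<phi> x > 0)}"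

definition half_sq_dists :: "nat \<Rightarrow> (nat \<Rightarrow> 'a::metric_space) \<Rightarrow> 'a \<Rightarrow> nat \<Rightarrow> real" where
  "half_sq_dists k \<mu> \<pi> = (\<lambda>i\<in>{..<k}. 1/2 * (dist \<pi> (\<mu> i))\<^sup>2)"

definition cyl_slope ::
    "nat \<Rightarrow> ((nat \<Rightarrow> real) \<Rightarrow> real) \<Rightarrow> (nat \<Rightarrow> 'a::metric_space) \<Rightarrow> 'a \<Rightarrow> real" where
  "cyl_slope k \<phi> \<mu> \<pi> = (\<Sum>i<k. partial i \<phi> (half_sq_dists k \<mu> \<pi>) * dist \<pi> (\<mu> i))"

text \<open>All reference points have finite energy and \<open>E > -\<infinity>\<close>, so in extended real arithmetic
  \<open>g\<close> below equals \<open>-\<infinity>\<close> (for \<open>H_dagger\<close>) resp. \<open>+\<infinity>\<close> (for \<open>H_ddagger\<close>) exactly where \<open>E = \<infinity>\<close>.\<close>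

definition H_dagger ::
    "('a::metric_space \<Rightarrow> ereal) \<Rightarrow> real \<Rightarrow> (('a \<Rightarrow> real) \<times> ('a \<Rightarrow> ereal)) set" where
  "H_dagger E \<kappa> = {(f, g). \<exists>(a::real) k \<phi> \<rho> \<mu>.
     a > 0 \<and> k \<ge> 1 \<and> \<phi> \<in> cyl_fun k \<and> \<rho> \<in> information_dom E \<and>
     (\<forall>i<k. \<mu> i \<in> information_dom E) \<and>
     f = (\<lambda>\<pi>. a/2 * (dist \<pi> \<rho>)\<^sup>2 + \<phi> (half_sq_dists k \<mu> \<pi>)) \<and>
     g = (\<lambda>\<pi>. ereal a * (E \<rho> - E \<pi> - ereal (\<kappa>/2 * (dist \<pi> \<rho>)\<^sup>2))
            + ereal (a\<^sup>2/2 * (dist \<pi> \<rho>)\<^sup>2)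
            + (\<Sum>i<k. ereal (partial i \<phi> (half_sq_dists k \<mu> \<pi>))
                 * (E (\<mu> i) - E \<pi> - ereal (\<kappa>/2 * (dist \<pi> (\<mu> i))\<^sup>2)))
            + ereal (1/2 * (cyl_slope k \<phi> \<mu> \<pi>)\<^sup>2)
            + ereal (a * dist \<pi> \<rho> * cyl_slope k \<phi> \<mu> \<pi>))}"

definition H_ddagger ::
    "('a::metric_space \<Rightarrow> ereal) \<Rightarrow> real \<Rightarrow> (('a \<Rightarrow> real) \<times> ('a \<Rightarrow> ereal)) set" where
  "H_ddagger E \<kappa> = {(f, g). \<exists>(a::real) k \<phi> \<gamma> \<pi>.
     a > 0 \<and> k \<ge> 1 \<and> \<phi> \<in> cyl_fun k \<and> \<gamma> \<in> information_dom E \<and>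
     (\<forall>i<k. \<pi> i \<in> information_dom E) \<and>
     f = (\<lambda>\<mu>. - (a/2) * (dist \<mu> \<gamma>)\<^sup>2 - \<phi> (half_sq_dists k \<pi> \<mu>)) \<and>
     g = (\<lambda>\<mu>. ereal a * (E \<mu> - E \<gamma> + ereal (\<kappa>/2 * (dist \<mu> \<gamma>)\<^sup>2))
            + ereal (a\<^sup>2/2 * (dist \<gamma> \<mu>)\<^sup>2)
            + (\<Sum>i<k. ereal (partial i \<phi> (half_sq_dists k \<pi> \<mu>))
                 * (E \<mu> - E (\<pi> i) + ereal (\<kappa>/2 * (dist \<mu> (\<pi> i))\<^sup>2)))
            - ereal (1/2 * (cyl_slope k \<phi> \<pi> \<mu>)\<^sup>2)
            - ereal (a * dist \<mu> \<gamma> * cyl_slope k \<phi> \<pi> \<mu>))}"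


section \<open>Viscosity solutions\<close>

definition viscosity_subsolution ::
    "(('a::metric_space \<Rightarrow> real) \<times> ('a \<Rightarrow> ereal)) set \<Rightarrow> real \<Rightarrow> ('a \<Rightarrow> real) \<Rightarrow> ('a \<Rightarrow> real) \<Rightarrow> bool"
  where
  "viscosity_subsolution A lam h u \<longleftrightarrow>
     bounded (range u) \<and> usc_map euclidean u \<and>
     (\<forall>(f, g)\<in>A. \<exists>p :: nat \<Rightarrow> 'a.
        (\<lambda>n. ereal (u (p n) - f (p n))) \<longlonglongrightarrow> (SUP \<pi>. ereal (u \<pi> - f \<pi>)) \<and>
        limsup (\<lambda>n. ereal (u (p n)) - ereal lam * g (p n) - ereal (h (p n))) \<le> 0)"

definition viscosity_supersolution ::
    "(('a::metric_space \<Rightarrow> real) \<times> ('a \<Rightarrow> ereal)) set \<Rightarrow> real \<Rightarrow> ('a \<Rightarrow> real) \<Rightarrow> ('a \<Rightarrow> real) \<Rightarrow> bool"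
  where
  "viscosity_supersolution A lam h v \<longleftrightarrow>
     bounded (range v) \<and> lsc_map euclidean v \<and>
     (\<forall>(f, g)\<in>A. \<exists>p :: nat \<Rightarrow> 'a.
        (\<lambda>n. ereal (v (p n) - f (p n))) \<longlonglongrightarrow> (INF \<pi>. ereal (v \<pi> - f \<pi>)) \<and>
        liminf (\<lambda>n. ereal (v (p n)) - ereal lam * g (p n) - ereal (h (p n))) \<ge> 0)"

end

theory Submission
  imports Defs
begin

text \<open>
  The variables are quadrupled: one maximizes
  \<open>(1 + \<delta>) u(\<pi>) - (1 - \<delta>) v(\<mu>) - a/2 (d\<^sup>2(\<pi>, \<rho>) + d\<^sup>2(\<rho>, \<gamma>) + d\<^sup>2(\<gamma>, \<mu>))\<close> minus penalties at \<open>\<rho>\<close> and \<open>\<gamma>\<close>,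
  tests \<open>u\<close> at \<open>\<pi>\<close> with centre \<open>\<rho>\<close> and \<open>v\<close> at \<open>\<mu>\<close> with centre \<open>\<gamma>\<close>. Optimality of \<open>\<rho>\<close> and \<open>\<gamma>\<close> along the
  gradient flow compensates the energy differences and yields a gain proportional to the
  information; optimality along the regularized geodesics gives
  \<open>d(\<pi>, \<rho>) \<le> d(\<gamma>, \<mu>)\<close> up to a multiple of the slopes, which this gain and the factor
  \<open>1 \<plusminus> \<delta>\<close> absorb. Exact maximizers come from a Borwein-Preiss principle whose perturbations are
  squared distances to points of finite information, so linear cylinder functions suffice.

  The energy penalty is \<open>- L / (E + c)\<close>: it is bounded, so it costs little even near points of
  infinite energy, but by geodesic convexity the slope grows linearly in the energy, so the gain
  stays large and forces \<open>E(\<rho>)\<close> and \<open>E(\<gamma>)\<close> to remain bounded as \<open>a\<close> tends to infinity. Weak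
  compactness of energy sublevels is then only needed to control \<open>h_ddagger(\<pi>) - h_ddagger(\<mu>)\<close>.
\<close>

section \<open>Evolution variational inequality\<close>

text \<open>Why four points: a test function for \<open>u\<close> or \<open>v\<close> must be
  centred at points of finite information, while the points \<pi> and \<mu> at which the viscosity
  inequalities are read off are only known to have finite energy. The inner points \<rho> and
  \<gamma> minimise penalised sums of squared distances, and this minimality makes their slopes
  finite. In the sum of the two viscosity inequalities and the two flow inequalities all energies
  multiplied by \<open>a\<close> cancel. The other obstacle is the order of the constants. The
  right-hand side has a modulus of continuity only on an energy sublevel, so energies must be
  bounded before \<open>a\<close> is fixed. A coercive penalty with a parameter chosen after
  \<open>a\<close> cannot do this; \<open>\<epsilon>\<^sub>1 * E\<close> therefore only produces an
  optimum of finite information, and the bounded penalty supplies the energy bound. Instead of a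
  limit in \<open>a\<close>, a single value is used at which halving \<open>a\<close> hardly changes
  the supremum; there \<open>a\<close> times the squared distances is small.\<close>

lemma dini_bound:
  fixes f :: "real \<Rightarrow> real"
  assumes t: "0 \<le> t" and cont: "continuous_on {0..t} f"
    and dini: "\<And>r \<eta>. \<lbrakk>0 \<le> r; r < t; 0 < \<eta>\<rbrakk> \<Longrightarrow>
      eventually (\<lambda>h. f (r + h) \<le> f r + h * (B + \<eta>)) (at_right 0)"
  shows "f t \<le> f 0 + B * t"
proof (rule field_le_epsilon)
  fix e :: real assume "0 < e"
  \<comment> \<open>The slack costs \<open>\<eta> * t \<le> e\<close> over the whole interval; the
    denominator \<open>t + 1\<close> also covers \<open>t = 0\<close>.\<close>
  define \<eta> where "\<eta> = e / (t + 1)"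
  have \<eta>: "0 < \<eta>" using \<open>0 < e\<close> t by (simp add: \<eta>_def)
  \<comment> \<open>Only a right derivative is controlled, so the argument is a continuation: the
    last time at which \<open>g\<close> is nonpositive must be \<open>t\<close>, because before
    \<open>t\<close> the Dini bound with slack keeps \<open>g\<close> nonpositive a little
    longer.\<close>
  define g where "g = (\<lambda>r. f r - f 0 - (B + \<eta>) * r)"
  define T where "T = {r \<in> {0..t}. g r \<le> 0}"
  have cg: "continuous_on {0..t} g"
    unfolding g_def by (intro continuous_intros cont)
  have "T = {0..t} \<inter> g -` {..0}" by (auto simp: T_def)
  then have "closed T"
    using continuous_closed_preimage[OF cg closed_atLeastAtMost closed_atMost] by simp
  then have "compact T"
    unfolding compact_eq_bounded_closed
    by (auto simp: T_def intro: bounded_subset[OF bounded_closed_interval[of 0 t]])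
  moreover have "0 \<in> T" using t by (simp add: T_def g_def)
  ultimately obtain r where r: "r \<in> T" and max: "\<And>q. q \<in> T \<Longrightarrow> q \<le> r"
    using compact_attains_sup[of T] by auto
  have "r = t"
  proof (rule ccontr)
    assume "r \<noteq> t"
    with r have "0 \<le> r" "r < t" "g r \<le> 0" by (auto simp: T_def)
    from dini[OF this(1,2) \<eta>] obtain b where b: "0 < b"
      and H: "\<And>h. \<lbrakk>0 < h; h < b\<rbrakk> \<Longrightarrow> f (r + h) \<le> f r + h * (B + \<eta>)"
      by (auto simp: eventually_at_right_field)
    define h where "h = min (b / 2) (t - r)"
    have h: "0 < h" "h < b" "r + h \<le> t" using b \<open>r < t\<close> by (auto simp: h_def)
    have "g (r + h) \<le> 0"
      using H[OF h(1,2)] \<open>g r \<le> 0\<close> by (simp add: g_def algebra_simps)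
    then have "r + h \<in> T" using h \<open>0 \<le> r\<close> by (simp add: T_def)
    from max[OF this] h(1) show False by simp
  qed
  then have "g t \<le> 0" using r by (simp add: T_def)
  moreover have "\<eta> * t \<le> e"
    using t \<open>0 < e\<close> by (simp add: \<eta>_def divide_simps mult_left_mono)
  ultimately show "f t \<le> f 0 + B * t + e"
    by (simp add: g_def algebra_simps)
qed

lemma sq_dist_perturb:
  fixes x y z :: "'a::metric_space"
  shows "\<bar>(dist x z)\<^sup>2 - (dist y z)\<^sup>2\<bar> \<le> dist x y * (dist x y + 2 * dist y z)"
proof -
  have 1: "\<bar>dist x z - dist y z\<bar> \<le> dist x y"
    by (metis abs_dist_diff_le dist_commute)
  have "dist x z + dist y z \<le> dist x y + 2 * dist y z"
    using dist_triangle[of x z y] by simp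
  with 1 have "\<bar>dist x z - dist y z\<bar> * \<bar>dist x z + dist y z\<bar> \<le> dist x y * (dist x y + 2 * dist y z)"
    by (intro mult_mono) auto
  moreover have "(dist x z)\<^sup>2 - (dist y z)\<^sup>2 = (dist x z - dist y z) * (dist x z + dist y z)"
    by (simp add: power2_eq_square algebra_simps)
  ultimately show ?thesis by (simp only: abs_mult)
qed

text \<open>Yields 0 where the energy is infinite, so its values are meaningful only on the energy
  domain.\<close>

definition real_energy :: "('a \<Rightarrow> ereal) \<Rightarrow> 'a \<Rightarrow> real" where
  "real_energy E x = real_of_ereal (E x)"

locale evi_space =
  fixes E :: "'a::complete_space \<Rightarrow> ereal" and \<kappa> :: real and S :: "real \<Rightarrow> 'a \<Rightarrow> 'a"
  assumes not_minf: "E x \<noteq> - \<infinity>"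
    and metric_energy: "metric_energy_assumption E"
    and flow: "EVI_gradient_flow E \<kappa> S"
begin

abbreviation "e \<equiv> real_energy E"
abbreviation "D \<equiv> energy_dom E"

lemma E_eq: "x \<in> D \<Longrightarrow> E x = ereal (e x)"
  using not_minf[of x] by (cases "E x") (auto simp: real_energy_def energy_dom_def)

lemma in_dom: "E x \<le> ereal m \<Longrightarrow> x \<in> D"
  by (auto simp: energy_dom_def intro: le_less_trans)

lemma E_le_iff: "E x \<le> ereal m \<longleftrightarrow> x \<in> D \<and> e x \<le> m"
  using E_eq[of x] in_dom[of x m] by auto

lemma lsc_E: "ereal m < E x \<Longrightarrow> \<exists>r>0. \<forall>y. dist y x < r \<longrightarrow> ereal m < E y"
proof -
  assume "ereal m < E x"
  moreover have "open {x. ereal m < E x}"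
    using metric_energy by (simp add: metric_energy_assumption_def lsc_map_def)
  ultimately show ?thesis
    unfolding open_dist by auto
qed

lemma lsc_e:
  assumes "x \<in> D" "0 < \<eta>"
  shows "\<exists>r>0. \<forall>y. dist y x < r \<longrightarrow> ereal (e x - \<eta>) \<le> E y"
proof -
  have "ereal (e x - \<eta>) < E x" using assms by (simp add: E_eq)
  from lsc_E[OF this] show ?thesis by (meson less_imp_le)
qed

lemma closed_sublevel: "closed {x. E x \<le> ereal m}"
proof -
  have "open {x. ereal m < E x}"
    using metric_energy by (simp add: metric_energy_assumption_def lsc_map_def)
  moreover have "{x. E x \<le> ereal m} = - {x. ereal m < E x}" by auto
  ultimately show ?thesis by (simp add: closed_open)
qed

section \<open>Elementary consequences of the evolution variational inequality\<close>

lemma flow_0: "S 0 x = x"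
  and flow_add: "\<lbrakk>0 \<le> t; 0 \<le> s\<rbrakk> \<Longrightarrow> S (t + s) x = S s (S t x)"
  and flow_cont: "continuous_on {0..} (\<lambda>t. S t x)"
  and flow_dom: "0 < t \<Longrightarrow> S t x \<in> D"
  and flow_evi: "\<lbrakk>\<sigma> \<in> D; 0 \<le> t\<rbrakk> \<Longrightarrow>
     ereal (1/2) * upper_right_deriv (\<lambda>s. (dist (S s x) \<sigma>)\<^sup>2) t
               \<le> E \<sigma> - E (S t x) - ereal (\<kappa>/2 * (dist (S t x) \<sigma>)\<^sup>2)"
  using flow unfolding EVI_gradient_flow_def by auto

lemma flow_tendsto: "((\<lambda>t. S t x) \<longlongrightarrow> x) (at_right 0)"
proof -
  have "((\<lambda>t. S t x) \<longlongrightarrow> S 0 x) (at 0 within {0..})"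
    using flow_cont[of x] by (simp add: continuous_on)
  then show ?thesis
    unfolding flow_0 by (rule tendsto_within_subset) auto
qed

lemma flow_near: "0 < r \<Longrightarrow> \<exists>\<tau>>0. \<forall>t. 0 \<le> t \<and> t < \<tau> \<longrightarrow> dist (S t x) x < r"
proof -
  assume r: "0 < r"
  have "eventually (\<lambda>t. dist (S t x) x < r) (at_right 0)"
    using flow_tendsto[of x] r by (simp add: tendsto_iff)
  then obtain b where "0 < b" "\<forall>t. 0 < t \<and> t < b \<longrightarrow> dist (S t x) x < r"
    by (auto simp: eventually_at_right_field)
  then show ?thesis using r
    by (intro exI[of _ b]) (metis dist_self flow_0 order_le_less)
qed

text \<open>The number \<open>m\<close> stands in for the energy at time \<open>t\<close>, which may
  be infinite when \<open>t = 0\<close>. A finite lower bound is enough because this energy enters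
  the EVI with a negative sign.\<close>

lemma flow_dini:
  assumes \<sigma>: "\<sigma> \<in> D" and t: "0 \<le> t" and m: "ereal m \<le> E (S t x)" and \<eta>: "0 < \<eta>"
  shows "eventually (\<lambda>h. (dist (S (t + h) x) \<sigma>)\<^sup>2
     \<le> (dist (S t x) \<sigma>)\<^sup>2 + h * (2 * (e \<sigma> - m - \<kappa>/2 * (dist (S t x) \<sigma>)\<^sup>2) + \<eta>)) (at_right 0)"
proof -
  let ?f = "\<lambda>s. (dist (S s x) \<sigma>)\<^sup>2" and ?c = "\<kappa>/2 * (dist (S t x) \<sigma>)\<^sup>2"
  have "ereal (1/2) * upper_right_deriv ?f t \<le> E \<sigma> - E (S t x) - ereal ?c"
    by (rule flow_evi[OF \<sigma> t])
  also have "\<dots> \<le> ereal (e \<sigma> - m - ?c)"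
    using m E_eq[OF \<sigma>] by (cases "E (S t x)") auto
  finally have "upper_right_deriv ?f t \<le> ereal (2 * (e \<sigma> - m - ?c))"
    by (cases "upper_right_deriv ?f t") auto
  also have "\<dots> < ereal (2 * (e \<sigma> - m - ?c) + \<eta>)" using \<eta> by simp
  finally have "eventually (\<lambda>h. ereal ((?f (t + h) - ?f t) / h) < ereal (2 * (e \<sigma> - m - ?c) + \<eta>)) (at_right 0)"
    unfolding upper_right_deriv_def by (rule Limsup_lessD)
  moreover have "eventually (\<lambda>h::real. 0 < h) (at_right 0)"
    by (simp add: eventually_at_right_less)
  ultimately show ?thesis
    by eventually_elim (auto simp: divide_simps mult.commute)
qed

text \<open>The EVI integrated in time. The lower energy bound \<open>m\<close> and the bound
  \<open>B\<close> on the \<kappa>-term are kept as parameters, since monotonicity of the energy is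
  itself derived from this estimate.\<close>

lemma flow_est:
  assumes \<sigma>: "\<sigma> \<in> D" and t: "0 \<le> t"
    and m: "\<And>r. \<lbrakk>0 \<le> r; r < t\<rbrakk> \<Longrightarrow> ereal m \<le> E (S r x)"
    and B: "\<And>r. \<lbrakk>0 \<le> r; r < t\<rbrakk> \<Longrightarrow> - (\<kappa>/2 * (dist (S r x) \<sigma>)\<^sup>2) \<le> B"
  shows "(dist (S t x) \<sigma>)\<^sup>2 \<le> (dist x \<sigma>)\<^sup>2 + 2 * t * (e \<sigma> - m + B)"
proof -
  let ?f = "\<lambda>s. (dist (S s x) \<sigma>)\<^sup>2"
  have "?f t \<le> ?f 0 + (2 * (e \<sigma> - m + B)) * t"
  proof (rule dini_bound[OF t])
    show "continuous_on {0..t} ?f"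
      by (intro continuous_intros continuous_on_subset[OF flow_cont]) auto
    fix r \<eta> :: real assume r: "0 \<le> r" "r < t" and \<eta>: "0 < \<eta>"
    have "eventually (\<lambda>h::real. 0 < h) (at_right 0)"
      by (simp add: eventually_at_right_less)
    with flow_dini[OF \<sigma> r(1) m[OF r] \<eta>]
    show "eventually (\<lambda>h. ?f (r + h) \<le> ?f r + h * (2 * (e \<sigma> - m + B) + \<eta>)) (at_right 0)"
    proof eventually_elim
      case (elim h)
      have "h * (2 * (e \<sigma> - m - \<kappa>/2 * ?f r) + \<eta>) \<le> h * (2 * (e \<sigma> - m + B) + \<eta>)"
        using B[OF r] elim(2) by (intro mult_left_mono) auto
      with elim(1) show ?case by linarith
    qed
  qed
  then show ?thesis by (simp add: flow_0 mult_ac)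
qed

text \<open>Restart the flow at the last time \<open>s\<close> at which the energy is at most
  \<open>c\<close>, and take the starting point \<open>y\<close> itself as reference point. From
  then on the energy is above \<open>e y\<close>, so the EVI leaves only the \<kappa>-term, which a
  short time absorbs: the flow rests at \<open>y\<close>, although its energy should exceed
  \<open>c\<close>.\<close>

lemma energy_antimono_0:
  assumes t: "0 \<le> t"
  shows "E (S t x) \<le> E x"
proof (rule ccontr)
  assume "\<not> ?thesis"
  then have less: "E x < E (S t x)" by simp
  then obtain c where c: "E x < ereal c" "ereal c < E (S t x)"
    by (metis ereal_dense2 not_minf ereal_less_eq(2) not_le)
  have "0 < t" using less t by (cases "t = 0") (auto simp: flow_0)
  define T where "T = {r \<in> {0..t}. E (S r x) \<le> ereal c}"
  have "continuous_on {0..t} (\<lambda>r. S r x)"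
    by (rule continuous_on_subset[OF flow_cont]) auto
  moreover have "T = {0..t} \<inter> (\<lambda>r. S r x) -` {z. E z \<le> ereal c}" by (auto simp: T_def)
  ultimately have "closed T"
    using continuous_closed_preimage[OF _ closed_atLeastAtMost closed_sublevel] by simp
  then have "compact T"
    unfolding compact_eq_bounded_closed
    by (auto simp: T_def intro: bounded_subset[OF bounded_closed_interval[of 0 t]])
  moreover have "0 \<in> T" using c t by (auto simp: T_def flow_0)
  ultimately obtain s where s: "s \<in> T" and max: "\<And>q. q \<in> T \<Longrightarrow> q \<le> s"
    using compact_attains_sup[of T] by auto
  have "s \<noteq> t" using s c by (auto simp: T_def)
  with s have s0: "0 \<le> s" "s < t" and Es: "E (S s x) \<le> ereal c" by (auto simp: T_def)
  define y where "y = S s x"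
  have y: "y \<in> D" "e y \<le> c" using Es by (auto simp: y_def E_le_iff)
  have flow_y: "S r y = S (s + r) x" if "0 \<le> r" for r
    using that s0 by (simp add: y_def flow_add)
  have above: "ereal c < E (S r y)" if "0 < r" "r \<le> t - s" for r
    using max[of "s + r"] that s0 flow_y[of r] by (fastforce simp: T_def)
  \<comment> \<open>The second bound gives \<open>b * \<bar>\<kappa>\<bar> < 1\<close>, so the
    largest squared displacement \<open>?f q\<close> is bounded by a proper fraction of itself and
    vanishes.\<close>
  define b where "b = min (t - s) (1 / (\<bar>\<kappa>\<bar> + 1))"
  have b: "0 < b" "b \<le> t - s" "b * \<bar>\<kappa>\<bar> < 1"
  proof -
    show "0 < b" "b \<le> t - s" using s0 by (auto simp: b_def add_nonneg_pos)
    have "b * \<bar>\<kappa>\<bar> \<le> 1 / (\<bar>\<kappa>\<bar> + 1) * \<bar>\<kappa>\<bar>" by (intro mult_right_mono) (auto simp: b_def)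
    also have "\<dots> < 1" by (simp add: divide_simps)
    finally show "b * \<bar>\<kappa>\<bar> < 1" .
  qed
  let ?f = "\<lambda>r. (dist (S r y) y)\<^sup>2"
  have cf: "continuous_on {0..b} ?f"
    by (intro continuous_intros continuous_on_subset[OF flow_cont]) auto
  have "compact {0..b}" "{0..b} \<noteq> {}" using b by auto
  from continuous_attains_sup[OF this cf] obtain q where q: "q \<in> {0..b}" "\<And>r. r \<in> {0..b} \<Longrightarrow> ?f r \<le> ?f q"
    by blast
  have "?f q \<le> (dist y y)\<^sup>2 + 2 * q * (e y - e y + \<bar>\<kappa>\<bar>/2 * ?f q)"
  proof (rule flow_est[OF y(1)])
    show "0 \<le> q" using q by auto
    fix r assume r: "0 \<le> r" "r < q"
    show "ereal (e y) \<le> E (S r y)"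
    proof (cases "r = 0")
      case True then show ?thesis using y by (simp add: flow_0 E_eq)
    next
      case False
      have "ereal (e y) \<le> ereal c" using y by simp
      also have "\<dots> < E (S r y)" using above[of r] False r q b by auto
      finally show ?thesis by simp
    qed
    have "- \<kappa>/2 * ?f r \<le> \<bar>\<kappa>\<bar>/2 * ?f r" by (intro mult_right_mono) auto
    also have "\<dots> \<le> \<bar>\<kappa>\<bar>/2 * ?f q" using q r by (intro mult_left_mono) auto
    finally show "- (\<kappa>/2 * ?f r) \<le> \<bar>\<kappa>\<bar>/2 * ?f q" by simp
  qed
  then have "?f q \<le> (q * \<bar>\<kappa>\<bar>) * ?f q" by simp
  moreover have "q * \<bar>\<kappa>\<bar> < 1"
    using b(3) q mult_right_mono[of q b "\<bar>\<kappa>\<bar>"] by auto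
  ultimately have "?f q = 0"
    by (smt (verit) mult_le_cancel_right1 zero_le_power2)
  then have "?f b = 0" using q(2)[of b] b by (smt (verit) atLeastAtMost_iff zero_le_power2)
  then have "S b y = y" by simp
  with above[of b] b y show False by (simp add: E_eq)
qed

lemma energy_antimono: "\<lbrakk>0 \<le> s; s \<le> t\<rbrakk> \<Longrightarrow> E (S t x) \<le> E (S s x)"
  using energy_antimono_0[of "t - s" "S s x"] flow_add[of s "t - s" x] by simp

lemma flow_in_dom: "\<lbrakk>x \<in> D; 0 \<le> t\<rbrakk> \<Longrightarrow> S t x \<in> D"
  by (metis flow_0 flow_dom order_le_less)

lemma e_antimono: "\<lbrakk>x \<in> D; 0 \<le> t\<rbrakk> \<Longrightarrow> e (S t x) \<le> e x"
  using energy_antimono_0[of t x] by (simp add: E_eq flow_in_dom)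

text \<open>A first-order expansion in which the time \<tau> does not depend on \<sigma>. The
  uniformity matters because the flow is later tested against all centres of an infinite
  perturbation at once.\<close>

lemma flow_small:
  assumes x: "x \<in> D" and \<eta>: "0 < \<eta>" and R: "0 \<le> R"
  shows "\<exists>\<tau>>0. \<forall>t \<sigma>. 0 \<le> t \<and> t < \<tau> \<and> \<sigma> \<in> D \<and> dist x \<sigma> \<le> R \<longrightarrow>
    (dist (S t x) \<sigma>)\<^sup>2 \<le> (dist x \<sigma>)\<^sup>2 + 2 * t * (e \<sigma> - e x - \<kappa>/2 * (dist x \<sigma>)\<^sup>2 + \<eta>)"
proof -
  obtain r1 where r1: "0 < r1" "\<And>y. dist y x < r1 \<Longrightarrow> ereal (e x - \<eta>/2) \<le> E y"
    using lsc_e[OF x, of "\<eta>/2"] \<eta> by auto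
  \<comment> \<open>A displacement below \<open>r2\<close> changes \<open>\<kappa>/2\<close> times
    the squared distance to any admissible \<sigma> by at most \<open>\<eta>/2\<close>. The other
    half of \<eta> is spent on lower semicontinuity of the energy.\<close>
  define r2 where "r2 = min 1 (\<eta> / ((\<bar>\<kappa>\<bar> + 1) * (1 + 2 * R)))"
  have "0 < r2" using \<eta> R by (auto simp: r2_def intro!: divide_pos_pos mult_pos_pos)
  then obtain \<tau> where \<tau>: "0 < \<tau>" "\<And>t. \<lbrakk>0 \<le> t; t < \<tau>\<rbrakk> \<Longrightarrow> dist (S t x) x < min r1 r2"
    using flow_near[of "min r1 r2" x] r1 by auto
  have "(dist (S t x) \<sigma>)\<^sup>2 \<le> (dist x \<sigma>)\<^sup>2 + 2 * t * (e \<sigma> - (e x - \<eta>/2) + (\<eta>/2 - \<kappa>/2 * (dist x \<sigma>)\<^sup>2))"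
    if t: "0 \<le> t" "t < \<tau>" and \<sigma>: "\<sigma> \<in> D" "dist x \<sigma> \<le> R" for t \<sigma>
  proof (rule flow_est[OF \<sigma>(1) t(1)])
    fix r assume r: "0 \<le> r" "r < t"
    then have near: "dist (S r x) x < min r1 r2" using \<tau>(2)[of r] t by auto
    then show "ereal (e x - \<eta>/2) \<le> E (S r x)" using r1(2) by auto
    have "\<bar>(dist (S r x) \<sigma>)\<^sup>2 - (dist x \<sigma>)\<^sup>2\<bar> \<le> dist (S r x) x * (dist (S r x) x + 2 * dist x \<sigma>)"
      by (rule sq_dist_perturb)
    also have "\<dots> \<le> r2 * (1 + 2 * R)"
      using near \<sigma> R \<open>0 < r2\<close> by (intro mult_mono) (auto simp: min_less_iff_conj, auto simp: r2_def)
    also have "\<dots> \<le> \<eta> / ((\<bar>\<kappa>\<bar> + 1) * (1 + 2 * R)) * (1 + 2 * R)"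
      using R by (intro mult_right_mono) (auto simp: r2_def)
    also have "\<dots> = \<eta> / (\<bar>\<kappa>\<bar> + 1)" using R by (simp add: divide_simps)
    finally have "\<bar>\<kappa>\<bar>/2 * \<bar>(dist (S r x) \<sigma>)\<^sup>2 - (dist x \<sigma>)\<^sup>2\<bar> \<le> \<bar>\<kappa>\<bar>/2 * (\<eta> / (\<bar>\<kappa>\<bar> + 1))"
      by (intro mult_left_mono) auto
    also have "\<dots> \<le> \<eta>/2" using \<eta> by (simp add: divide_simps)
    finally have "\<bar>\<kappa>/2 * ((dist (S r x) \<sigma>)\<^sup>2 - (dist x \<sigma>)\<^sup>2)\<bar> \<le> \<eta>/2"
      by (simp add: abs_mult)
    then show "- (\<kappa>/2 * (dist (S r x) \<sigma>)\<^sup>2) \<le> \<eta>/2 - \<kappa>/2 * (dist x \<sigma>)\<^sup>2"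
      by (auto simp: algebra_simps abs_if split: if_splits)
  qed
  with \<tau>(1) show ?thesis by (intro exI[of _ \<tau>]) (auto simp: algebra_simps)
qed

text \<open>The integrated EVI for the flow started at \<open>y\<close>, read backwards: its
  left-hand side is a square and hence nonnegative, so at a fixed small time it can be solved for
  the energy of the reference point \<open>z\<close>.\<close>

lemma quadratic_lower_bound:
  assumes y: "y \<in> D"
  shows "\<exists>C>0. \<forall>z\<in>D. - C * (1 + (dist z y)\<^sup>2) \<le> e z"
proof -
  obtain r1 where r1: "0 < r1" "\<And>z. dist z y < r1 \<Longrightarrow> ereal (e y - 1) \<le> E z"
    using lsc_e[OF y, of 1] by auto
  obtain \<tau> where \<tau>: "0 < \<tau>" "\<And>t. \<lbrakk>0 \<le> t; t < \<tau>\<rbrakk> \<Longrightarrow> dist (S t y) y < min r1 1"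
    using flow_near[of "min r1 1" y] r1 by auto
  define t where "t = \<tau> / 2"
  have t: "0 < t" "t < \<tau>" using \<tau> by (auto simp: t_def)
  define C where "C = 1 + \<bar>e y - 1\<bar> + \<bar>\<kappa>\<bar> + 1 / (2 * t)"
  have "- C * (1 + (dist z y)\<^sup>2) \<le> e z" if z: "z \<in> D" for z
  proof -
    let ?d = "(dist y z)\<^sup>2"
    have "(dist (S t y) z)\<^sup>2 \<le> ?d + 2 * t * (e z - (e y - 1) + \<bar>\<kappa>\<bar> * (1 + ?d))"
    proof (rule flow_est[OF z])
      show "0 \<le> t" using t by simp
      fix r assume r: "0 \<le> r" "r < t"
      then have near: "dist (S r y) y < min r1 1" using \<tau>(2)[of r] t by auto
      then show "ereal (e y - 1) \<le> E (S r y)" using r1 by auto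
      have "dist (S r y) z \<le> 1 + dist y z"
        using near dist_triangle[of "S r y" z y] by simp
      then have "(dist (S r y) z)\<^sup>2 \<le> (1 + dist y z)\<^sup>2"
        by (intro power_mono) auto
      also have "\<dots> \<le> 2 * (1 + ?d)"
        using zero_le_power2[of "1 - dist y z"] by (simp add: power2_eq_square algebra_simps)
      finally have "\<bar>\<kappa>\<bar>/2 * (dist (S r y) z)\<^sup>2 \<le> \<bar>\<kappa>\<bar>/2 * (2 * (1 + ?d))"
        by (intro mult_left_mono) auto
      moreover have "- (\<kappa>/2 * (dist (S r y) z)\<^sup>2) \<le> \<bar>\<kappa>\<bar>/2 * (dist (S r y) z)\<^sup>2"
        using mult_right_mono[of "- \<kappa>/2" "\<bar>\<kappa>\<bar>/2" "(dist (S r y) z)\<^sup>2"] by auto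
      moreover have "\<bar>\<kappa>\<bar>/2 * (2 * (1 + ?d)) = \<bar>\<kappa>\<bar> * (1 + ?d)" by simp
      ultimately show "- (\<kappa>/2 * (dist (S r y) z)\<^sup>2) \<le> \<bar>\<kappa>\<bar> * (1 + ?d)"
        by linarith
    qed
    then have "0 \<le> ?d + 2 * t * (e z - (e y - 1) + \<bar>\<kappa>\<bar> * (1 + ?d))"
      using zero_le_power2 order_trans by blast
    then have "0 \<le> (?d + 2 * t * (e z - (e y - 1) + \<bar>\<kappa>\<bar> * (1 + ?d))) / (2 * t)"
      using t by simp
    also have "\<dots> = ?d / (2 * t) + e z - (e y - 1) + \<bar>\<kappa>\<bar> * (1 + ?d)"
      using t by (simp add: field_simps)
    finally have "- (?d / (2 * t)) + (e y - 1) - \<bar>\<kappa>\<bar> * (1 + ?d) \<le> e z" by simp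
    moreover have "?d / (2 * t) \<le> 1 / (2 * t) * (1 + ?d)" using t by (simp add: field_simps)
    moreover have "- (\<bar>e y - 1\<bar> * (1 + ?d)) \<le> e y - 1"
    proof -
      have "\<bar>e y - 1\<bar> \<le> \<bar>e y - 1\<bar> * (1 + ?d)" by (simp add: algebra_simps)
      then show ?thesis by linarith
    qed
    moreover have "- (\<bar>e y - 1\<bar> + \<bar>\<kappa>\<bar> + 1 / (2 * t)) * (1 + ?d)
        = - (\<bar>e y - 1\<bar> * (1 + ?d)) - \<bar>\<kappa>\<bar> * (1 + ?d) - 1 / (2 * t) * (1 + ?d)"
      by (simp only: distrib_right minus_mult_left[symmetric])
    ultimately have "- (\<bar>e y - 1\<bar> + \<bar>\<kappa>\<bar> + 1 / (2 * t)) * (1 + ?d) \<le> e z"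
      by linarith
    moreover have "- C * (1 + ?d) \<le> - (\<bar>e y - 1\<bar> + \<bar>\<kappa>\<bar> + 1 / (2 * t)) * (1 + ?d)"
      by (intro mult_right_mono) (auto simp: C_def)
    ultimately show ?thesis by (simp add: dist_commute)
  qed
  moreover have "0 < C" using t by (auto simp: C_def add_pos_nonneg)
  ultimately show ?thesis by blast
qed

end

section \<open>Slope, convexity and dissipation\<close>

definition real_slope :: "('a::metric_space \<Rightarrow> ereal) \<Rightarrow> 'a \<Rightarrow> real" where
  "real_slope E x = real_of_ereal (local_slope E x)"

context evi_space
begin

abbreviation "DI \<equiv> information_dom E"
abbreviation "slope \<equiv> real_slope E"

lemma slope_nonneg: "0 \<le> slope x"
  unfolding real_slope_def by (intro real_of_ereal_pos) (simp add: local_slope_def)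

lemma information_dom_iff: "x \<in> DI \<longleftrightarrow> x \<in> D \<and> local_slope E x < \<infinity>"
proof -
  have "(local_slope E x)\<^sup>2 < \<infinity> \<longleftrightarrow> local_slope E x < \<infinity>" if "0 \<le> local_slope E x"
    using that by (cases "local_slope E x") (auto simp: power2_eq_square)
  then show ?thesis
    by (auto simp: information_dom_def information_def local_slope_def)
qed

lemma slope_eq: "x \<in> DI \<Longrightarrow> local_slope E x = ereal (slope x)"
proof -
  assume "x \<in> DI"
  moreover have "0 \<le> local_slope E x" by (simp add: local_slope_def)
  ultimately show ?thesis
    by (cases "local_slope E x") (auto simp: information_dom_iff real_slope_def)
qed

lemma DI_D: "x \<in> DI \<Longrightarrow> x \<in> D"
  by (simp add: information_dom_iff)

text \<open>Only nearby points of lower energy have to be examined, since all others contribute 0 to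
  the slope.\<close>

lemma DI_I:
  assumes x: "x \<in> D" and r: "0 < r" and C: "0 \<le> C"
    and le: "\<And>z. \<lbrakk>dist z x < r; z \<in> D; e z \<le> e x\<rbrakk> \<Longrightarrow> e x \<le> e z + C * dist z x"
  shows "x \<in> DI"
proof -
  have "eventually (\<lambda>z. max 0 (E x - E z) / ereal (dist x z) \<le> ereal C) (at x)"
    unfolding eventually_at
  proof (intro exI[of _ r] conjI ballI impI r)
    fix z assume z: "z \<noteq> x \<and> dist z x < r"
    show "max 0 (E x - E z) / ereal (dist x z) \<le> ereal C"
    proof (cases "z \<in> D \<and> e z \<le> e x")
      case True
      then show ?thesis using le[of z] z C x
        by (auto simp: E_eq dist_commute divide_simps max_def)
    next
      case False
      have "E x - E z \<le> 0"
        using False E_eq[OF x] E_eq[of z] by (cases "z \<in> D") (auto simp: energy_dom_def)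
      then have "max 0 (E x - E z) = 0" by (simp add: max_def)
      then show ?thesis using C by simp
    qed
  qed
  then have "Limsup (at x) (\<lambda>z. max 0 (E x - E z) / ereal (dist x z)) \<le> ereal C"
    by (rule Limsup_bounded)
  then have "local_slope E x \<le> ereal C"
    using C by (simp add: local_slope_def)
  then show ?thesis using x by (auto simp: information_dom_iff)
qed

lemma slope_approx:
  assumes x: "x \<in> DI" and s: "0 \<le> s" "s < slope x" and \<tau>: "0 < \<tau>"
  shows "\<exists>z\<in>D. z \<noteq> x \<and> dist z x < \<tau> \<and> e z < e x - s * dist x z"
proof (rule ccontr)
  assume neg: "\<not> ?thesis"
  have "eventually (\<lambda>z. max 0 (E x - E z) / ereal (dist x z) \<le> ereal s) (at x)"
    unfolding eventually_at
  proof (intro exI[of _ \<tau>] conjI ballI impI \<tau>)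
    fix z assume z: "z \<noteq> x \<and> dist z x < \<tau>"
    show "max 0 (E x - E z) / ereal (dist x z) \<le> ereal s"
    proof (cases "z \<in> D")
      case True
      then have "e x - s * dist x z \<le> e z" using neg z by force
      then show ?thesis using True z s(1) DI_D[OF x]
        by (auto simp: E_eq dist_commute divide_simps max_def)
    next
      case False
      then have "max 0 (E x - E z) = 0"
        using E_eq[OF DI_D[OF x]] by (auto simp: energy_dom_def max_def)
      then show ?thesis using s by simp
    qed
  qed
  then have "Limsup (at x) (\<lambda>z. max 0 (E x - E z) / ereal (dist x z)) \<le> ereal s"
    by (rule Limsup_bounded)
  then have "local_slope E x \<le> ereal s"
    using s by (simp add: local_slope_def)
  then show False using s slope_eq[OF x] by simp
qed

lemma slope_bound:
  assumes x: "x \<in> DI" and s: "slope x < s"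
  shows "\<exists>r>0. \<forall>z\<in>D. dist z x < r \<longrightarrow> e x - e z \<le> s * dist x z"
proof -
  have "Limsup (at x) (\<lambda>z. max 0 (E x - E z) / ereal (dist x z)) \<le> local_slope E x"
    by (simp add: local_slope_def)
  also have "\<dots> < ereal s" using s slope_eq[OF x] by simp
  finally have "eventually (\<lambda>z. max 0 (E x - E z) / ereal (dist x z) < ereal s) (at x)"
    by (rule Limsup_lessD)
  then obtain r where r: "0 < r"
    "\<And>z. \<lbrakk>z \<noteq> x; dist z x < r\<rbrakk> \<Longrightarrow> max 0 (E x - E z) / ereal (dist x z) < ereal s"
    unfolding eventually_at by auto
  have "e x - e z \<le> s * dist x z" if "z \<in> D" "dist z x < r" for z
  proof (cases "z = x")
    case False
    with r(2)[of z] that have "max 0 (e x - e z) / dist x z < s"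
      by (simp add: E_eq DI_D[OF x] max_def zero_ereal_def split: if_splits)
    then have "max 0 (e x - e z) < s * dist x z" using False by (simp add: divide_simps)
    then show ?thesis by linarith
  qed simp
  with r(1) show ?thesis by blast
qed

text \<open>A known consequence of the EVI, valid along every geodesic. The flow from
  \<open>\<zeta> t\<close> is tested with both endpoints, with weights \<open>1 - t\<close> and
  \<open>t\<close>. The weighted sum of squared distances is already minimal at
  \<open>\<zeta> t\<close>, so it cannot decrease, and this bounds the energy there. Using
  \<open>\<bar>\<kappa>\<bar>\<close> treats both signs of \<kappa> alike.\<close>

lemma geodesic_convexity:
  assumes x: "x \<in> D" and y: "y \<in> D" and \<zeta>: "is_geodesic \<zeta> x y" and t: "0 \<le> t" "t \<le> 1"
  shows "E (\<zeta> t) \<le> ereal ((1 - t) * e x + t * e y + \<bar>\<kappa>\<bar>/2 * (t * (1 - t)) * (dist x y)\<^sup>2)"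
proof (rule ccontr)
  define d where "d = dist x y"
  define c where "c = (1 - t) * e x + t * e y + \<bar>\<kappa>\<bar>/2 * (t * (1 - t)) * d\<^sup>2"
  assume "\<not> ?thesis"
  then have "ereal c < E (\<zeta> t)" by (simp add: c_def d_def not_le)
  \<comment> \<open>The energy at \<open>\<zeta> t\<close> may be infinite; a real level strictly
    below it and above \<open>c\<close> takes its place.\<close>
  then obtain m where m: "c < m" "ereal m < E (\<zeta> t)"
    by (metis ereal_dense2 ereal_less_eq(3) less_ereal.simps(1) not_le)
  define \<eta> where "\<eta> = m - c"
  have \<eta>: "0 < \<eta>" using m by (simp add: \<eta>_def)
  have dx: "dist (\<zeta> t) x = t * d"
    using \<zeta> t unfolding is_geodesic_def d_def
    by (metis abs_of_nonneg atLeastAtMost_iff diff_zero dist_commute order_refl zero_le_one)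
  have dy: "dist (\<zeta> t) y = (1 - t) * d"
    using \<zeta> t unfolding is_geodesic_def d_def
    by (metis abs_of_nonneg atLeastAtMost_iff diff_ge_0_iff_ge order_refl zero_le_one)
  obtain r1 where r1: "0 < r1" "\<And>z. dist z (\<zeta> t) < r1 \<Longrightarrow> ereal m < E z"
    using lsc_E[OF m(2)] by auto
  define g where "g = (\<lambda>z r. \<bar>\<kappa>\<bar>/2 * (dist (S r (\<zeta> t)) z)\<^sup>2)"
  have lim: "((\<lambda>r. g z r) \<longlongrightarrow> \<bar>\<kappa>\<bar>/2 * (dist (\<zeta> t) z)\<^sup>2) (at_right 0)" for z
    unfolding g_def by (intro tendsto_intros flow_tendsto)
  have ev: "eventually (\<lambda>r. g z r < \<bar>\<kappa>\<bar>/2 * (dist (\<zeta> t) z)\<^sup>2 + \<eta>/2) (at_right 0)" for z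
    using order_tendstoD(2)[OF lim[of z], of "\<bar>\<kappa>\<bar>/2 * (dist (\<zeta> t) z)\<^sup>2 + \<eta>/2"] \<eta> by simp
  obtain b where b: "0 < b"
    "\<And>r. \<lbrakk>0 < r; r < b\<rbrakk> \<Longrightarrow> g x r < \<bar>\<kappa>\<bar>/2 * (dist (\<zeta> t) x)\<^sup>2 + \<eta>/2 \<and> g y r < \<bar>\<kappa>\<bar>/2 * (dist (\<zeta> t) y)\<^sup>2 + \<eta>/2"
    using eventually_conj[OF ev[of x] ev[of y]] by (auto simp: eventually_at_right_field)
  obtain \<tau> where \<tau>: "0 < \<tau>" "\<And>r. \<lbrakk>0 \<le> r; r < \<tau>\<rbrakk> \<Longrightarrow> dist (S r (\<zeta> t)) (\<zeta> t) < r1"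
    using flow_near[OF r1(1), of "\<zeta> t"] by auto
  define r where "r = min b \<tau> / 2"
  have r: "0 < r" "r < b" "r < \<tau>" using b \<tau> by (auto simp: r_def)
  have est: "(dist (S r (\<zeta> t)) z)\<^sup>2 \<le> (dist (\<zeta> t) z)\<^sup>2 + 2 * r * (e z - m + (\<bar>\<kappa>\<bar>/2 * (dist (\<zeta> t) z)\<^sup>2 + \<eta>/2))"
    if z: "z \<in> D" "z = x \<or> z = y" for z
  proof (rule flow_est[OF z(1)])
    show "0 \<le> r" using r by simp
    fix q assume q: "0 \<le> q" "q < r"
    show "ereal m \<le> E (S q (\<zeta> t))" using r1(2)[OF \<tau>(2)[of q]] q r by simp
    have "g z q \<le> \<bar>\<kappa>\<bar>/2 * (dist (\<zeta> t) z)\<^sup>2 + \<eta>/2"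
      using b(2)[of q] z(2) q r \<eta> by (cases "q = 0") (auto simp: g_def flow_0)
    moreover have "- (\<kappa>/2 * (dist (S q (\<zeta> t)) z)\<^sup>2) \<le> g z q"
      using mult_right_mono[of "-\<kappa>" "\<bar>\<kappa>\<bar>" "(dist (S q (\<zeta> t)) z)\<^sup>2"] by (simp add: g_def)
    ultimately show "- (\<kappa>/2 * (dist (S q (\<zeta> t)) z)\<^sup>2) \<le> \<bar>\<kappa>\<bar>/2 * (dist (\<zeta> t) z)\<^sup>2 + \<eta>/2" by linarith
  qed
  define A where "A = dist (S r (\<zeta> t)) x"
  define B where "B = dist (S r (\<zeta> t)) y"
  have "d \<le> A + B" using dist_triangle3[of x y "S r (\<zeta> t)"] by (simp add: d_def A_def B_def)
  then have "d\<^sup>2 \<le> (A + B)\<^sup>2" by (intro power_mono) (auto simp: d_def)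
  \<comment> \<open>Completing the square in \<open>A\<close> and \<open>B\<close>, with
    \<open>d \<le> A + B\<close>: the weighted sum of squares is at least
    \<open>t * (1 - t) * d\<^sup>2\<close>, its value at \<open>\<zeta> t\<close>.\<close>
  then have "t * (1 - t) * d\<^sup>2 \<le> t * (1 - t) * (A + B)\<^sup>2" using t by (intro mult_left_mono) auto
  also have "\<dots> = (1 - t) * A\<^sup>2 + t * B\<^sup>2 - ((1 - t) * A - t * B)\<^sup>2"
    by (simp add: power2_eq_square algebra_simps)
  also have "\<dots> \<le> (1 - t) * A\<^sup>2 + t * B\<^sup>2" by simp
  also have "\<dots> \<le> (1 - t) * ((t * d)\<^sup>2 + 2 * r * (e x - m + (\<bar>\<kappa>\<bar>/2 * (t * d)\<^sup>2 + \<eta>/2)))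
      + t * (((1 - t) * d)\<^sup>2 + 2 * r * (e y - m + (\<bar>\<kappa>\<bar>/2 * ((1 - t) * d)\<^sup>2 + \<eta>/2)))"
    using est[OF x] est[OF y] t by (intro add_mono mult_left_mono) (auto simp: A_def B_def dx dy)
  also have "\<dots> = t * (1 - t) * d\<^sup>2 + 2 * r * (c - m + \<eta>/2)"
    by (simp add: c_def power2_eq_square field_simps)
  also have "\<dots> = t * (1 - t) * d\<^sup>2 - r * \<eta>" by (simp add: \<eta>_def field_simps)
  finally have "r * \<eta> \<le> 0" by simp
  with r \<eta> show False by (simp add: mult_le_0_iff)
qed

text \<open>Convexity turns the local slope into a bound on global difference quotients: along a
  geodesic from \<open>x\<close> to \<open>y\<close> the energy already drops near \<open>x\<close>
  at the rate of the chord, up to the convexity defect.\<close>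

lemma slope_lower_bound:
  assumes x: "x \<in> DI" and y: "y \<in> D" and ne: "x \<noteq> y"
  shows "(e x - e y) / dist x y - \<bar>\<kappa>\<bar>/2 * dist x y \<le> slope x"
proof (rule ccontr)
  define d where "d = dist x y"
  have d: "0 < d" using ne by (simp add: d_def)
  assume "\<not> ?thesis"
  then obtain s where s: "slope x < s" "s < (e x - e y) / d - \<bar>\<kappa>\<bar>/2 * d"
    unfolding d_def by (metis dense not_le)
  obtain r where r: "0 < r" "\<And>z. \<lbrakk>z \<in> D; dist z x < r\<rbrakk> \<Longrightarrow> e x - e z \<le> s * dist x z"
    using slope_bound[OF x s(1)] by auto
  obtain \<zeta> where \<zeta>: "is_geodesic \<zeta> x y"
    using metric_energy by (auto simp: metric_energy_assumption_def)
  define t where "t = min 1 (r / (2 * d))"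
  have t: "0 < t" "t \<le> 1" using r d by (auto simp: t_def)
  have dz: "dist x (\<zeta> t) = t * d"
    using \<zeta> t unfolding is_geodesic_def d_def
    by (metis abs_of_nonneg atLeastAtMost_iff diff_zero order_refl zero_le_one less_imp_le)
  have "t * d \<le> r / (2 * d) * d" using d by (intro mult_right_mono) (auto simp: t_def)
  then have near: "dist (\<zeta> t) x < r" using dz d r by (simp add: dist_commute)
  have conv: "E (\<zeta> t) \<le> ereal ((1 - t) * e x + t * e y + \<bar>\<kappa>\<bar>/2 * (t * (1 - t)) * d\<^sup>2)"
    unfolding d_def using t by (intro geodesic_convexity[OF DI_D[OF x] y \<zeta>]) auto
  then have z: "\<zeta> t \<in> D" "e (\<zeta> t) \<le> (1 - t) * e x + t * e y + \<bar>\<kappa>\<bar>/2 * (t * (1 - t)) * d\<^sup>2"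
    by (simp_all add: E_le_iff)
  have "\<bar>\<kappa>\<bar>/2 * (t * (1 - t)) * d\<^sup>2 \<le> \<bar>\<kappa>\<bar>/2 * t * d\<^sup>2"
    using t by (intro mult_right_mono mult_left_mono) (auto simp: mult_le_cancel_left1)
  then have "t * (e x - e y) - \<bar>\<kappa>\<bar>/2 * t * d\<^sup>2 \<le> s * (t * d)"
    using r(2)[OF z(1) near] z(2) dz by (simp add: algebra_simps add_divide_distrib diff_divide_distrib)
  then have "t * ((e x - e y) - \<bar>\<kappa>\<bar>/2 * d\<^sup>2) \<le> t * (s * d)" by (simp add: algebra_simps)
  then have "(e x - e y) - \<bar>\<kappa>\<bar>/2 * d\<^sup>2 \<le> s * d" using t by simp
  moreover have "s * d < ((e x - e y) / d - \<bar>\<kappa>\<bar>/2 * d) * d" using s d by (intro mult_strict_right_mono)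
  moreover have "((e x - e y) / d - \<bar>\<kappa>\<bar>/2 * d) * d = (e x - e y) - \<bar>\<kappa>\<bar>/2 * d\<^sup>2"
    using d by (simp add: field_simps power2_eq_square)
  ultimately show False by linarith
qed

text \<open>The flow in fact dissipates energy at the rate of the squared slope. Half of that rate, along some
  sequence of times, suffices here and follows from testing the EVI up to time \<open>t\<close> with a point
  that almost realizes the slope \<open>s\<close> at distance \<open>s t\<close>.\<close>

lemma dissipation:
  assumes x: "x \<in> DI" and \<eta>: "0 < \<eta>" and \<tau>: "0 < \<tau>"
  shows "\<exists>t>0. t < \<tau> \<and> e (S t x) \<le> e x - t * ((slope x)\<^sup>2 / 2 - \<eta>)"
proof (cases "(slope x)\<^sup>2 / 2 - \<eta> \<le> 0")
  case True
  have "e (S (\<tau>/2) x) \<le> e x" using e_antimono[OF DI_D[OF x]] \<tau> by simp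
  moreover have "\<tau>/2 * ((slope x)\<^sup>2 / 2 - \<eta>) \<le> 0" using True \<tau> by (simp add: mult_le_0_iff)
  ultimately have "e (S (\<tau>/2) x) \<le> e x - \<tau>/2 * ((slope x)\<^sup>2 / 2 - \<eta>)" by linarith
  then show ?thesis using \<tau> by (intro exI[of _ "\<tau>/2"]) auto
next
  case False
  define s where "s = slope x"
  have s: "0 < s" using False slope_nonneg[of x] \<eta> by (cases "slope x = 0") (auto simp: s_def)
  \<comment> \<open>The second bound makes the loss in the square at most \<eta>, that is
    \<open>s\<^sup>2 - \<eta> \<le> s1\<^sup>2\<close>; the first keeps \<open>s1\<close>
    positive.\<close>
  define m where "m = min (s/2) (\<eta> / (2 * s))"
  define s1 where "s1 = s - m"
  have m: "0 < m" "m \<le> s/2" "2 * s * m \<le> \<eta>"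
    using s \<eta> mult_left_mono[of m "\<eta> / (2 * s)" "2 * s"] by (auto simp: m_def)
  have s1: "0 < s1" "s1 < s" using m s by (auto simp: s1_def)
  have "s1\<^sup>2 = s\<^sup>2 - 2 * s * m + m\<^sup>2" by (simp add: s1_def power2_eq_square algebra_simps)
  then have s1sq: "s\<^sup>2 - \<eta> \<le> s1\<^sup>2" using m(3) zero_le_power2[of m] by linarith
  define \<eta>1 where "\<eta>1 = \<eta> / (8 * (\<bar>\<kappa>\<bar> + 1))"
  have \<eta>1: "0 < \<eta>1" "\<bar>\<kappa>\<bar> * (2 * \<eta>1) \<le> \<eta>/4" using \<eta> by (auto simp: \<eta>1_def divide_simps)
  \<comment> \<open>With \<open>x\<close> itself as reference point (radius 0) the squared
    displacement is bounded by an arbitrarily small multiple of \<open>t\<close>, so the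
    \<kappa>-term \<open>B\<close> below is negligible against \<open>t\<close>.\<close>
  obtain \<tau>1 where \<tau>1: "0 < \<tau>1" "\<And>t. \<lbrakk>0 \<le> t; t < \<tau>1\<rbrakk> \<Longrightarrow> (dist (S t x) x)\<^sup>2 \<le> 2 * t * \<eta>1"
    using flow_small[OF DI_D[OF x] \<eta>1(1), of 0] DI_D[OF x] by force
  define \<tau>2 where "\<tau>2 = \<eta> / 4 / ((\<bar>\<kappa>\<bar> + 1) * (s1\<^sup>2 + 1))"
  have K1: "0 < (\<bar>\<kappa>\<bar> + 1) * (s1\<^sup>2 + 1)" by (intro mult_pos_pos) (auto simp: add_nonneg_pos)
  then have \<tau>2: "0 < \<tau>2" unfolding \<tau>2_def using \<eta> by (intro divide_pos_pos) auto
  define b where "b = min \<tau> (min \<tau>1 \<tau>2)"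
  have b: "0 < b" using \<tau> \<tau>1 \<tau>2 by (simp add: b_def)
  obtain z where z: "z \<in> D" "z \<noteq> x" "dist z x < s1 * b" "e z < e x - s1 * dist x z"
    using slope_approx[OF x, of s1 "s1 * b"] s1 b by (auto simp: s_def)
  \<comment> \<open>For a point at distance \<open>d\<close> the test up to time \<open>t\<close>
    yields, apart from \<open>B\<close>, the decrease \<open>s1 * d - d\<^sup>2 / (2 * t)\<close>.
    Relative to \<open>t\<close> this is largest at \<open>d = s1 * t\<close>. The slope prescribes
    the point, hence the time is fitted to the distance.\<close>
  define t where "t = dist x z / s1"
  have dt: "dist x z = s1 * t" using s1 by (simp add: t_def)
  have t: "0 < t" "t < b" using z s1 by (auto simp: t_def divide_simps dist_commute mult.commute)
  define B where "B = \<bar>\<kappa>\<bar> * (2 * t * \<eta>1 + s1\<^sup>2 * t\<^sup>2)"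
  have "(dist (S t x) z)\<^sup>2 \<le> (dist x z)\<^sup>2 + 2 * t * (e z - e (S t x) + B)"
  proof (rule flow_est[OF z(1)])
    show "0 \<le> t" using t by simp
    fix r assume r: "0 \<le> r" "r < t"
    show "ereal (e (S t x)) \<le> E (S r x)"
      using energy_antimono[of r t x] r E_eq[OF flow_dom[OF t(1)], of x] by simp
    have "dist (S r x) z \<le> dist (S r x) x + dist x z" by (rule dist_triangle)
    then have "(dist (S r x) z)\<^sup>2 \<le> (dist (S r x) x + dist x z)\<^sup>2" by (intro power_mono) auto
    also have "\<dots> \<le> 2 * ((dist (S r x) x)\<^sup>2 + (dist x z)\<^sup>2)"
      using zero_le_power2[of "dist (S r x) x - dist x z"] by (simp add: power2_eq_square algebra_simps)
    also have "\<dots> \<le> 2 * (2 * t * \<eta>1 + s1\<^sup>2 * t\<^sup>2)"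
    proof -
      have "(dist (S r x) x)\<^sup>2 \<le> 2 * r * \<eta>1" using \<tau>1(2)[of r] r t by (simp add: b_def)
      also have "\<dots> \<le> 2 * t * \<eta>1" using r \<eta>1 by (intro mult_right_mono) auto
      finally show ?thesis by (simp add: dt power_mult_distrib mult_ac)
    qed
    finally have "\<bar>\<kappa>\<bar>/2 * (dist (S r x) z)\<^sup>2 \<le> \<bar>\<kappa>\<bar>/2 * (2 * (2 * t * \<eta>1 + s1\<^sup>2 * t\<^sup>2))"
      by (intro mult_left_mono) auto
    moreover have "- (\<kappa>/2 * (dist (S r x) z)\<^sup>2) \<le> \<bar>\<kappa>\<bar>/2 * (dist (S r x) z)\<^sup>2"
      using mult_right_mono[of "- \<kappa>/2" "\<bar>\<kappa>\<bar>/2" "(dist (S r x) z)\<^sup>2"] by auto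
    moreover have "\<bar>\<kappa>\<bar>/2 * (2 * (2 * t * \<eta>1 + s1\<^sup>2 * t\<^sup>2)) = B" by (simp add: B_def)
    ultimately show "- (\<kappa>/2 * (dist (S r x) z)\<^sup>2) \<le> B" by linarith
  qed
  then have "0 \<le> (s1 * t)\<^sup>2 + 2 * t * (e z - e (S t x) + B)"
    unfolding dt by (rule order_trans[OF zero_le_power2])
  also have "\<dots> = 2 * t * (s1\<^sup>2 * t / 2 + e z - e (S t x) + B)"
    by (simp add: power2_eq_square algebra_simps)
  finally have "e (S t x) \<le> s1\<^sup>2 * t / 2 + e z + B" using t by (simp add: zero_le_mult_iff)
  also have "\<dots> \<le> s1\<^sup>2 * t / 2 + (e x - s1 * (s1 * t)) + B" using z(4) dt by simp
  also have "\<dots> = e x - t * (s1\<^sup>2 / 2 - \<bar>\<kappa>\<bar> * (2 * \<eta>1) - \<bar>\<kappa>\<bar> * s1\<^sup>2 * t)"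
    by (simp add: B_def power2_eq_square algebra_simps)
  also have "\<dots> \<le> e x - t * (s\<^sup>2 / 2 - \<eta>)"
  proof -
    have "\<bar>\<kappa>\<bar> * s1\<^sup>2 * t \<le> ((\<bar>\<kappa>\<bar> + 1) * (s1\<^sup>2 + 1)) * \<tau>2"
      using t by (intro mult_mono) (auto simp: b_def algebra_simps)
    also have "\<dots> = \<eta> / 4"
      unfolding \<tau>2_def using K1
      by (metis less_irrefl nonzero_mult_div_cancel_left times_divide_eq_right)
    finally have "s\<^sup>2 / 2 - \<eta> \<le> s1\<^sup>2 / 2 - \<bar>\<kappa>\<bar> * (2 * \<eta>1) - \<bar>\<kappa>\<bar> * s1\<^sup>2 * t"
      using \<eta>1(2) s1sq by linarith
    then show ?thesis using t by (simp add: mult_left_mono)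
  qed
  finally show ?thesis using t by (intro exI[of _ t]) (auto simp: b_def s_def)
qed

end

section \<open>A smooth variational principle\<close>

text \<open>The centres come from a prescribed dense set \<open>C\<close>, because only points of
  finite information may be centres of test functions. The total weight \<open>W\<close> is
  prescribed separately from the tolerance \<eta>, so that the first-order effect of the
  perturbation can be made as small as desired. The last conclusion says that the maximum is strong:
  near-maximizers are close to \<open>x\<^sub>0\<close>, which replaces compactness.\<close>

lemma borwein_preiss:
  fixes X C :: "'b::metric_space set" and \<Phi> :: "'b \<Rightarrow> real"
  assumes X: "complete X" "X \<noteq> {}" "bounded X"
    and bdd: "\<And>x. x \<in> X \<Longrightarrow> \<Phi> x \<le> M"
    and usc: "\<And>x a. \<lbrakk>x \<in> X; \<Phi> x < a\<rbrakk> \<Longrightarrow> \<exists>r>0. \<forall>y\<in>X. dist y x < r \<longrightarrow> \<Phi> y < a"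
    and dense_C: "\<And>x r. \<lbrakk>x \<in> X; 0 < r\<rbrakk> \<Longrightarrow> \<exists>c\<in>C. dist c x < r"
    and pos: "0 < \<eta>" "0 < W"
  obtains w :: "nat \<Rightarrow> real" and c :: "nat \<Rightarrow> 'b" and x\<^sub>0
  where "\<And>i. 0 < w i" "w sums W" "\<And>i. c i \<in> C" "\<And>i. \<exists>y\<in>X. dist (c i) y \<le> 1" "x\<^sub>0 \<in> X"
    "\<And>x. x \<in> X \<Longrightarrow> summable (\<lambda>i. w i * (dist x (c i))\<^sup>2)"
    "\<And>x. x \<in> X \<Longrightarrow>
      \<Phi> x - (\<Sum>i. w i * (dist x (c i))\<^sup>2) \<le> \<Phi> x\<^sub>0 - (\<Sum>i. w i * (dist x\<^sub>0 (c i))\<^sup>2)"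
    "\<And>x. x \<in> X \<Longrightarrow> \<Phi> x \<le> \<Phi> x\<^sub>0 + \<eta>"
    "\<And>r. 0 < r \<Longrightarrow> \<exists>e>0. \<forall>x\<in>X. \<Phi> x\<^sub>0 - (\<Sum>i. w i * (dist x\<^sub>0 (c i))\<^sup>2) - e
        < \<Phi> x - (\<Sum>i. w i * (dist x (c i))\<^sup>2) \<longrightarrow> dist x x\<^sub>0 < r"
proof -
  define w where "w = (\<lambda>i::nat. W / 2 ^ Suc i)"
  have w: "0 < w i" for i using pos by (simp add: w_def)
  have "(\<lambda>i. W * (1/2) ^ Suc i) sums (W * 1)"
    by (intro sums_mult power_half_series)
  then have wsum: "w sums W" by (simp add: w_def power_divide)
  \<comment> \<open>The tolerances must decay at least by a factor 3, for the monotonicity in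
    \<open>step\<close>, and faster than the weights, so that \<open>\<delta> n / w n\<close> tends
    to 0. The factor \<open>1/3\<close> turns the bound \<open>3 * \<delta> 0\<close> into
    \<eta>.\<close>
  define \<delta> where "\<delta> = (\<lambda>i::nat. \<eta> / 3 / 16 ^ i)"
  have \<delta>: "0 < \<delta> i" "\<delta> (Suc i) = \<delta> i / 16" for i using pos by (auto simp: \<delta>_def)
  \<comment> \<open>State of the recursion: the functional after \<open>n\<close> perturbations, a
    near-maximizer of it, and the next centre, taken from \<open>C\<close> so close to the
    near-maximizer that the new perturbation costs at most \<open>\<delta> n\<close> there.\<close>
  define P :: "nat \<Rightarrow> ('b \<Rightarrow> real) \<times> 'b \<times> 'b \<Rightarrow> bool" where
    "P = (\<lambda>n (F, x, c). x \<in> X \<and> c \<in> C \<and> dist c x \<le> 1 \<and> w n * (dist x c)\<^sup>2 \<le> \<delta> n \<and>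
      (\<forall>y\<in>X. F y \<le> F x + \<delta> n) \<and> (\<forall>y\<in>X. F y \<le> M))"
  define Q :: "nat \<Rightarrow> ('b \<Rightarrow> real) \<times> 'b \<times> 'b \<Rightarrow> ('b \<Rightarrow> real) \<times> 'b \<times> 'b \<Rightarrow> bool" where
    "Q = (\<lambda>n (F, x, c) (F', _, _). F' = (\<lambda>y. F y - w n * (dist y c)\<^sup>2))"
  have ex: "\<exists>x c. P n (F, x, c)" if F: "\<forall>y\<in>X. F y \<le> M" for F n
  proof -
    have bF: "bdd_above (F ` X)" using F by auto
    obtain x where x: "x \<in> X" "Sup (F ` X) - \<delta> n < F x"
      using less_cSUP_iff[OF X(2) bF, of "Sup (F ` X) - \<delta> n"] \<delta>(1)[of n] by auto
    define r where "r = min 1 (sqrt (\<delta> n / w n))"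
    have r: "0 < r" using \<delta>(1)[of n] w[of n] by (simp add: r_def)
    obtain c where c: "c \<in> C" "dist c x < r" using dense_C[OF x(1) r] by auto
    have "(dist x c)\<^sup>2 \<le> (sqrt (\<delta> n / w n))\<^sup>2"
      using c by (intro power_mono) (auto simp: r_def dist_commute)
    also have "\<dots> = \<delta> n / w n" using \<delta>(1)[of n] w[of n] by simp
    finally have "w n * (dist x c)\<^sup>2 \<le> \<delta> n"
      using w[of n] by (simp add: field_simps)
    moreover have "F y \<le> F x + \<delta> n" if "y \<in> X" for y
      using cSUP_upper[OF that bF] x(2) by linarith
    ultimately have "P n (F, x, c)" using x c F by (auto simp: P_def r_def)
    then show ?thesis by blast
  qed
  have "\<exists>f. (\<forall>n. P n (f n)) \<and> (\<forall>n. Q n (f n) (f (Suc n))) \<and> fst (f 0) = \<Phi>"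
  proof -
    define P' where "P' = (\<lambda>n f. P n f \<and> (n = 0 \<longrightarrow> fst f = \<Phi>))"
    obtain x c where "P 0 (\<Phi>, x, c)" using ex[of \<Phi> 0] bdd by auto
    then have "\<exists>f. P' 0 f" by (auto simp: P'_def)
    moreover have "\<exists>g. P' (Suc n) g \<and> Q n f g" if f: "P' n f" for f n
    proof -
      obtain F x c where [simp]: "f = (F, x, c)" by (cases f)
      let ?F = "\<lambda>y. F y - w n * (dist y c)\<^sup>2"
      have "?F y \<le> M" if "y \<in> X" for y
      proof -
        have "F y \<le> M" using f that by (auto simp: P'_def P_def)
        moreover have "0 \<le> w n * (dist y c)\<^sup>2" using w[of n] by simp
        ultimately show ?thesis by linarith
      qed
      then obtain x' c' where "P (Suc n) (?F, x', c')" using ex[of ?F "Suc n"] by auto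
      then show ?thesis by (intro exI[of _ "(?F, x', c')"]) (auto simp: P'_def Q_def)
    qed
    ultimately obtain f where "\<And>n. P' n (f n)" "\<And>n. Q n (f n) (f (Suc n))"
      using dependent_nat_choice[of P' Q] by blast
    then show ?thesis by (auto simp: P'_def)
  qed
  then obtain f where f: "\<And>n. P n (f n)" "\<And>n. Q n (f n) (f (Suc n))" "fst (f 0) = \<Phi>" by blast
  define F where "F = (\<lambda>n. fst (f n))"
  define x where "x = (\<lambda>n. fst (snd (f n)))"
  define c where "c = (\<lambda>n. snd (snd (f n)))"
  have f_eq: "f n = (F n, x n, c n)" for n by (simp add: F_def x_def c_def)
  have x: "x n \<in> X" and c: "c n \<in> C" "dist (c n) (x n) \<le> 1" and wx: "w n * (dist (x n) (c n))\<^sup>2 \<le> \<delta> n"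
    and near_max: "\<And>y. y \<in> X \<Longrightarrow> F n y \<le> F n (x n) + \<delta> n" for n
    using f(1)[of n] unfolding f_eq P_def by simp_all
  have F_Suc: "F (Suc n) y = F n y - w n * (dist y (c n))\<^sup>2" for n y
    using f(2)[of n] unfolding f_eq Q_def by simp
  have F_0: "F 0 = \<Phi>" using f(3) unfolding F_def .
  have F_sum: "F n y = \<Phi> y - (\<Sum>i<n. w i * (dist y (c i))\<^sup>2)" for n y
    by (induction n) (simp_all add: F_0 F_Suc)
  obtain d0 where d0: "\<And>y z. \<lbrakk>y \<in> X; z \<in> X\<rbrakk> \<Longrightarrow> dist y z \<le> d0"
    using X(3) unfolding bounded_two_points by blast
  define d where "d = d0 + 1"
  have d: "dist y (c i) \<le> d" if "y \<in> X" for y i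
    using d0[OF that x[of i]] c(2)[of i] dist_triangle[of y "c i" "x i"] by (simp add: d_def dist_commute)
  have term_le: "w i * (dist y (c i))\<^sup>2 \<le> w i * d\<^sup>2" if "y \<in> X" for y i
    using d[OF that] w[of i] by (intro mult_left_mono power_mono) auto
  have summ: "summable (\<lambda>i. w i * (dist y (c i))\<^sup>2)" if "y \<in> X" for y
  proof (rule summable_comparison_test)
    show "summable (\<lambda>i. w i * d\<^sup>2)" using wsum by (intro summable_mult2) (auto simp: sums_iff)
    show "\<exists>N. \<forall>n\<ge>N. norm (w n * (dist y (c n))\<^sup>2) \<le> w n * d\<^sup>2"
      using term_le[OF that] w by (auto simp: abs_mult less_imp_le)
  qed
  define V where "V = (\<lambda>y. \<Sum>i. w i * (dist y (c i))\<^sup>2)"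
  define \<Psi> where "\<Psi> = (\<lambda>y. \<Phi> y - V y)"
  have partial_le: "(\<Sum>i<n. w i * (dist y (c i))\<^sup>2) \<le> V y" if "y \<in> X" for n y
    unfolding V_def using summ[OF that] w by (intro sum_le_suminf) (auto simp: less_imp_le)
  have \<Psi>_le: "\<Psi> y \<le> F n y" if "y \<in> X" for n y
    using partial_le[OF that, of n] by (simp add: \<Psi>_def F_sum)
  define T where "T = (\<lambda>n. \<Sum>i. w (i + n) * d\<^sup>2)"
  have sumwd: "summable (\<lambda>i. w i * d\<^sup>2)" using wsum by (intro summable_mult2) (auto simp: sums_iff)
  have T_lim: "T \<longlonglongrightarrow> 0"
    unfolding T_def using sumwd by (rule suminf_exist_split2)
  have F_le: "F n y \<le> \<Psi> y + T n" if "y \<in> X" for n y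
  proof -
    have "V y = (\<Sum>i. w (i + n) * (dist y (c (i + n)))\<^sup>2) + (\<Sum>i<n. w i * (dist y (c i))\<^sup>2)"
      unfolding V_def by (rule suminf_split_initial_segment[OF summ[OF that]])
    moreover have "(\<Sum>i. w (i + n) * (dist y (c (i + n)))\<^sup>2) \<le> T n"
      unfolding T_def using summ[OF that] sumwd term_le[OF that]
      by (intro suminf_le) (auto simp: summable_iff_shift[where f = "\<lambda>i. w i * (dist y (c i))\<^sup>2"]
          summable_iff_shift[where f = "\<lambda>i. w i * d\<^sup>2"])
    ultimately show ?thesis by (simp add: \<Psi>_def F_sum)
  qed
  have b\<Psi>: "bdd_above (\<Psi> ` X)"
    by (intro bdd_aboveI2[of _ _ M] order_trans[OF \<Psi>_le[of _ 0]]) (auto simp: F_0 bdd)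
  define s where "s = Sup (\<Psi> ` X)"
  have \<Psi>_s: "\<Psi> y \<le> s" if "y \<in> X" for y
    unfolding s_def using that b\<Psi> by (rule cSUP_upper)
  \<comment> \<open>The new perturbation costs \<open>\<delta> n\<close> at \<open>x n\<close>, and
    \<open>x (Suc n)\<close> misses the supremum by at most \<open>\<delta> (Suc n)\<close>; the
    corrections \<open>2 * \<delta>\<close> turn the near-maximal values into an increasing
    sequence.\<close>
  have step: "F n (x n) - 2 * \<delta> n \<le> F (Suc n) (x (Suc n)) - 2 * \<delta> (Suc n)" for n
    using near_max[OF x[of n], of "Suc n"] wx[of n] \<delta>(1)[of n] F_Suc[of n "x n"] \<delta>(2)[of n] by linarith
  have mono: "F n (x n) - 2 * \<delta> n \<le> F j (x j) - 2 * \<delta> j" if "n \<le> j" for n j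
    using that step by (rule lift_Suc_mono_le[of "\<lambda>n. F n (x n) - 2 * \<delta> n", rotated])
  have F_s: "F n y \<le> s + 3 * \<delta> n" if y: "y \<in> X" for n y
  proof -
    have "F n y - 3 * \<delta> n - s \<le> T j" if "n \<le> j" for j
      using near_max[OF y, of n] mono[OF that] F_le[OF x[of j], of j] \<Psi>_s[OF x[of j]] \<delta>(1)[of j] by linarith
    then have "F n y - 3 * \<delta> n - s \<le> 0"
      by (intro LIMSEQ_le_const[OF T_lim]) auto
    then show ?thesis by simp
  qed
  \<comment> \<open>The \<open>n\<close>-th perturbation alone localizes: removing it raises the
    value by at most \<open>s + 3 * \<delta> n - \<Psi> y\<close>, and dividing by
    \<open>w n\<close> confines near-maximizers to a small ball around \<open>c n\<close>.\<close>
  have near: "\<exists>e>0. \<exists>z. \<forall>y\<in>X. s - e < \<Psi> y \<longrightarrow> dist y z < r" if r: "0 < r" for r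
  proof -
    have "(\<lambda>n. (2 * \<eta> / W) * (1/8) ^ n) \<longlonglongrightarrow> (2 * \<eta> / W) * 0"
      by (intro tendsto_intros LIMSEQ_realpow_zero) auto
    moreover have "3 * \<delta> n / w n = (2 * \<eta> / W) * (1/8) ^ n" for n
    proof -
      have "(16::real) ^ n = 2 ^ n * 8 ^ n" by (simp add: power_mult_distrib[symmetric])
      then show ?thesis using pos by (simp add: \<delta>_def w_def field_simps)
    qed
    ultimately have "(\<lambda>n. 3 * \<delta> n / w n) \<longlonglongrightarrow> 0" by simp
    from order_tendstoD(2)[OF this, of "r\<^sup>2/2"] r obtain n where n: "3 * \<delta> n / w n < r\<^sup>2/2"
      by (auto simp: eventually_sequentially)
    then have n': "3 * \<delta> n < w n * r\<^sup>2/2" using w[of n] by (simp add: field_simps)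
    have "dist y (c n) < r" if y: "y \<in> X" "s - w n * r\<^sup>2/2 < \<Psi> y" for y
    proof -
      have "w n * (dist y (c n))\<^sup>2 = F n y - F (Suc n) y" by (simp add: F_Suc)
      also have "\<dots> \<le> s + 3 * \<delta> n - \<Psi> y" using F_s[OF y(1), of n] \<Psi>_le[OF y(1), of "Suc n"] by linarith
      also have "\<dots> < w n * r\<^sup>2" using y n' by linarith
      finally have "(dist y (c n))\<^sup>2 < r\<^sup>2" using w[of n] by simp
      then show ?thesis using r by (simp add: power_less_imp_less_base)
    qed
    moreover have "0 < w n * r\<^sup>2/2" using w[of n] r by simp
    ultimately show ?thesis by blast
  qed
  have "\<exists>z\<in>X. s - 1 / real (Suc j) < \<Psi> z" for j
    using less_cSUP_iff[OF X(2) b\<Psi>, of "s - 1 / real (Suc j)"] by (simp add: s_def)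
  then obtain z where z: "\<And>j. z j \<in> X" "\<And>j. s - 1 / real (Suc j) < \<Psi> (z j)" by metis
  have z_lim: "(\<lambda>j. s - 1 / real (Suc j)) \<longlonglongrightarrow> s - 0"
    by (intro tendsto_intros LIMSEQ_Suc[OF lim_1_over_n])
  have "Cauchy z"
    unfolding Cauchy_def
  proof (intro allI impI)
    fix r :: real assume "0 < r"
    then obtain e p where e: "0 < e" "\<And>y. \<lbrakk>y \<in> X; s - e < \<Psi> y\<rbrakk> \<Longrightarrow> dist y p < r/2"
      using near[of "r/2"] by auto
    have "eventually (\<lambda>j. s - e < s - 1 / real (Suc j)) sequentially"
      using order_tendstoD(1)[OF z_lim, of "s - e"] e by simp
    then obtain N where N: "\<And>j. j \<ge> N \<Longrightarrow> s - e < s - 1 / real (Suc j)"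
      by (auto simp: eventually_sequentially)
    have "dist (z j) p < r/2" if "j \<ge> N" for j
      using N[OF that] z(2)[of j] by (intro e(2) z(1)) linarith
    then show "\<exists>N. \<forall>m\<ge>N. \<forall>n\<ge>N. dist (z m) (z n) < r"
      by (intro exI[of _ N]) (metis dist_triangle_half_l dist_commute)
  qed
  then obtain x0 where x0: "x0 \<in> X" "z \<longlonglongrightarrow> x0"
    using X(1) z(1) unfolding complete_def by blast
  \<comment> \<open>Semicontinuity is applied at the finite stages, where \<Phi> is reduced by
    finitely many continuous terms; the passage to the infinite sum then happens at the single point
    \<open>x0\<close>.\<close>
  have "s \<le> F n x0" for n
  proof (rule ccontr)
    assume "\<not> s \<le> F n x0"
    then obtain a where a: "F n x0 < a" "a < s" by (metis dense not_le)
    define g where "g = (\<lambda>y. \<Sum>i<n. w i * (dist y (c i))\<^sup>2)"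
    obtain a1 where a1: "\<Phi> x0 < a1" "a1 - g x0 < a"
    proof
      show "\<Phi> x0 < (\<Phi> x0 + a + g x0) / 2" "(\<Phi> x0 + a + g x0) / 2 - g x0 < a"
        using a(1) by (simp_all add: F_sum g_def)
    qed
    have "(\<lambda>j. g (z j)) \<longlonglongrightarrow> g x0"
      unfolding g_def by (intro tendsto_intros x0)
    then have ev1: "eventually (\<lambda>j. a1 - a < g (z j)) sequentially"
      using a1(2) by (intro order_tendstoD) auto
    obtain r where r: "0 < r" "\<And>y. \<lbrakk>y \<in> X; dist y x0 < r\<rbrakk> \<Longrightarrow> \<Phi> y < a1"
      using usc[OF x0(1) a1(1)] by auto
    have ev2: "eventually (\<lambda>j. dist (z j) x0 < r) sequentially"
      using x0(2) r(1) by (simp add: tendsto_iff)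
    have ev3: "eventually (\<lambda>j. a < s - 1 / real (Suc j)) sequentially"
      using order_tendstoD(1)[OF z_lim, of a] a by simp
    from eventually_conj[OF ev1 eventually_conj[OF ev2 ev3]] obtain j
      where j: "a1 - a < g (z j)" "dist (z j) x0 < r" "a < s - 1 / real (Suc j)"
      by (auto simp: eventually_sequentially)
    have "F n (z j) < a" using r(2)[OF z(1) j(2)] j(1) by (simp add: F_sum g_def)
    with \<Psi>_le[OF z(1), of j n] z(2)[of j] j(3) show False by linarith
  qed
  moreover have "(\<lambda>n. F n x0) \<longlonglongrightarrow> \<Psi> x0"
    unfolding F_sum \<Psi>_def V_def by (intro tendsto_intros summable_LIMSEQ summ x0)
  ultimately have "s \<le> \<Psi> x0" by (intro LIMSEQ_le_const) auto
  with \<Psi>_s[OF x0(1)] have s: "\<Psi> x0 = s" by simp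
  show ?thesis
  proof (rule that[of w c x0])
    show "0 < w i" "c i \<in> C" for i by (rule w c)+
    show "w sums W" by (rule wsum)
    show "\<exists>y\<in>X. dist (c i) y \<le> 1" for i using x[of i] c(2)[of i] by blast
    show "x0 \<in> X" by (rule x0)
    show "summable (\<lambda>i. w i * (dist y (c i))\<^sup>2)" if "y \<in> X" for y by (rule summ[OF that])
    show "\<Phi> y - (\<Sum>i. w i * (dist y (c i))\<^sup>2) \<le> \<Phi> x0 - (\<Sum>i. w i * (dist x0 (c i))\<^sup>2)" if "y \<in> X" for y
      using \<Psi>_s[OF that] s by (simp add: \<Psi>_def V_def)
    show "\<Phi> y \<le> \<Phi> x0 + \<eta>" if "y \<in> X" for y
      using F_s[OF that, of 0] \<Psi>_le[OF x0(1), of 0] s by (simp add: F_0 \<delta>_def)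
    show "\<exists>e>0. \<forall>y\<in>X. \<Phi> x0 - (\<Sum>i. w i * (dist x0 (c i))\<^sup>2) - e
        < \<Phi> y - (\<Sum>i. w i * (dist y (c i))\<^sup>2) \<longrightarrow> dist y x0 < r" if r: "0 < r" for r
    proof -
      obtain e p where e: "0 < e" "\<And>y. \<lbrakk>y \<in> X; s - e < \<Psi> y\<rbrakk> \<Longrightarrow> dist y p < r/2"
        using near[of "r/2"] r by auto
      have "dist x0 p < r/2" using e(2)[OF x0(1)] s e(1) by simp
      then have "dist y x0 < r" if "y \<in> X" "s - e < \<Psi> y" for y
        using e(2)[OF that] by (metis dist_triangle_half_l dist_commute)
      then show ?thesis using e(1) s by (auto simp: \<Psi>_def V_def)
    qed
  qed
qed

section \<open>Quadratic test functions\<close>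

text \<open>In the weakly compact energy sublevel, the pairs at which \<open>h\<close> differs by at
  least \<eta> form a weakly compact set that avoids the diagonal. The distance is positive and
  weakly lower semicontinuous there, so finitely many of the open sets \<open>U n\<close> cover it
  and the distance is bounded away from 0.\<close>

lemma weakly_continuous_imp_uniformly_continuous:
  fixes E :: "'a::metric_space \<Rightarrow> ereal"
  assumes W: "weak_topology_assumption W E" and h: "continuous_map W euclideanreal h" and \<eta>: "0 < \<eta>"
  shows "\<exists>r>0. \<forall>x y. dist \<rho> x \<le> c \<and> E x \<le> ereal c' \<and> dist \<rho> y \<le> c \<and> E y \<le> ereal c' \<and> dist x y < r
    \<longrightarrow> \<bar>h x - h y\<bar> < \<eta>"
proof -
  define K where "K = {\<pi>. dist \<rho> \<pi> \<le> c \<and> E \<pi> \<le> ereal c'}"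
  have top: "topspace W = UNIV" and lsc: "lsc_map (prod_topology W W) (\<lambda>(x, y). dist x y)"
    and K: "compactin W K"
    using W by (auto simp: weak_topology_assumption_def K_def)
  define A where "A = {p \<in> topspace (prod_topology W W). \<bar>h (fst p) - h (snd p)\<bar> \<in> {\<eta>..}}"
  have "closedin (prod_topology W W) A"
    unfolding A_def
  proof (rule closedin_continuous_map_preimage)
    show "continuous_map (prod_topology W W) euclideanreal (\<lambda>p. \<bar>h (fst p) - h (snd p)\<bar>)"
      by (intro continuous_intros continuous_map_compose[OF continuous_map_fst h, unfolded o_def]
          continuous_map_compose[OF continuous_map_snd h, unfolded o_def])
  qed simp
  moreover have "compactin (prod_topology W W) (K \<times> K)" using K by (simp add: compactin_Times)
  ultimately have comp: "compactin (prod_topology W W) (A \<inter> (K \<times> K))"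
    by (rule closed_Int_compactin)
  define U where "U = (\<lambda>n. {p \<in> topspace (prod_topology W W). 1 / real (Suc n) < (\<lambda>(x, y). dist x y) p})"
  have "openin (prod_topology W W) (U n)" for n
    using lsc unfolding lsc_map_def U_def by blast
  moreover have "A \<inter> (K \<times> K) \<subseteq> \<Union> (range U)"
  proof
    fix p assume p: "p \<in> A \<inter> (K \<times> K)"
    then have "fst p \<noteq> snd p" using \<eta> by (auto simp: A_def)
    then have "0 < dist (fst p) (snd p)" by simp
    then obtain n where "1 / real (Suc n) < dist (fst p) (snd p)"
      using nat_approx_posE by blast
    then show "p \<in> \<Union> (range U)" by (auto simp: U_def top case_prod_beta)
  qed
  ultimately obtain \<F> where \<F>: "finite \<F>" "\<F> \<subseteq> range U" "A \<inter> (K \<times> K) \<subseteq> \<Union> \<F>"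
    using compactinD[OF comp, of "range U"] by auto
  then obtain I where I: "finite I" "\<F> = U ` I" by (meson finite_subset_image)
  define N where "N = Max (insert 0 I)"
  have "\<bar>h x - h y\<bar> < \<eta>" if xy: "x \<in> K" "y \<in> K" "dist x y < 1 / real (Suc N)" for x y
  proof (rule ccontr)
    assume "\<not> ?thesis"
    then have "(x, y) \<in> A \<inter> (K \<times> K)" using xy by (auto simp: A_def top)
    then obtain n where n: "n \<in> I" "(x, y) \<in> U n" using \<F>(3) I(2) by blast
    have "n \<le> N" using n(1) I(1) by (simp add: N_def)
    then have "1 / real (Suc N) \<le> 1 / real (Suc n)" by (simp add: divide_simps)
    with n(2) xy(3) show False by (simp add: U_def)
  qed
  then show ?thesis by (intro exI[of _ "1 / real (Suc N)"]) (auto simp: K_def)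
qed

section \<open>Linear functions as cylinder functions\<close>

lemma at_within_atLeast_nontrivial: "0 \<le> (x::real) \<Longrightarrow> at x within {0..} \<noteq> bot"
proof
  assume x: "0 \<le> x" and bot: "at x within {0..} = bot"
  have "at x within {x<..} \<le> at x within {0..}" using x by (intro at_le) auto
  then show False using bot by (metis bot_unique trivial_limit_at_right_real)
qed

lemma partial_affine:
  assumes \<psi>: "\<And>x. x \<in> orthant k \<Longrightarrow> \<psi> x = \<alpha> + (\<Sum>j<k. \<beta> j * x j)" and i: "i < k" and x: "x \<in> orthant k"
  shows "partial i \<psi> x = \<beta> i" "(\<lambda>t. \<psi> (x(i := t))) differentiable (at (x i) within {0..})"
proof -
  have xi: "0 \<le> x i" using x i by (auto simp: orthant_def PiE_iff)
  define \<gamma> where "\<gamma> = \<alpha> + (\<Sum>j\<in>{..<k} - {i}. \<beta> j * x j)"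
  have eq: "\<psi> (x(i := t)) = \<gamma> + \<beta> i * t" if "t \<in> {0..}" for t
  proof -
    have "x(i := t) \<in> orthant k" using x i that by (auto simp: orthant_def PiE_iff extensional_def)
    then have "\<psi> (x(i := t)) = \<alpha> + (\<Sum>j<k. \<beta> j * (x(i := t)) j)" by (rule \<psi>)
    also have "(\<Sum>j<k. \<beta> j * (x(i := t)) j) = \<beta> i * t + (\<Sum>j\<in>{..<k} - {i}. \<beta> j * (x(i := t)) j)"
      using i by (subst sum.remove[of _ i]) auto
    also have "(\<Sum>j\<in>{..<k} - {i}. \<beta> j * (x(i := t)) j) = (\<Sum>j\<in>{..<k} - {i}. \<beta> j * x j)"
      by (intro sum.cong) auto
    finally show ?thesis unfolding \<gamma>_def by linarith
  qed
  have "((\<lambda>t. \<gamma> + \<beta> i * t) has_vector_derivative \<beta> i) (at (x i) within {0..})"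
    by (auto intro!: derivative_eq_intros simp flip: has_real_derivative_iff_has_vector_derivative)
  then have der: "((\<lambda>t. \<psi> (x(i := t))) has_vector_derivative \<beta> i) (at (x i) within {0..})"
    by (rule has_vector_derivative_transform[rotated 2]) (use xi eq in auto)
  then show "partial i \<psi> x = \<beta> i"
    unfolding partial_def by (intro vector_derivative_within at_within_atLeast_nontrivial xi)
  show "(\<lambda>t. \<psi> (x(i := t))) differentiable (at (x i) within {0..})"
    using der by (rule differentiableI_vector)
qed

text \<open>Smoothness concerns all iterated partial derivatives. The induction invariant is that
  each of them agrees on the orthant with some affine function; nothing is claimed about values
  outside the orthant.\<close>

lemma linear_cyl_fun:
  assumes w: "\<And>i. i < k \<Longrightarrow> 0 < w i"
  shows "(\<lambda>x. \<Sum>i<k. w i * x i) \<in> cyl_fun k"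
proof -
  let ?\<phi> = "\<lambda>x. \<Sum>i<k. w i * x i"
  have affine: "\<exists>\<alpha> \<beta>. \<forall>x\<in>orthant k. foldr partial is ?\<phi> x = \<alpha> + (\<Sum>j<k. \<beta> j * x j)"
    if "set is \<subseteq> {..<k}" for "is"
    using that
  proof (induction "is")
    case Nil
    show ?case by (intro exI[of _ 0] exI[of _ w]) simp
  next
    case (Cons i "is")
    then obtain \<alpha> \<beta> where "\<And>x. x \<in> orthant k \<Longrightarrow> foldr partial is ?\<phi> x = \<alpha> + (\<Sum>j<k. \<beta> j * x j)"
      by auto
    from partial_affine(1)[OF this] Cons.prems
    have "\<forall>x\<in>orthant k. foldr partial (i # is) ?\<phi> x = \<beta> i + (\<Sum>j<k. 0 * x j)" by simp
    then show ?case by (intro exI[of _ "\<beta> i"] exI[of _ "\<lambda>_. 0"])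
  qed
  have "smooth_on_orthant k ?\<phi>"
    unfolding smooth_on_orthant_def
  proof (intro allI impI conjI ballI)
    fix "is" assume "set is \<subseteq> {..<k}"
    then obtain \<alpha> \<beta> where ab: "\<And>x. x \<in> orthant k \<Longrightarrow> foldr partial is ?\<phi> x = \<alpha> + (\<Sum>j<k. \<beta> j * x j)"
      using affine by blast
    have "continuous_on (orthant k) (\<lambda>x. \<alpha> + (\<Sum>j<k. \<beta> j * x j))"
      by (intro continuous_intros continuous_on_subset[OF continuous_on_product_coordinates]) auto
    then show "continuous_on (orthant k) (foldr partial is ?\<phi>)"
      using ab by (simp cong: continuous_on_cong)
    show "(\<lambda>t. foldr partial is ?\<phi> (x(i := t))) differentiable at (x i) within {0..}"
      if "i < k" "x \<in> orthant k" for i x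
      by (rule partial_affine(2)[OF ab that])
  qed
  moreover have "partial i ?\<phi> x = w i" if "i < k" "x \<in> orthant k" for i x
    by (rule partial_affine(1)[of k _ 0]) (use that in auto)
  ultimately show ?thesis using w by (simp add: cyl_fun_def)
qed

lemma half_sq_dists_in_orthant: "half_sq_dists k \<mu> \<pi> \<in> orthant k"
  by (auto simp: half_sq_dists_def orthant_def)

lemma partial_linear:
  "i < k \<Longrightarrow> partial i (\<lambda>x. \<Sum>i<k. w i * x i) (half_sq_dists k \<mu> \<pi>) = w i"
  by (rule partial_affine(1)[of k _ 0]) (auto simp: half_sq_dists_in_orthant)

context evi_space
begin

definition quad_test :: "real \<Rightarrow> nat \<Rightarrow> 'a \<Rightarrow> (nat \<Rightarrow> real) \<Rightarrow> (nat \<Rightarrow> 'a) \<Rightarrow> 'a \<Rightarrow> real" where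
  "quad_test a k \<rho> w c q = a/2 * (dist q \<rho>)\<^sup>2 + (\<Sum>i<k. w i * (1/2 * (dist q (c i))\<^sup>2))"

definition quad_slope :: "nat \<Rightarrow> (nat \<Rightarrow> real) \<Rightarrow> (nat \<Rightarrow> 'a) \<Rightarrow> 'a \<Rightarrow> real" where
  "quad_slope k w c q = (\<Sum>i<k. w i * dist q (c i))"

text \<open>For linear cylinder functions, \<open>H_dagger\<close> and the negative of
  \<open>H_ddagger\<close> agree except for the sign of the term with \<open>a\<^sup>2\<close>; this
  sign is \<open>\<sigma>\<close>, so one argument serves both.\<close>

definition quad_ham :: "real \<Rightarrow> real \<Rightarrow> nat \<Rightarrow> 'a \<Rightarrow> (nat \<Rightarrow> real) \<Rightarrow> (nat \<Rightarrow> 'a) \<Rightarrow> 'a \<Rightarrow> real" where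
  "quad_ham \<sigma> a k \<rho> w c q =
     a * (e \<rho> - e q - \<kappa>/2 * (dist q \<rho>)\<^sup>2) + \<sigma> * (a\<^sup>2/2 * (dist q \<rho>)\<^sup>2)
     + (\<Sum>i<k. w i * (e (c i) - e q - \<kappa>/2 * (dist q (c i))\<^sup>2))
     + 1/2 * (quad_slope k w c q)\<^sup>2 + a * dist q \<rho> * quad_slope k w c q"

text \<open>With \<open>\<sigma> = 1\<close> this is the subsolution property of \<open>u\<close> for \<open>H_dagger\<close>; with \<open>\<sigma> = -1\<close> it is
  the supersolution property of \<open>- u\<close> for \<open>H_ddagger\<close> and the right-hand side \<open>- h\<close>.\<close>

definition quad_subsolution :: "real \<Rightarrow> real \<Rightarrow> ('a \<Rightarrow> real) \<Rightarrow> ('a \<Rightarrow> real) \<Rightarrow> bool" where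
  "quad_subsolution lam \<sigma> h u \<longleftrightarrow>
     (\<forall>a>0. \<forall>k\<ge>1. \<forall>\<rho>\<in>DI. \<forall>w c. (\<forall>i<k. 0 < w i \<and> c i \<in> DI) \<longrightarrow>
       (\<forall>\<epsilon>>0. \<exists>p\<in>D. (\<forall>q. u q - quad_test a k \<rho> w c q \<le> u p - quad_test a k \<rho> w c p + \<epsilon>) \<and>
          u p - h p \<le> lam * quad_ham \<sigma> a k \<rho> w c p + \<epsilon>))"

lemma cyl_slope_linear: "cyl_slope k (\<lambda>x. \<Sum>i<k. w i * x i) c q = quad_slope k w c q"
  by (simp add: cyl_slope_def quad_slope_def partial_linear)

lemma sum_half_sq_dists: "(\<Sum>i<k. w i * half_sq_dists k c q i) = (\<Sum>i<k. w i * (1/2 * (dist q (c i))\<^sup>2))"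
  by (intro sum.cong) (auto simp: half_sq_dists_def)

text \<open>A single late member of the viscosity sequence satisfies both requirements up to
  \<epsilon>. It lies in \<open>D\<close>, because elsewhere \<open>g = - \<infinity>\<close> and
  the viscosity inequality would fail. The supremum is finite as \<open>u\<close> is bounded and the
  test function is nonnegative.\<close>

lemma viscosity_subsolution_quad:
  assumes vs: "viscosity_subsolution (H_dagger E \<kappa>) lam h u" and lam: "0 < lam"
  shows "quad_subsolution lam 1 h u"
  unfolding quad_subsolution_def
proof (intro allI impI ballI)
  fix a :: real and k :: nat and \<rho> and w :: "nat \<Rightarrow> real" and c and \<epsilon> :: real
  assume a: "0 < a" and k: "1 \<le> k" and \<rho>: "\<rho> \<in> DI" and wc: "\<forall>i<k. 0 < w i \<and> c i \<in> DI" and \<epsilon>: "0 < \<epsilon>"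
  let ?\<phi> = "\<lambda>x. \<Sum>i<k. w i * x i"
  define f where "f = quad_test a k \<rho> w c"
  define g where "g = (\<lambda>\<pi>. ereal a * (E \<rho> - E \<pi> - ereal (\<kappa>/2 * (dist \<pi> \<rho>)\<^sup>2))
            + ereal (a\<^sup>2/2 * (dist \<pi> \<rho>)\<^sup>2)
            + (\<Sum>i<k. ereal (partial i ?\<phi> (half_sq_dists k c \<pi>))
                 * (E (c i) - E \<pi> - ereal (\<kappa>/2 * (dist \<pi> (c i))\<^sup>2)))
            + ereal (1/2 * (cyl_slope k ?\<phi> c \<pi>)\<^sup>2)
            + ereal (a * dist \<pi> \<rho> * cyl_slope k ?\<phi> c \<pi>))"
  have "(f, g) \<in> H_dagger E \<kappa>"
    unfolding H_dagger_def using a k \<rho> wc linear_cyl_fun[of k w]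
    by (auto intro!: exI[of _ a] exI[of _ k] exI[of _ ?\<phi>] exI[of _ \<rho>] exI[of _ c]
        simp: f_def g_def quad_test_def sum_half_sq_dists fun_eq_iff)
  then obtain p where p1: "(\<lambda>n. ereal (u (p n) - f (p n))) \<longlonglongrightarrow> (SUP \<pi>. ereal (u \<pi> - f \<pi>))"
    and p2: "limsup (\<lambda>n. ereal (u (p n)) - ereal lam * g (p n) - ereal (h (p n))) \<le> 0"
    using vs unfolding viscosity_subsolution_def by blast
  obtain b where b: "\<And>x. \<bar>u x\<bar> \<le> b"
    using vs unfolding viscosity_subsolution_def bounded_iff by auto
  have f0: "0 \<le> f x" for x
    unfolding f_def quad_test_def using a wc by (intro add_nonneg_nonneg sum_nonneg mult_nonneg_nonneg) (auto simp: less_imp_le)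
  define Z where "Z = (SUP \<pi>. ereal (u \<pi> - f \<pi>))"
  have "Z \<le> ereal b"
    unfolding Z_def
  proof (rule SUP_least)
    show "ereal (u x - f x) \<le> ereal b" for x using b[of x] f0[of x] by simp
  qed
  moreover have "ereal (u q - f q) \<le> Z" for q unfolding Z_def by (intro SUP_upper) auto
  from this[of \<rho>] have "Z \<noteq> - \<infinity>" by auto
  ultimately obtain s where "Z = ereal s" by (cases Z) auto
  then have s: "(SUP \<pi>. ereal (u \<pi> - f \<pi>)) = ereal s" by (simp add: Z_def)
  have "eventually (\<lambda>n. ereal (s - \<epsilon>) < ereal (u (p n) - f (p n))) sequentially"
    using order_tendstoD(1)[OF p1, of "ereal (s - \<epsilon>)"] s \<epsilon> by simp
  moreover have "eventually (\<lambda>n. ereal (u (p n)) - ereal lam * g (p n) - ereal (h (p n)) < ereal \<epsilon>) sequentially"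
    using p2 \<epsilon> by (intro Limsup_lessD) (auto intro: le_less_trans)
  ultimately obtain n where n: "s - \<epsilon> < u (p n) - f (p n)"
      "ereal (u (p n)) - ereal lam * g (p n) - ereal (h (p n)) < ereal \<epsilon>"
    using eventually_happens[OF eventually_conj] trivial_limit_sequentially by fastforce
  define q where "q = p n"
  have q: "q \<in> D"
  proof (rule ccontr)
    assume "q \<notin> D"
    then have inf: "E q = \<infinity>" by (simp add: energy_dom_def)
    \<comment> \<open>In extended reals \<open>\<infinity> + (- \<infinity>)\<close> is
      \<open>\<infinity>\<close>, so the sum has to be kept away from \<open>\<infinity>\<close>
      before the first term can make \<open>g q\<close> equal to
      \<open>- \<infinity>\<close>.\<close>
    have "(\<Sum>i<k. ereal (partial i ?\<phi> (half_sq_dists k c q))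
                 * (E (c i) - E q - ereal (\<kappa>/2 * (dist q (c i))\<^sup>2))) \<noteq> \<infinity>"
      using wc by (auto simp: sum_Pinfty inf E_eq DI_D partial_linear)
    then have "g q = - \<infinity>"
      using a by (auto simp: g_def inf E_eq[OF DI_D[OF \<rho>]])
    with n(2) lam show False by (simp add: q_def)
  qed
  have "(\<Sum>i<k. ereal (partial i ?\<phi> (half_sq_dists k c q)) * (E (c i) - E q - ereal (\<kappa>/2 * (dist q (c i))\<^sup>2)))
      = ereal (\<Sum>i<k. w i * (e (c i) - e q - \<kappa>/2 * (dist q (c i))\<^sup>2))"
    unfolding sum_ereal[symmetric] using wc q by (intro sum.cong) (auto simp: E_eq DI_D partial_linear)
  then have gq: "g q = ereal (quad_ham 1 a k \<rho> w c q)"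
    using q by (simp add: g_def E_eq DI_D[OF \<rho>] quad_ham_def cyl_slope_linear)
  have "u x - f x \<le> u q - f q + \<epsilon>" for x
    using SUP_upper[of x UNIV "\<lambda>x. ereal (u x - f x)"] n(1) s by (simp add: q_def)
  moreover have "u q - h q \<le> lam * quad_ham 1 a k \<rho> w c q + \<epsilon>"
    using n(2) gq by (simp add: q_def)
  ultimately show "\<exists>p\<in>D. (\<forall>q. u q - quad_test a k \<rho> w c q \<le> u p - quad_test a k \<rho> w c p + \<epsilon>) \<and>
          u p - h p \<le> lam * quad_ham 1 a k \<rho> w c p + \<epsilon>"
    using q unfolding f_def by blast
qed

lemma viscosity_supersolution_quad:
  assumes vs: "viscosity_supersolution (H_ddagger E \<kappa>) lam h v" and lam: "0 < lam"
  shows "quad_subsolution lam (- 1) (\<lambda>x. - h x) (\<lambda>x. - v x)"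
  unfolding quad_subsolution_def
proof (intro allI impI ballI)
  fix a :: real and k :: nat and \<rho> and w :: "nat \<Rightarrow> real" and c and \<epsilon> :: real
  assume a: "0 < a" and k: "1 \<le> k" and \<rho>: "\<rho> \<in> DI" and wc: "\<forall>i<k. 0 < w i \<and> c i \<in> DI" and \<epsilon>: "0 < \<epsilon>"
  let ?\<phi> = "\<lambda>x. \<Sum>i<k. w i * x i"
  define f where "f = quad_test a k \<rho> w c"
  define g where "g = (\<lambda>\<mu>. ereal a * (E \<mu> - E \<rho> + ereal (\<kappa>/2 * (dist \<mu> \<rho>)\<^sup>2))
            + ereal (a\<^sup>2/2 * (dist \<rho> \<mu>)\<^sup>2)
            + (\<Sum>i<k. ereal (partial i ?\<phi> (half_sq_dists k c \<mu>))
                 * (E \<mu> - E (c i) + ereal (\<kappa>/2 * (dist \<mu> (c i))\<^sup>2)))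
            - ereal (1/2 * (cyl_slope k ?\<phi> c \<mu>)\<^sup>2)
            - ereal (a * dist \<mu> \<rho> * cyl_slope k ?\<phi> c \<mu>))"
  have "((\<lambda>x. - f x), g) \<in> H_ddagger E \<kappa>"
    unfolding H_ddagger_def using a k \<rho> wc linear_cyl_fun[of k w]
    by (auto intro!: exI[of _ a] exI[of _ k] exI[of _ ?\<phi>] exI[of _ \<rho>] exI[of _ c]
        simp: f_def g_def quad_test_def sum_half_sq_dists fun_eq_iff)
  from bspec[OF conjunct2[OF conjunct2[OF vs[unfolded viscosity_supersolution_def]]] this, unfolded prod.case]
  obtain p where p1: "(\<lambda>n. ereal (v (p n) - - f (p n))) \<longlonglongrightarrow> (INF \<pi>. ereal (v \<pi> - - f \<pi>))"
    and p2: "liminf (\<lambda>n. ereal (v (p n)) - ereal lam * g (p n) - ereal (h (p n))) \<ge> 0"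
    by blast
  obtain b where b: "\<And>x. \<bar>v x\<bar> \<le> b"
    using vs unfolding viscosity_supersolution_def bounded_iff by auto
  have f0: "0 \<le> f x" for x
    unfolding f_def quad_test_def using a wc by (intro add_nonneg_nonneg sum_nonneg mult_nonneg_nonneg) (auto simp: less_imp_le)
  define Z where "Z = (INF \<pi>. ereal (v \<pi> - - f \<pi>))"
  have "ereal (- b) \<le> Z"
    unfolding Z_def
  proof (rule INF_greatest)
    show "ereal (- b) \<le> ereal (v x - - f x)" for x using b[of x] f0[of x] by simp
  qed
  moreover have "Z \<le> ereal (v q - - f q)" for q unfolding Z_def by (intro INF_lower) auto
  from this[of \<rho>] have "Z \<noteq> \<infinity>" by auto
  ultimately obtain s where "Z = ereal s" by (cases Z) auto
  then have s: "(INF \<pi>. ereal (v \<pi> - - f \<pi>)) = ereal s" by (simp add: Z_def)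
  have "eventually (\<lambda>n. ereal (v (p n) - - f (p n)) < ereal (s + \<epsilon>)) sequentially"
    using order_tendstoD(2)[OF p1, of "ereal (s + \<epsilon>)"] s \<epsilon> by simp
  moreover have "eventually (\<lambda>n. ereal (- \<epsilon>) < ereal (v (p n)) - ereal lam * g (p n) - ereal (h (p n))) sequentially"
    using less_le_trans[OF _ p2, of "ereal (- \<epsilon>)"] \<epsilon> by (intro less_LiminfD) simp
  ultimately obtain n where n: "v (p n) - - f (p n) < s + \<epsilon>"
      "ereal (- \<epsilon>) < ereal (v (p n)) - ereal lam * g (p n) - ereal (h (p n))"
    using eventually_happens[OF eventually_conj] trivial_limit_sequentially by fastforce
  define q where "q = p n"
  have q: "q \<in> D"
  proof (rule ccontr)
    assume "q \<notin> D"
    then have inf: "E q = \<infinity>" by (simp add: energy_dom_def)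
    have "0 \<le> (\<Sum>i<k. ereal (partial i ?\<phi> (half_sq_dists k c q))
                 * (E q - E (c i) + ereal (\<kappa>/2 * (dist q (c i))\<^sup>2)))"
      using wc by (intro sum_nonneg) (auto simp: inf E_eq DI_D partial_linear)
    then have "g q = \<infinity>"
      using a by (auto simp: g_def inf E_eq[OF DI_D[OF \<rho>]])
    with n(2) lam show False by (simp add: q_def)
  qed
  have sum_eq: "(\<Sum>i<k. ereal (partial i ?\<phi> (half_sq_dists k c q)) * (E q - E (c i) + ereal (\<kappa>/2 * (dist q (c i))\<^sup>2)))
      = ereal (\<Sum>i<k. - (w i * (e (c i) - e q - \<kappa>/2 * (dist q (c i))\<^sup>2)))"
    unfolding sum_ereal[symmetric] using wc q
    by (intro sum.cong) (auto simp: E_eq DI_D partial_linear, auto simp: algebra_simps)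
  then have gq: "g q = ereal (- quad_ham (- 1) a k \<rho> w c q)"
    unfolding g_def cyl_slope_linear sum_eq sum_negf
    using q by (simp add: E_eq DI_D[OF \<rho>] quad_ham_def dist_commute algebra_simps)
  have "- v x - f x \<le> - v q - f q + \<epsilon>" for x
    using INF_lower[of x UNIV "\<lambda>x. ereal (v x - - f x)"] n(1) s by (simp add: q_def)
  moreover have "- v q - - h q \<le> lam * quad_ham (- 1) a k \<rho> w c q + \<epsilon>"
    using n(2) gq by (simp add: q_def)
  ultimately show "\<exists>p\<in>D. (\<forall>q. - v q - quad_test a k \<rho> w c q \<le> - v p - quad_test a k \<rho> w c p + \<epsilon>) \<and>
          - v p - - h p \<le> lam * quad_ham (- 1) a k \<rho> w c p + \<epsilon>"
    using q unfolding f_def by blast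
qed

end

section \<open>First-order conditions at a penalized minimizer\<close>

lemma frequently_less_of_Liminf_le:
  fixes f :: "'b \<Rightarrow> 'c::complete_linorder"
  assumes "Liminf F f \<le> a" "a < b"
  shows "frequently (\<lambda>x. f x < b) F"
proof (rule ccontr)
  assume "\<not> ?thesis"
  then have "eventually (\<lambda>x. b \<le> f x) F" by (simp add: not_frequently not_less)
  then have "b \<le> Liminf F f" by (rule Liminf_bounded)
  with assms show False by simp
qed

lemma sq_dist_le:
  fixes z \<rho> x :: "'a::metric_space"
  assumes "dist z \<rho> \<le> 1"
  shows "(dist z x)\<^sup>2 \<le> (dist \<rho> x)\<^sup>2 + dist z \<rho> * (1 + 2 * dist \<rho> x)"
proof -
  have "dist z \<rho> * (dist z \<rho> + 2 * dist \<rho> x) \<le> dist z \<rho> * (1 + 2 * dist \<rho> x)"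
    using assms by (intro mult_left_mono) auto
  with sq_dist_perturb[of z x \<rho>] show ?thesis by linarith
qed

context evi_space
begin

text \<open>The first term is bounded once the denominator is at least 1 and supplies the slope
  gain. The second bounds the energy of near-optimal points and makes their information finite. The
  logarithm keeps them in a ball, yet its derivative in the distance is at most 1, so in the
  geodesic condition it costs at most \<epsilon>, however large the ball.\<close>

definition penalty :: "real \<Rightarrow> real \<Rightarrow> real \<Rightarrow> real \<Rightarrow> 'a \<Rightarrow> 'a \<Rightarrow> real" where
  "penalty L c \<epsilon>\<^sub>1 \<epsilon> y z = - L / (e z + c) + \<epsilon>\<^sub>1 * e z + \<epsilon> * ln (1 + (dist z y)\<^sup>2)"

text \<open>The penalty is concave in the energy and in the squared distance, so it lies below its
  tangent. The derivative in the energy is the weight \<open>q\<close> that appears in all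
  first-order conditions.\<close>

lemma penalty_diff_le:
  assumes pos: "0 < e \<rho> + c" "0 < e z + c" and L: "0 \<le> L" and \<epsilon>: "0 \<le> \<epsilon>"
  shows "penalty L c \<epsilon>\<^sub>1 \<epsilon> y z - penalty L c \<epsilon>\<^sub>1 \<epsilon> y \<rho>
     \<le> (L / (e \<rho> + c)\<^sup>2 + \<epsilon>\<^sub>1) * (e z - e \<rho>) + \<epsilon> * (((dist z y)\<^sup>2 - (dist \<rho> y)\<^sup>2) / (1 + (dist \<rho> y)\<^sup>2))"
proof -
  define p where "p = e \<rho> + c"
  define q where "q = e z + c"
  have pq: "0 < p" "0 < q" using pos by (auto simp: p_def q_def)
  have "L * (0 - 1 / q + 1 / p) \<le> L * ((q - p) / p\<^sup>2)"
  proof (intro mult_left_mono L)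
    have "(q - p) / p\<^sup>2 - (1 / p - 1 / q) = (q - p)\<^sup>2 / (p\<^sup>2 * q)"
      using pq by (simp add: field_simps power2_eq_square)
    moreover have "0 \<le> (q - p)\<^sup>2 / (p\<^sup>2 * q)" using pq by simp
    ultimately show "0 - 1 / q + 1 / p \<le> (q - p) / p\<^sup>2" by linarith
  qed
  then have 1: "- L / q + L / p \<le> L / p\<^sup>2 * (e z - e \<rho>)"
    by (simp add: p_def q_def algebra_simps)
  have "ln (1 + (dist z y)\<^sup>2) - ln (1 + (dist \<rho> y)\<^sup>2)
      \<le> ((1 + (dist z y)\<^sup>2) - (1 + (dist \<rho> y)\<^sup>2)) / (1 + (dist \<rho> y)\<^sup>2)"
    by (intro ln_diff_le) (auto intro: add_pos_nonneg)
  then have "\<epsilon> * (ln (1 + (dist z y)\<^sup>2) - ln (1 + (dist \<rho> y)\<^sup>2))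
      \<le> \<epsilon> * (((dist z y)\<^sup>2 - (dist \<rho> y)\<^sup>2) / (1 + (dist \<rho> y)\<^sup>2))"
    using \<epsilon> by (intro mult_left_mono) simp
  with 1 show ?thesis
    unfolding penalty_def p_def[symmetric] q_def[symmetric] by (simp add: algebra_simps)
qed

text \<open>Setting of one inner point \<rho> with its neighbours \<open>A\<close> and
  \<open>B\<close> in the chain \<pi>, \<rho>, \<gamma>, \<mu>. \<open>V\<close> represents the
  perturbation of the variational principle, through its growth in distance and along the flow.
  Competitors are limited in distance and energy because the optimum is taken over a bounded part of
  an energy sublevel.\<close>

context
  fixes A B y \<rho> :: 'a and V :: "'a \<Rightarrow> real" and a L c \<epsilon>\<^sub>1 \<epsilon> l r\<^sub>0 :: real
  assumes dom: "A \<in> D" "B \<in> D" "y \<in> D" "\<rho> \<in> D"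
    and par: "0 < a" "0 \<le> L" "0 < \<epsilon>\<^sub>1" "0 \<le> \<epsilon>" "0 \<le> l" "0 < r\<^sub>0"
    and pos: "\<And>z. \<lbrakk>z \<in> D; dist z \<rho> < r\<^sub>0\<rbrakk> \<Longrightarrow> 0 < e z + c"
    and V_lip: "\<And>z. dist z \<rho> < r\<^sub>0 \<Longrightarrow> V z \<le> V \<rho> + l * dist z \<rho>"
    and V_flow: "\<And>t. \<lbrakk>0 < t; t < r\<^sub>0\<rbrakk> \<Longrightarrow> V (S t \<rho>) \<le> V \<rho> + t * l"
    and minimal: "\<And>z. \<lbrakk>z \<in> D; dist z \<rho> < r\<^sub>0; e z \<le> e \<rho> + r\<^sub>0\<rbrakk> \<Longrightarrow>
      a/2 * (dist \<rho> A)\<^sup>2 + a/2 * (dist \<rho> B)\<^sup>2 + penalty L c \<epsilon>\<^sub>1 \<epsilon> y \<rho> + V \<rho>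
        \<le> a/2 * (dist z A)\<^sup>2 + a/2 * (dist z B)\<^sup>2 + penalty L c \<epsilon>\<^sub>1 \<epsilon> y z + V z"
begin

private abbreviation "q \<equiv> L / (e \<rho> + c)\<^sup>2 + \<epsilon>\<^sub>1"

lemma minimizer_first_order:
  assumes z: "z \<in> D" "dist z \<rho> < r\<^sub>0" "e z \<le> e \<rho> + r\<^sub>0"
  shows "0 \<le> a/2 * ((dist z A)\<^sup>2 - (dist \<rho> A)\<^sup>2) + a/2 * ((dist z B)\<^sup>2 - (dist \<rho> B)\<^sup>2)
    + q * (e z - e \<rho>) + \<epsilon> * (((dist z y)\<^sup>2 - (dist \<rho> y)\<^sup>2) / (1 + (dist \<rho> y)\<^sup>2)) + (V z - V \<rho>)"
  using minimal[OF z] penalty_diff_le[OF pos[OF dom(4)] pos[OF z(1,2)] par(2,4), of \<epsilon>\<^sub>1 y] par(6)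
  by (simp add: algebra_simps)

text \<open>A point of lower energy gains at least \<open>\<epsilon>\<^sub>1\<close> per unit of
  energy, while every other term grows at most linearly in the distance. Minimality thus bounds the
  energy drop by \<open>N / \<epsilon>\<^sub>1\<close> times the distance.\<close>

lemma minimizer_information_dom: "\<rho> \<in> DI"
proof -
  define N where "N = a/2 * (1 + 2 * dist \<rho> A) + a/2 * (1 + 2 * dist \<rho> B) + \<epsilon> * (1 + 2 * dist \<rho> y) + l"
  define C where "C = N / \<epsilon>\<^sub>1"
  show ?thesis
  proof (rule DI_I)
    show "\<rho> \<in> D" "0 < min r\<^sub>0 1" "0 \<le> C" using dom par by (auto simp: C_def N_def)
    fix z assume z: "dist z \<rho> < min r\<^sub>0 1" "z \<in> D" "e z \<le> e \<rho>"
    let ?d = "dist z \<rho>"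
    have d1: "?d \<le> 1" using z by simp
    have A: "a/2 * ((dist z A)\<^sup>2 - (dist \<rho> A)\<^sup>2) \<le> a/2 * (?d * (1 + 2 * dist \<rho> A))"
      and B: "a/2 * ((dist z B)\<^sup>2 - (dist \<rho> B)\<^sup>2) \<le> a/2 * (?d * (1 + 2 * dist \<rho> B))"
      using sq_dist_le[OF d1, of A] sq_dist_le[OF d1, of B] par by (auto intro!: mult_left_mono)
    have y: "\<epsilon> * (((dist z y)\<^sup>2 - (dist \<rho> y)\<^sup>2) / (1 + (dist \<rho> y)\<^sup>2)) \<le> \<epsilon> * (?d * (1 + 2 * dist \<rho> y))"
    proof (intro mult_left_mono)
      have "((dist z y)\<^sup>2 - (dist \<rho> y)\<^sup>2) / (1 + (dist \<rho> y)\<^sup>2) \<le> (?d * (1 + 2 * dist \<rho> y)) / (1 + (dist \<rho> y)\<^sup>2)"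
        using sq_dist_le[OF d1, of y] by (intro divide_right_mono) auto
      also have "\<dots> \<le> (?d * (1 + 2 * dist \<rho> y)) / 1"
        by (intro divide_left_mono) (auto intro: add_pos_nonneg)
      finally show "((dist z y)\<^sup>2 - (dist \<rho> y)\<^sup>2) / (1 + (dist \<rho> y)\<^sup>2) \<le> ?d * (1 + 2 * dist \<rho> y)" by simp
    qed (use par in auto)
    have V: "V z - V \<rho> \<le> l * ?d" using V_lip[of z] z by simp
    have q: "q * (e z - e \<rho>) \<le> \<epsilon>\<^sub>1 * (e z - e \<rho>)"
      using z par by (intro mult_right_mono_neg) auto
    have "0 \<le> a/2 * (?d * (1 + 2 * dist \<rho> A)) + a/2 * (?d * (1 + 2 * dist \<rho> B))
        + \<epsilon>\<^sub>1 * (e z - e \<rho>) + \<epsilon> * (?d * (1 + 2 * dist \<rho> y)) + l * ?d"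
      using z par by (intro order_trans[OF minimizer_first_order[of z]] add_mono A B q y V) auto
    also have "\<dots> = N * ?d - \<epsilon>\<^sub>1 * (e \<rho> - e z)" by (simp add: N_def algebra_simps)
    also have "N * ?d = \<epsilon>\<^sub>1 * (C * ?d)" using par by (simp add: C_def)
    finally have "\<epsilon>\<^sub>1 * (e \<rho> - e z) \<le> \<epsilon>\<^sub>1 * (C * ?d)" by simp
    then show "e \<rho> \<le> e z + C * ?d" using par(3) by simp
  qed
qed

text \<open>The competitor is \<open>S t \<rho>\<close>, and the comparison is divided by
  \<open>t\<close>. The EVI handles the three squared distances and \<open>dissipation\<close> the
  energy; since the latter holds only at some small times, one such time is taken for each
  tolerance.\<close>

lemma minimizer_flow:
  "0 \<le> a * (e A - e \<rho> - \<kappa>/2 * (dist \<rho> A)\<^sup>2) + a * (e B - e \<rho> - \<kappa>/2 * (dist \<rho> B)\<^sup>2)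
     - q * ((slope \<rho>)\<^sup>2 / 2) + 2 * \<epsilon> / (1 + (dist \<rho> y)\<^sup>2) * (e y - e \<rho> - \<kappa>/2 * (dist \<rho> y)\<^sup>2) + l"
  (is "0 \<le> ?X")
proof (rule field_le_epsilon)
  fix \<delta> :: real assume \<delta>: "0 < \<delta>"
  define Q where "Q = q"
  have q: "0 \<le> Q" using par by (simp add: Q_def)
  \<comment> \<open>Sum of the coefficients with which \<eta> enters, so that the total error is
    \<open>\<eta> * K = \<delta>\<close>.\<close>
  define K where "K = 2 * a + Q + 2 * \<epsilon> / (1 + (dist \<rho> y)\<^sup>2)"
  have K: "0 < K" using par q by (auto simp: K_def intro!: add_pos_nonneg)
  define \<eta> where "\<eta> = \<delta> / K"
  have \<eta>: "0 < \<eta>" using \<delta> K by (simp add: \<eta>_def)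
  define R where "R = max (dist \<rho> A) (max (dist \<rho> B) (dist \<rho> y))"
  have "0 \<le> R" by (simp add: R_def le_max_iff_disj)
  then obtain \<tau>1 where \<tau>1: "0 < \<tau>1" "\<And>t \<sigma>. \<lbrakk>0 \<le> t; t < \<tau>1; \<sigma> \<in> D; dist \<rho> \<sigma> \<le> R\<rbrakk> \<Longrightarrow>
      (dist (S t \<rho>) \<sigma>)\<^sup>2 \<le> (dist \<rho> \<sigma>)\<^sup>2 + 2 * t * (e \<sigma> - e \<rho> - \<kappa>/2 * (dist \<rho> \<sigma>)\<^sup>2 + \<eta>)"
    using flow_small[OF dom(4) \<eta>, of R] by auto
  obtain \<tau>2 where \<tau>2: "0 < \<tau>2" "\<And>t. \<lbrakk>0 \<le> t; t < \<tau>2\<rbrakk> \<Longrightarrow> dist (S t \<rho>) \<rho> < r\<^sub>0"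
    using flow_near[of r\<^sub>0 \<rho>] par by auto
  obtain t where t: "0 < t" "t < min \<tau>1 (min \<tau>2 r\<^sub>0)" "e (S t \<rho>) \<le> e \<rho> - t * ((slope \<rho>)\<^sup>2 / 2 - \<eta>)"
    using dissipation[OF minimizer_information_dom \<eta>, of "min \<tau>1 (min \<tau>2 r\<^sub>0)"] \<tau>1 \<tau>2 par by auto
  let ?z = "S t \<rho>"
  have z: "?z \<in> D" "dist ?z \<rho> < r\<^sub>0" "e ?z \<le> e \<rho> + r\<^sub>0"
    using t \<tau>2 flow_dom[OF t(1)] e_antimono[OF dom(4), of t] par by auto
  have sq: "(dist ?z \<sigma>)\<^sup>2 - (dist \<rho> \<sigma>)\<^sup>2 \<le> 2 * t * (e \<sigma> - e \<rho> - \<kappa>/2 * (dist \<rho> \<sigma>)\<^sup>2 + \<eta>)"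
    if "\<sigma> \<in> {A, B, y}" for \<sigma>
    using \<tau>1(2)[of t \<sigma>] t that dom by (auto simp: R_def le_max_iff_disj)
  have A: "a/2 * ((dist ?z A)\<^sup>2 - (dist \<rho> A)\<^sup>2) \<le> a/2 * (2 * t * (e A - e \<rho> - \<kappa>/2 * (dist \<rho> A)\<^sup>2 + \<eta>))"
    and B: "a/2 * ((dist ?z B)\<^sup>2 - (dist \<rho> B)\<^sup>2) \<le> a/2 * (2 * t * (e B - e \<rho> - \<kappa>/2 * (dist \<rho> B)\<^sup>2 + \<eta>))"
    using par by (intro mult_left_mono sq; simp)+
  have y: "\<epsilon> * (((dist ?z y)\<^sup>2 - (dist \<rho> y)\<^sup>2) / (1 + (dist \<rho> y)\<^sup>2))
      \<le> \<epsilon> * ((2 * t * (e y - e \<rho> - \<kappa>/2 * (dist \<rho> y)\<^sup>2 + \<eta>)) / (1 + (dist \<rho> y)\<^sup>2))"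
    using sq[of y] par by (intro mult_left_mono divide_right_mono) (auto intro: add_nonneg_nonneg)
  have Q: "Q * (e ?z - e \<rho>) \<le> Q * (- t * ((slope \<rho>)\<^sup>2 / 2 - \<eta>))"
    using t q by (intro mult_left_mono) auto
  have V: "V ?z - V \<rho> \<le> t * l" using V_flow[of t] t by simp
  have "0 \<le> a/2 * (2 * t * (e A - e \<rho> - \<kappa>/2 * (dist \<rho> A)\<^sup>2 + \<eta>))
    + a/2 * (2 * t * (e B - e \<rho> - \<kappa>/2 * (dist \<rho> B)\<^sup>2 + \<eta>))
    + Q * (- t * ((slope \<rho>)\<^sup>2 / 2 - \<eta>))
    + \<epsilon> * ((2 * t * (e y - e \<rho> - \<kappa>/2 * (dist \<rho> y)\<^sup>2 + \<eta>)) / (1 + (dist \<rho> y)\<^sup>2)) + t * l"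
    by (intro order_trans[OF minimizer_first_order[OF z, folded Q_def]] add_mono A B Q y V)
  also have "\<dots> = t * (?X + \<eta> * K)"
    unfolding K_def Q_def[symmetric] by (simp add: add_divide_distrib diff_divide_distrib algebra_simps)
  finally have "0 \<le> ?X + \<eta> * K" using t by (simp add: zero_le_mult_iff)
  moreover have "\<eta> * K = \<delta>" using K by (simp add: \<eta>_def)
  ultimately show "0 \<le> ?X + \<delta>" by simp
qed

text \<open>The competitor moves along the regularized geodesic towards \<open>A\<close>. The
  distance to \<open>A\<close> falls at rate \<open>X = dist \<rho> A\<close>, the distance to
  \<open>B\<close> rises at most as fast by the triangle inequality, and the energy costs slope
  times \<open>X\<close>. Dividing by the time and by \<open>X\<close> gives the claim. Such a
  geodesic requires finite information at \<rho>, hence \<open>minimizer_information_dom\<close>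
  comes first.\<close>

lemma minimizer_geodesic:
  assumes reg: "regularized_geodesics_assumption E"
  shows "a * dist \<rho> A \<le> a * dist \<rho> B + q * slope \<rho> + \<epsilon> + l"
proof -
  define X where "X = dist \<rho> A"
  define Y where "Y = dist \<rho> B"
  define Z where "Z = dist \<rho> y"
  define s where "s = slope \<rho>"
  have s: "0 \<le> s" by (simp add: s_def slope_nonneg)
  define Q where "Q = q"
  have q: "0 \<le> Q" using par by (simp add: Q_def)
  have XYZ: "0 \<le> X" "0 \<le> Y" "0 \<le> Z" by (auto simp: X_def Y_def Z_def)
  \<comment> \<open>Collects all errors due to the regularization; each carries a factor
    \<theta>.\<close>
  define K where "K = 2 * a * X + 2 * a * Y + Q * (s + 1) + 2 * \<epsilon> + 2 * l + (a + \<epsilon>) * (X + 2)\<^sup>2"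
  have K: "0 \<le> K" unfolding K_def using par XYZ s q by (intro add_nonneg_nonneg mult_nonneg_nonneg) auto
  have \<rho>I: "\<rho> \<in> DI" by (rule minimizer_information_dom)
  have "information E \<rho> + E A < \<infinity>"
    using \<rho>I dom(1) by (auto simp: information_dom_def E_eq)
  then obtain \<zeta> where \<zeta>: "is_geodesic \<zeta> \<rho> A"
    and reg\<zeta>: "\<And>\<theta>. 0 < \<theta> \<Longrightarrow> \<exists>\<tau>>0. \<exists>\<zeta>\<theta> :: real \<Rightarrow> 'a.
            \<zeta>\<theta> 0 = \<rho> \<and>
            Limsup (at 0 within {0<..\<tau>}) (\<lambda>t. ereal (dist (\<zeta>\<theta> t) (\<zeta> t) / t)) \<le> ereal \<theta> \<and>
            Liminf (at 0 within {0<..\<tau>}) (\<lambda>t. (E (\<zeta>\<theta> t) - E \<rho>) / ereal t)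
              \<le> local_slope E \<rho> * ereal (X + \<theta>)"
    using reg unfolding regularized_geodesics_assumption_def X_def by blast
  have main: "0 \<le> X * (- a * X + a * Y + Q * s + \<epsilon> + l) + \<theta> * K" if \<theta>: "0 < \<theta>" "\<theta> \<le> 1" for \<theta>
  proof -
    obtain \<tau> \<xi> where \<tau>: "0 < \<tau>"
      and near: "Limsup (at 0 within {0<..\<tau>}) (\<lambda>t. ereal (dist (\<xi> t) (\<zeta> t) / t)) \<le> ereal \<theta>"
      and en: "Liminf (at 0 within {0<..\<tau>}) (\<lambda>t. (E (\<xi> t) - E \<rho>) / ereal t) \<le> ereal (s * (X + \<theta>))"
      using reg\<zeta>[OF \<theta>(1)] slope_eq[OF \<rho>I] by (auto simp: s_def)
    have "ereal \<theta> < ereal (2 * \<theta>)" using \<theta> by simp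
    with near have ev1: "eventually (\<lambda>t. ereal (dist (\<xi> t) (\<zeta> t) / t) < ereal (2 * \<theta>)) (at 0 within {0<..\<tau>})"
      by (intro Limsup_lessD) (rule le_less_trans)
    \<comment> \<open>In this order the bounds make the terms quadratic in \<open>t\<close> at most
      of size \<open>\<theta> * t\<close>, keep the competitor within \<open>r\<^sub>0\<close> of
      \<rho>, and keep its energy below \<open>e \<rho> + r\<^sub>0\<close>.\<close>
    define b where "b = min \<theta> (min (r\<^sub>0 / (X + 2)) (r\<^sub>0 / (s * (X + \<theta>) + \<theta> + 1)))"
    have "0 \<le> s * (X + \<theta>) + \<theta>" using s XYZ \<theta> by simp
    then have b: "0 < b" using \<theta> par XYZ by (auto simp: b_def intro!: divide_pos_pos)
    have ev2: "eventually (\<lambda>t. t \<in> {0<..\<tau>} \<and> t < b) (at 0 within {0<..\<tau>})"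
      unfolding eventually_at using b by (intro exI[of _ b]) (auto simp: dist_real_def)
    \<comment> \<open>The energy bound, being a lower limit, holds only at some arbitrarily small
      times; the distance bound holds at all small times, so both hold at a common one.\<close>
    have "frequently (\<lambda>t. (E (\<xi> t) - E \<rho>) / ereal t < ereal (s * (X + \<theta>) + \<theta>)) (at 0 within {0<..\<tau>})"
      using \<theta> by (intro frequently_less_of_Liminf_le[OF en]) simp
    from frequently_ex[OF frequently_eventually_frequently[OF this eventually_conj[OF ev1 ev2]]]
    obtain t where t: "0 < t" "t < b" and dt: "dist (\<xi> t) (\<zeta> t) / t < 2 * \<theta>"
      and et: "(E (\<xi> t) - E \<rho>) / ereal t < ereal (s * (X + \<theta>) + \<theta>)"
      by auto
    define z where "z = \<xi> t"
    have t\<theta>: "t < \<theta>" "t < 1" using t \<theta> by (auto simp: b_def)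
    have zD: "z \<in> D"
      using et t by (cases "E (\<xi> t)") (auto simp: z_def energy_dom_def E_eq[OF dom(4)])
    have ez: "e z - e \<rho> \<le> t * (s * (X + \<theta>) + \<theta>)"
      using et t E_eq[OF zD] E_eq[OF dom(4)] by (simp add: z_def field_simps)
    have zz: "dist z (\<zeta> t) \<le> 2 * \<theta> * t" using dt t by (simp add: z_def field_simps)
    have g\<rho>: "dist (\<zeta> t) \<rho> = t * X"
      using \<zeta> t t\<theta> unfolding is_geodesic_def X_def
      by (metis abs_of_nonneg atLeastAtMost_iff diff_zero dist_commute order_refl zero_le_one less_imp_le)
    have gA: "dist (\<zeta> t) A = (1 - t) * X"
      using \<zeta> t t\<theta> unfolding is_geodesic_def X_def
      by (metis abs_of_nonneg atLeastAtMost_iff diff_ge_0_iff_ge order_refl zero_le_one less_imp_le)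
    define P where "P = X + 2 * \<theta>"
    have P: "0 \<le> P" "P \<le> X + 2" using XYZ \<theta> by (auto simp: P_def)
    have dz: "dist z \<rho> \<le> t * P"
      using dist_triangle[of z \<rho> "\<zeta> t"] zz g\<rho> by (simp add: P_def algebra_simps)
    have "t * P \<le> t * (X + 2)" using P t by (intro mult_left_mono) auto
    also have "\<dots> < r\<^sub>0 / (X + 2) * (X + 2)"
      using t XYZ by (intro mult_strict_right_mono) (auto simp: b_def)
    also have "\<dots> = r\<^sub>0" using XYZ by simp
    finally have tP: "t * P < r\<^sub>0" .
    then have zr: "dist z \<rho> < r\<^sub>0" using dz by simp
    have "t * (s * (X + \<theta>) + \<theta>) \<le> r\<^sub>0 / (s * (X + \<theta>) + \<theta> + 1) * (s * (X + \<theta>) + \<theta> + 1)"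
      using t \<open>0 \<le> s * (X + \<theta>) + \<theta>\<close> par by (intro mult_mono) (auto simp: b_def)
    also have "\<dots> = r\<^sub>0" using \<open>0 \<le> s * (X + \<theta>) + \<theta>\<close> by simp
    finally have ezr: "e z \<le> e \<rho> + r\<^sub>0" using ez by simp
    have "dist z A \<le> X - t * (X - 2 * \<theta>)"
      using dist_triangle[of z A "\<zeta> t"] zz gA by (simp add: algebra_simps)
    then have "(dist z A)\<^sup>2 \<le> (X - t * (X - 2 * \<theta>))\<^sup>2" by (intro power_mono) auto
    also have "\<dots> = X\<^sup>2 - 2 * t * X * (X - 2 * \<theta>) + t\<^sup>2 * (X - 2 * \<theta>)\<^sup>2"
      by (simp add: power2_eq_square algebra_simps)
    also have "\<dots> \<le> X\<^sup>2 - 2 * t * X * (X - 2 * \<theta>) + t * \<theta> * (X + 2)\<^sup>2"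
    proof -
      have "(X - 2 * \<theta>)\<^sup>2 \<le> (X + 2)\<^sup>2" using XYZ \<theta> by (intro power2_le_iff_abs_le[THEN iffD2]) auto
      moreover have "t\<^sup>2 \<le> t * \<theta>" using t t\<theta> by (simp add: power2_eq_square)
      ultimately have "t\<^sup>2 * (X - 2 * \<theta>)\<^sup>2 \<le> t * \<theta> * (X + 2)\<^sup>2"
        using t \<theta> by (intro mult_mono) auto
      then show ?thesis by simp
    qed
    finally have sqA: "(dist z A)\<^sup>2 - X\<^sup>2 \<le> t * (- 2 * X * (X - 2 * \<theta>) + \<theta> * (X + 2)\<^sup>2)"
      by (simp add: algebra_simps)
    have sq: "(dist z x)\<^sup>2 - (dist \<rho> x)\<^sup>2 \<le> t * (2 * dist \<rho> x * P + \<theta> * (X + 2)\<^sup>2)" for x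
    proof -
      have "dist z x \<le> dist \<rho> x + t * P" using dist_triangle[of z x \<rho>] dz by simp
      then have "(dist z x)\<^sup>2 \<le> (dist \<rho> x + t * P)\<^sup>2" by (intro power_mono) auto
      also have "\<dots> = (dist \<rho> x)\<^sup>2 + t * (2 * dist \<rho> x * P) + t\<^sup>2 * P\<^sup>2"
        by (simp add: power2_eq_square algebra_simps)
      also have "t\<^sup>2 * P\<^sup>2 \<le> t * \<theta> * (X + 2)\<^sup>2"
        using t t\<theta> \<theta> P by (intro mult_mono power_mono) (auto simp: power2_eq_square)
      finally show ?thesis by (simp add: algebra_simps)
    qed
    have A: "a/2 * ((dist z A)\<^sup>2 - (dist \<rho> A)\<^sup>2) \<le> a/2 * (t * (- 2 * X * (X - 2 * \<theta>) + \<theta> * (X + 2)\<^sup>2))"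
      using sqA par by (intro mult_left_mono) (auto simp: X_def)
    have B: "a/2 * ((dist z B)\<^sup>2 - (dist \<rho> B)\<^sup>2) \<le> a/2 * (t * (2 * Y * P + \<theta> * (X + 2)\<^sup>2))"
      using sq[of B] par by (intro mult_left_mono) (auto simp: Y_def)
    have y: "\<epsilon> * (((dist z y)\<^sup>2 - (dist \<rho> y)\<^sup>2) / (1 + (dist \<rho> y)\<^sup>2)) \<le> \<epsilon> * (t * (P + \<theta> * (X + 2)\<^sup>2))"
    proof (intro mult_left_mono)
      \<comment> \<open>This is the bound \<open>2 * Z / (1 + Z\<^sup>2) \<le> 1\<close> on the
        derivative of the logarithm.\<close>
      have "2 * Z * P \<le> (1 + Z\<^sup>2) * P"
        using zero_le_power2[of "1 - Z"] P by (intro mult_right_mono) (auto simp: power2_eq_square algebra_simps)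
      moreover have "\<theta> * (X + 2)\<^sup>2 \<le> (1 + Z\<^sup>2) * (\<theta> * (X + 2)\<^sup>2)"
        using \<theta> by (simp add: algebra_simps)
      ultimately have "2 * Z * P + \<theta> * (X + 2)\<^sup>2 \<le> (1 + Z\<^sup>2) * (P + \<theta> * (X + 2)\<^sup>2)"
        by (simp only: distrib_left)
      then have "t * (2 * Z * P + \<theta> * (X + 2)\<^sup>2) \<le> t * ((1 + Z\<^sup>2) * (P + \<theta> * (X + 2)\<^sup>2))"
        using t by (intro mult_left_mono) auto
      then have "(dist z y)\<^sup>2 - (dist \<rho> y)\<^sup>2 \<le> t * (P + \<theta> * (X + 2)\<^sup>2) * (1 + Z\<^sup>2)"
        using sq[of y] by (simp add: Z_def mult_ac)
      moreover have "0 < 1 + Z\<^sup>2" by (simp add: add_pos_nonneg)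
      ultimately show "((dist z y)\<^sup>2 - (dist \<rho> y)\<^sup>2) / (1 + (dist \<rho> y)\<^sup>2) \<le> t * (P + \<theta> * (X + 2)\<^sup>2)"
        by (simp add: Z_def pos_divide_le_eq)
    qed (use par in auto)
    have V: "V z - V \<rho> \<le> l * (t * P)"
      using V_lip[OF zr] mult_left_mono[OF dz, of l] par by simp
    have Q: "Q * (e z - e \<rho>) \<le> Q * (t * (s * (X + \<theta>) + \<theta>))"
      using ez q by (intro mult_left_mono)
    have "0 \<le> a/2 * (t * (- 2 * X * (X - 2 * \<theta>) + \<theta> * (X + 2)\<^sup>2))
        + a/2 * (t * (2 * Y * P + \<theta> * (X + 2)\<^sup>2)) + Q * (t * (s * (X + \<theta>) + \<theta>))
        + \<epsilon> * (t * (P + \<theta> * (X + 2)\<^sup>2)) + l * (t * P)"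
      by (intro order_trans[OF minimizer_first_order[OF zD zr ezr, folded Q_def]] add_mono A B Q y V)
    also have "\<dots> = t * (X * (- a * X + a * Y + Q * s + \<epsilon> + l) + \<theta> * K)"
      by (simp add: P_def K_def power2_eq_square algebra_simps)
    finally show ?thesis using t by (simp add: zero_le_mult_iff)
  qed
  have "0 \<le> X * (- a * X + a * Y + Q * s + \<epsilon> + l)"
  proof (rule field_le_epsilon)
    fix \<delta> :: real assume \<delta>: "0 < \<delta>"
    define \<theta> where "\<theta> = min 1 (\<delta> / (K + 1))"
    have \<theta>: "0 < \<theta>" "\<theta> \<le> 1" using \<delta> K by (auto simp: \<theta>_def intro!: divide_pos_pos)
    have "\<theta> * K \<le> \<delta> / (K + 1) * (K + 1)" using K \<delta> by (intro mult_mono) (auto simp: \<theta>_def)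
    also have "\<dots> = \<delta>" using K by simp
    finally show "0 \<le> X * (- a * X + a * Y + Q * s + \<epsilon> + l) + \<delta>" using main[OF \<theta>] by simp
  qed
  then have "X = 0 \<or> 0 \<le> - a * X + a * Y + Q * s + \<epsilon> + l"
    using XYZ by (auto simp: zero_le_mult_iff)
  then have "a * X \<le> a * Y + Q * s + \<epsilon> + l"
  proof
    assume "X = 0"
    moreover have "0 \<le> a * Y" "0 \<le> Q * s" using XYZ par q s by auto
    ultimately show ?thesis using par(4,5) by simp
  next
    assume "0 \<le> - a * X + a * Y + Q * s + \<epsilon> + l"
    then show ?thesis by (simp add: algebra_simps)
  qed
  then show ?thesis by (simp add: X_def Y_def s_def Q_def)
qed

end

end

section \<open>Semicontinuity and density of points of finite information\<close>

definition usc_on :: "'a::metric_space set \<Rightarrow> ('a \<Rightarrow> real) \<Rightarrow> bool" where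
  "usc_on X f \<longleftrightarrow> (\<forall>x\<in>X. \<forall>a. f x < a \<longrightarrow> (\<exists>r>0. \<forall>y\<in>X. dist y x < r \<longrightarrow> f y < a))"

lemma usc_onD: "\<lbrakk>usc_on X f; x \<in> X; f x < a\<rbrakk> \<Longrightarrow> \<exists>r>0. \<forall>y\<in>X. dist y x < r \<longrightarrow> f y < a"
  by (simp add: usc_on_def)

lemma usc_on_add:
  assumes "usc_on X f" "usc_on X g"
  shows "usc_on X (\<lambda>x. f x + g x)"
  unfolding usc_on_def
proof (intro ballI allI impI)
  fix x a assume x: "x \<in> X" and less: "f x + g x < a"
  define d where "d = (a - (f x + g x)) / 2"
  have d: "0 < d" using less by (simp add: d_def)
  obtain r1 where r1: "0 < r1" "\<forall>y\<in>X. dist y x < r1 \<longrightarrow> f y < f x + d"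
    using usc_onD[OF assms(1) x, of "f x + d"] d by auto
  obtain r2 where r2: "0 < r2" "\<forall>y\<in>X. dist y x < r2 \<longrightarrow> g y < g x + d"
    using usc_onD[OF assms(2) x, of "g x + d"] d by auto
  show "\<exists>r>0. \<forall>y\<in>X. dist y x < r \<longrightarrow> f y + g y < a"
  proof (intro exI[of _ "min r1 r2"] conjI ballI impI)
    fix y assume "y \<in> X" "dist y x < min r1 r2"
    then have "f y < f x + d" "g y < g x + d" using r1 r2 by auto
    then show "f y + g y < a" by (simp add: d_def field_simps)
  qed (use r1 r2 in auto)
qed

lemma usc_on_cmult:
  assumes "usc_on X f" "0 \<le> c"
  shows "usc_on X (\<lambda>x. c * f x)"
proof (cases "c = 0")
  case True
  then show ?thesis by (auto simp: usc_on_def intro: exI[of _ 1])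
next
  case False
  then have "0 < c" using assms by simp
  then show ?thesis
    using assms(1) by (simp add: usc_on_def pos_less_divide_eq[symmetric] mult.commute[of c])
qed

lemma continuous_on_imp_usc_on:
  assumes "continuous_on X f"
  shows "usc_on X f"
  unfolding usc_on_def
proof (intro ballI allI impI)
  fix x a assume x: "x \<in> X" "f x < a"
  then obtain r where "0 < r" "\<forall>y\<in>X. dist y x < r \<longrightarrow> dist (f y) (f x) < a - f x"
    using assms unfolding continuous_on_iff by (metis diff_gt_0_iff_gt)
  then show "\<exists>r>0. \<forall>y\<in>X. dist y x < r \<longrightarrow> f y < a"
    by (intro exI[of _ r]) (force simp: dist_real_def)
qed

lemma usc_on_compose:
  assumes f: "usc_on Y f" and g: "continuous_on X g" "g ` X \<subseteq> Y"
  shows "usc_on X (\<lambda>x. f (g x))"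
  unfolding usc_on_def
proof (intro ballI allI impI)
  fix x a assume x: "x \<in> X" "f (g x) < a"
  then obtain r where r: "0 < r" "\<forall>y\<in>Y. dist y (g x) < r \<longrightarrow> f y < a"
    using usc_onD[OF f] g by blast
  then obtain r' where "0 < r'" "\<forall>y\<in>X. dist y x < r' \<longrightarrow> dist (g y) (g x) < r"
    using g(1) x(1) unfolding continuous_on_iff by blast
  with r g(2) show "\<exists>r>0. \<forall>y\<in>X. dist y x < r \<longrightarrow> f (g y) < a" by blast
qed

section \<open>Weighted sums of squared distances\<close>

lemma weighted_sq_dist_summable:
  fixes w :: "nat \<Rightarrow> real" and c :: "nat \<Rightarrow> 'a::metric_space"
  assumes w: "\<And>i. 0 < w i" "w sums W" and R: "\<And>i. dist z (c i) \<le> R"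
  shows "summable (\<lambda>i. w i * (dist z (c i))\<^sup>2)"
proof (rule summable_comparison_test)
  show "summable (\<lambda>i. w i * R\<^sup>2)" using w by (intro summable_mult2) (auto simp: sums_iff)
  have "w n * (dist z (c n))\<^sup>2 \<le> w n * R\<^sup>2" for n
    using R[of n] w(1)[of n] by (intro mult_left_mono power_mono) auto
  then show "\<exists>N. \<forall>n\<ge>N. norm (w n * (dist z (c n))\<^sup>2) \<le> w n * R\<^sup>2"
    using w(1) by (auto simp: abs_mult less_imp_le)
qed

lemma weighted_sq_dist_lipschitz:
  fixes w :: "nat \<Rightarrow> real" and c :: "nat \<Rightarrow> 'a::metric_space"
  assumes w: "\<And>i. 0 < w i" "w sums W" and R: "\<And>i. dist \<sigma> (c i) \<le> R" and z: "dist z \<sigma> \<le> 1"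
  shows "(\<Sum>i. w i * (dist z (c i))\<^sup>2) \<le> (\<Sum>i. w i * (dist \<sigma> (c i))\<^sup>2) + W * (dist z \<sigma> * (1 + 2 * R))"
proof -
  have zR: "dist z (c i) \<le> R + 1" for i using dist_triangle[of z "c i" \<sigma>] R[of i] z by simp
  have summ: "summable (\<lambda>i. w i * (dist z (c i))\<^sup>2)" "summable (\<lambda>i. w i * (dist \<sigma> (c i))\<^sup>2)"
    by (rule weighted_sq_dist_summable[OF w zR]) (rule weighted_sq_dist_summable[OF w R])
  have sW: "(\<lambda>i. w i * (dist z \<sigma> * (1 + 2 * R))) sums (W * (dist z \<sigma> * (1 + 2 * R)))"
    by (intro sums_mult2 w)
  have "(\<Sum>i. w i * (dist z (c i))\<^sup>2) \<le> (\<Sum>i. w i * (dist \<sigma> (c i))\<^sup>2 + w i * (dist z \<sigma> * (1 + 2 * R)))"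
  proof (rule suminf_le)
    fix i
    have "dist z \<sigma> * (1 + 2 * dist \<sigma> (c i)) \<le> dist z \<sigma> * (1 + 2 * R)" using R by (intro mult_left_mono) auto
    then have "w i * (dist z (c i))\<^sup>2 \<le> w i * ((dist \<sigma> (c i))\<^sup>2 + dist z \<sigma> * (1 + 2 * R))"
      using sq_dist_le[OF z, of "c i"] w(1)[of i] by (intro mult_left_mono) auto
    then show "w i * (dist z (c i))\<^sup>2 \<le> w i * (dist \<sigma> (c i))\<^sup>2 + w i * (dist z \<sigma> * (1 + 2 * R))"
      by (simp add: algebra_simps)
  qed (use summ sW in \<open>auto intro!: summable_add simp: sums_iff\<close>)
  also have "\<dots> = (\<Sum>i. w i * (dist \<sigma> (c i))\<^sup>2) + W * (dist z \<sigma> * (1 + 2 * R))"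
    using suminf_add[OF summ(2) sums_summable[OF sW]] sums_unique[OF sW] by simp
  finally show ?thesis .
qed

lemma sum_le_of_sums:
  fixes w :: "nat \<Rightarrow> real"
  assumes "\<And>i. 0 < w i" "w sums W"
  shows "(\<Sum>i<k. w i) \<le> W"
  using sum_le_suminf[of w "{..<k}"] assms by (auto simp: sums_iff less_imp_le)

context evi_space
begin

lemma usc_on_minus_e: "X \<subseteq> D \<Longrightarrow> usc_on X (\<lambda>z. - e z)"
  unfolding usc_on_def
proof (intro ballI allI impI)
  fix x a assume X: "X \<subseteq> D" and x: "x \<in> X" "- e x < a"
  then have "x \<in> D" by auto
  then have "ereal (- a) < E x" using x by (simp add: E_eq)
  from lsc_E[OF this] obtain r where "0 < r" "\<forall>y. dist y x < r \<longrightarrow> ereal (- a) < E y" by blast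
  then show "\<exists>r>0. \<forall>y\<in>X. dist y x < r \<longrightarrow> - e y < a"
    using X by (intro exI[of _ r]) (force simp: E_eq)
qed

text \<open>As long as the denominator is positive, \<open>L / (e z + c)\<close> decreases with the
  energy, so lower semicontinuity of the energy makes it upper semicontinuous.\<close>

lemma usc_on_minus_penalty:
  assumes X: "X \<subseteq> D" and pos: "\<And>z. z \<in> X \<Longrightarrow> 0 < e z + c"
    and L: "0 \<le> L" and \<epsilon>\<^sub>1: "0 \<le> \<epsilon>\<^sub>1"
  shows "usc_on X (\<lambda>z. - penalty L c \<epsilon>\<^sub>1 \<epsilon> y z)"
proof -
  have 1: "usc_on X (\<lambda>z. L / (e z + c))"
    unfolding usc_on_def
  proof (intro ballI allI impI)
    fix x a assume x: "x \<in> X" and less: "L / (e x + c) < a"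
    have "((\<lambda>\<eta>. L / (e x - \<eta> + c)) \<longlongrightarrow> L / (e x - 0 + c)) (at_right 0)"
      using pos[OF x] by (intro tendsto_intros) auto
    from order_tendstoD(2)[OF this, of a] less
    have "eventually (\<lambda>\<eta>. L / (e x - \<eta> + c) < a) (at_right 0)" by simp
    moreover have "eventually (\<lambda>\<eta>. \<eta> < e x + c) (at_right 0)"
      using pos[OF x] by (auto simp: eventually_at_right_field)
    moreover have "eventually (\<lambda>\<eta>::real. 0 < \<eta>) (at_right 0)" by (rule eventually_at_right_less)
    ultimately have "eventually (\<lambda>\<eta>. L / (e x - \<eta> + c) < a \<and> \<eta> < e x + c \<and> 0 < \<eta>) (at_right 0)"
      by eventually_elim simp
    then obtain \<eta> where \<eta>: "L / (e x - \<eta> + c) < a" "\<eta> < e x + c" "0 < \<eta>"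
      using eventually_happens[of _ "at_right (0::real)"] by (auto simp: trivial_limit_at_right_real)
    obtain r where r: "0 < r" "\<forall>z\<in>X. dist z x < r \<longrightarrow> - e z < - e x + \<eta>"
      using usc_onD[OF usc_on_minus_e[OF X] x, of "- e x + \<eta>"] \<eta> by auto
    have "L / (e z + c) < a" if "z \<in> X" "dist z x < r" for z
    proof -
      have "e x - \<eta> < e z" using r(2) that by force
      then have "L / (e z + c) \<le> L / (e x - \<eta> + c)"
        using \<eta> L by (intro divide_left_mono mult_pos_pos) auto
      with \<eta> show ?thesis by simp
    qed
    with r(1) show "\<exists>r>0. \<forall>z\<in>X. dist z x < r \<longrightarrow> L / (e z + c) < a" by blast
  qed
  have 2: "usc_on X (\<lambda>z. - \<epsilon> * ln (1 + (dist z y)\<^sup>2))"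
  proof (intro continuous_on_imp_usc_on continuous_intros)
    show "\<forall>x\<in>X. 1 + (dist x y)\<^sup>2 \<noteq> 0" by (metis add_pos_nonneg less_irrefl zero_le_power2 zero_less_one)
  qed
  have "usc_on X (\<lambda>z. L / (e z + c) + (\<epsilon>\<^sub>1 * (- e z) + - \<epsilon> * ln (1 + (dist z y)\<^sup>2)))"
    by (rule usc_on_add[OF 1 usc_on_add[OF usc_on_cmult[OF usc_on_minus_e[OF X] \<epsilon>\<^sub>1] 2]])
  then show ?thesis by (simp add: penalty_def algebra_simps)
qed

text \<open>Minus the energy is maximised with a penalty on the distance to \<open>x\<close>.
  Penalty and perturbation are Lipschitz near the maximizer, which therefore meets the criterion
  \<open>DI_I\<close>. The variational principle is applied with arbitrary centres, so that no
  density is presupposed.\<close>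

lemma DI_dense:
  assumes x: "x \<in> D" and r: "0 < r"
  shows "\<exists>\<sigma>\<in>DI. dist \<sigma> x < r \<and> e \<sigma> \<le> e x"
proof -
  obtain C where C: "0 < C" "\<And>z. z \<in> D \<Longrightarrow> - C * (1 + (dist z x)\<^sup>2) \<le> e z"
    using quadratic_lower_bound[OF x] by auto
  define X where "X = cball x 1 \<inter> {z. E z \<le> ereal (e x)}"
  have X_iff: "z \<in> X \<longleftrightarrow> dist z x \<le> 1 \<and> z \<in> D \<and> e z \<le> e x" for z
    by (auto simp: X_def E_le_iff dist_commute)
  define r' where "r' = min r 1 / 2"
  have r': "0 < r'" "r' < r" "r' < 1" using r by (auto simp: r'_def)
  define M where "M = e x + 2 * C + 1"
  have lower: "- (2 * C) \<le> e z" if "z \<in> X" for z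
  proof -
    have "(dist z x)\<^sup>2 \<le> 1" using that by (simp add: X_iff power_le_one)
    then have "C * (1 + (dist z x)\<^sup>2) \<le> C * 2" using C by (intro mult_left_mono) auto
    then show ?thesis using C(2)[of z] that by (simp add: X_iff)
  qed
  have xX: "x \<in> X" using x by (simp add: X_iff)
  have M: "0 < M" using lower[OF xX] by (simp add: M_def)
  \<comment> \<open>By near-maximality compared with \<open>x\<close>,
    \<open>K * (dist \<sigma> x)\<^sup>2 \<le> e x - e \<sigma> + 1/2\<close>, which is less than
    \<open>M\<close>; this strength of the penalty therefore places \<sigma> within
    \<open>r'\<close> of \<open>x\<close>.\<close>
  define K where "K = M / r'\<^sup>2"
  have K: "0 < K" "K * r'\<^sup>2 = M" using M r' by (auto simp: K_def)
  define \<Phi> where "\<Phi> = (\<lambda>z. - e z + - K * (dist z x)\<^sup>2)"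
  have XD: "X \<subseteq> D" by (auto simp: X_iff)
  have usc: "usc_on X \<Phi>"
    unfolding \<Phi>_def
    by (intro usc_on_add usc_on_minus_e XD continuous_on_imp_usc_on continuous_intros)
  have "closed X" unfolding X_def by (intro closed_Int closed_cball closed_sublevel)
  then have 1: "complete X" by (simp add: complete_eq_closed)
  have 2: "X \<noteq> {}" using xX by auto
  have 3: "bounded X" unfolding X_def by (intro bounded_Int disjI1 bounded_cball)
  have 4: "\<Phi> z \<le> 2 * C" if "z \<in> X" for z
  proof -
    have "0 \<le> K * (dist z x)\<^sup>2" using K by simp
    then show ?thesis using lower[OF that] unfolding \<Phi>_def by linarith
  qed
  have 6: "\<exists>c\<in>UNIV. dist c z < r" if "0 < r" for z :: 'a and r
    using that by (intro bexI[of _ z]) auto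
  obtain w c \<sigma> where w: "\<And>i. 0 < w i" "w sums 1"
    and c: "\<And>i. \<exists>y\<in>X. dist (c i) y \<le> 1" and \<sigma>: "\<sigma> \<in> X"
    and max: "\<And>z. z \<in> X \<Longrightarrow>
      \<Phi> z - (\<Sum>i. w i * (dist z (c i))\<^sup>2) \<le> \<Phi> \<sigma> - (\<Sum>i. w i * (dist \<sigma> (c i))\<^sup>2)"
    and near: "\<And>z. z \<in> X \<Longrightarrow> \<Phi> z \<le> \<Phi> \<sigma> + 1/2"
    by (rule borwein_preiss[OF 1 2 3 4 usc_onD[OF usc] 6, of "1/2" 1]) auto
  have "K * (dist \<sigma> x)\<^sup>2 < K * r'\<^sup>2"
    using near[OF xX] lower[OF \<sigma>] K by (simp add: \<Phi>_def M_def)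
  then have "(dist \<sigma> x)\<^sup>2 < r'\<^sup>2" using K(1) by (simp only: mult_less_cancel_left_pos)
  then have near': "dist \<sigma> x < r'" using r' by (simp add: power_less_imp_less_base)
  have \<sigma>D: "\<sigma> \<in> D" "e \<sigma> \<le> e x" using \<sigma> by (auto simp: X_iff)
  have R: "dist \<sigma> (c i) \<le> 3" for i
  proof -
    obtain y where "y \<in> X" "dist (c i) y \<le> 1" using c by blast
    then show ?thesis
      using dist_triangle[of \<sigma> "c i" x] dist_triangle[of x "c i" y] \<sigma>
      by (simp add: X_iff dist_commute)
  qed
  \<comment> \<open>In the Lipschitz constant, \<open>3 * K\<close> comes from the penalty in the
    unit ball, and \<open>7 = 1 + 2 * 3\<close> from a perturbation of weight 1 whose centres lie
    within distance 3 of \<sigma>.\<close>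
  have "\<sigma> \<in> DI"
  proof (rule DI_I[OF \<sigma>D(1), of "1 - r'" "3 * K + 7"])
    show "0 < 1 - r'" "0 \<le> 3 * K + 7" using r' K by auto
    fix z assume z: "dist z \<sigma> < 1 - r'" "z \<in> D" "e z \<le> e \<sigma>"
    have "z \<in> X" using z \<sigma>D near' dist_triangle[of z x \<sigma>] by (simp add: X_iff)
    have z1: "dist z \<sigma> \<le> 1" using z r' by simp
    have "(dist z x)\<^sup>2 \<le> (dist \<sigma> x)\<^sup>2 + dist z \<sigma> * (1 + 2 * dist \<sigma> x)" by (rule sq_dist_le[OF z1])
    also have "dist z \<sigma> * (1 + 2 * dist \<sigma> x) \<le> dist z \<sigma> * 3"
      using \<sigma> by (intro mult_left_mono) (auto simp: X_iff)
    finally have "K * (dist z x)\<^sup>2 \<le> K * ((dist \<sigma> x)\<^sup>2 + dist z \<sigma> * 3)"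
      using K by (intro mult_left_mono) auto
    moreover have "(\<Sum>i. w i * (dist z (c i))\<^sup>2) \<le> (\<Sum>i. w i * (dist \<sigma> (c i))\<^sup>2) + 1 * (dist z \<sigma> * (1 + 2 * 3))"
      by (rule weighted_sq_dist_lipschitz[OF w R z1])
    ultimately show "e \<sigma> \<le> e z + (3 * K + 7) * dist z \<sigma>"
      using max[OF \<open>z \<in> X\<close>] by (simp add: \<Phi>_def algebra_simps)
  qed
  then show ?thesis using near' r' \<sigma>D by (intro bexI[of _ \<sigma>]) auto
qed

end

section \<open>The viscosity inequality at a strict maximum\<close>

context evi_space
begin

text \<open>Transfers the viscosity inequality from near-maximizers to the maximizer \<pi>. The
  infinite perturbation is truncated to become a test function, and the strong maximum forces the
  resulting points towards \<pi>. In the limit \<open>h\<close> is continuous, the energy lower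
  semicontinuous, and \<open>u\<close> is compared only through optimality. The term with factor
  \<open>W\<close> is the contribution of the perturbation.\<close>

lemma subsolution_at_max:
  fixes h u :: "'a \<Rightarrow> real"
  assumes sub: "quad_subsolution lam \<sigma> h u" and lam: "0 < lam" and \<sigma>: "\<bar>\<sigma>\<bar> \<le> 1"
    and h: "continuous_on UNIV h" and bounds: "\<And>x. \<bar>u x\<bar> \<le> b" "\<And>x. \<bar>h x\<bar> \<le> b"
    and s: "0 < s" and a: "4 * s * b + 4 \<le> a"
    and \<rho>: "\<rho> \<in> DI" "dist \<rho> y \<le> R - 1"
    and w: "\<And>i. 0 < w i" "w sums W" "W * (2 * R + 1)\<^sup>2 \<le> 1"
    and c: "\<And>i. c i \<in> DI" "\<And>i. e (c i) \<le> N" "\<And>i. dist (c i) y \<le> R + 1"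
    and lower: "\<And>z. \<lbrakk>z \<in> D; dist z y \<le> R\<rbrakk> \<Longrightarrow> - m \<le> e z"
    and N: "a * e \<rho> + ((2 * s * b + s) / lam + a * \<bar>\<kappa>\<bar> + a\<^sup>2 / (2 * s) + \<bar>\<kappa>\<bar> + (2 + 2 * a) / s) \<le> a * N"
    and \<pi>: "\<pi> \<in> D" "dist \<pi> y \<le> R"
    and strict: "\<And>r. 0 < r \<Longrightarrow> \<exists>\<epsilon>>0. \<forall>x\<in>D. e x \<le> N \<and> dist x y \<le> R \<and>
        s * u \<pi> - a/2 * (dist \<pi> \<rho>)\<^sup>2 - (\<Sum>i. w i * (dist \<pi> (c i))\<^sup>2) - \<epsilon>
          < s * u x - a/2 * (dist x \<rho>)\<^sup>2 - (\<Sum>i. w i * (dist x (c i))\<^sup>2) \<longrightarrow> dist x \<pi> < r"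
  shows "s * (u \<pi> - h \<pi>) \<le> lam * (a * (e \<rho> - e \<pi> - \<kappa>/2 * (dist \<pi> \<rho>)\<^sup>2) + \<sigma> * (a\<^sup>2 / (2 * s) * (dist \<pi> \<rho>)\<^sup>2))
     + W * (lam * (2 * (N + m + \<bar>\<kappa>\<bar> * (2 * R + 1)\<^sup>2) + (2 + 2 * a) * (2 * R + 1) / s))"
proof -
  define C where "C = lam * (2 * (N + m + \<bar>\<kappa>\<bar> * (2 * R + 1)\<^sup>2) + (2 + 2 * a) * (2 * R + 1) / s)"
  define G where "G = (\<lambda>x z. lam * (a * (e \<rho> - z - \<kappa>/2 * (dist x \<rho>)\<^sup>2) + \<sigma> * (a\<^sup>2 / (2 * s) * (dist x \<rho>)\<^sup>2)))"
  have b0: "0 \<le> b" using bounds(1)[of \<rho>] by (meson abs_ge_zero order_trans)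
  have apos: "0 < a" using a s b0 by (smt (verit) mult_nonneg_nonneg)
  have W: "0 < W" using w(1)[of 0] sum_le_of_sums[OF w(1,2), of 1] by simp
  have R1: "1 \<le> R" using \<rho>(2) zero_le_dist[of \<rho> y] by linarith
  define T where "T = 2 * R + 1"
  have T: "1 \<le> T" using R1 by (simp add: T_def)
  have "W * T \<le> W * T\<^sup>2" using T W by (intro mult_left_mono) (auto simp: power2_eq_square)
  then have WT: "W * T \<le> 1" using w(3) by (simp add: T_def)
  have dT: "dist x (c i) \<le> T" if "dist x y \<le> R" for x i
    using dist_triangle2[of x "c i" y] c(3)[of i] that by (simp add: T_def)
  have step: "\<exists>p\<in>D. dist p \<pi> < r \<and>
      s * u \<pi> \<le> s * h p + G p (e p) + W * C + r + a/2 * ((dist \<pi> \<rho>)\<^sup>2 - (dist p \<rho>)\<^sup>2) + W * (dist \<pi> p * (1 + 2 * T))"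
    if r: "0 < r" for r
  proof -
    obtain \<epsilon>\<^sub>0 where \<epsilon>\<^sub>0: "0 < \<epsilon>\<^sub>0" "\<And>x. \<lbrakk>x \<in> D; e x \<le> N; dist x y \<le> R;
        s * u \<pi> - a/2 * (dist \<pi> \<rho>)\<^sup>2 - (\<Sum>i. w i * (dist \<pi> (c i))\<^sup>2) - \<epsilon>\<^sub>0
          < s * u x - a/2 * (dist x \<rho>)\<^sup>2 - (\<Sum>i. w i * (dist x (c i))\<^sup>2)\<rbrakk> \<Longrightarrow> dist x \<pi> < min r 1"
      using strict[of "min r 1"] r by auto
    define \<epsilon> where "\<epsilon> = min (min 1 (1 / s)) (min (\<epsilon>\<^sub>0 / (2 * s)) (r / (2 * s)))"
    have \<epsilon>: "0 < \<epsilon>" "\<epsilon> \<le> 1" "s * \<epsilon> \<le> 1" "s * \<epsilon> \<le> \<epsilon>\<^sub>0 / 2" "2 * (s * \<epsilon>) \<le> r"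
    proof -
      show "0 < \<epsilon>" "\<epsilon> \<le> 1" using \<epsilon>\<^sub>0 r s by (auto simp: \<epsilon>_def)
      have "\<epsilon> \<le> 1 / s" "\<epsilon> \<le> \<epsilon>\<^sub>0 / (2 * s)" "\<epsilon> \<le> r / (2 * s)" by (auto simp: \<epsilon>_def)
      then show "s * \<epsilon> \<le> 1" "s * \<epsilon> \<le> \<epsilon>\<^sub>0 / 2" "2 * (s * \<epsilon>) \<le> r" using s by (auto simp: field_simps)
    qed
    have "(\<lambda>n. \<Sum>i. w (i + n) * T\<^sup>2) \<longlonglongrightarrow> 0"
      using w(2) by (intro suminf_exist_split2 summable_mult2) (auto simp: sums_iff)
    then have "eventually (\<lambda>n. (\<Sum>i. w (i + n) * T\<^sup>2) < \<epsilon>\<^sub>0 / 2) sequentially"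
      using \<epsilon>\<^sub>0 by (intro order_tendstoD) auto
    from eventually_happens[OF eventually_conj[OF eventually_ge_at_top[of 1] this]]
    obtain k where k: "1 \<le> k" "(\<Sum>i. w (i + k) * T\<^sup>2) < \<epsilon>\<^sub>0 / 2" by auto
    \<comment> \<open>The factor 2 offsets the \<open>1/2\<close> in \<open>quad_test\<close>; the
      division by \<open>s\<close> is there because the maximised functional contains
      \<open>s * u\<close>, whereas the test function belongs to \<open>u\<close>.\<close>
    let ?w = "\<lambda>i. 2 * w i / s"
    define V where "V = (\<lambda>x. \<Sum>i<k. w i * (dist x (c i))\<^sup>2)"
    have test_eq: "quad_test (a / s) k \<rho> ?w c x = (a/2 * (dist x \<rho>)\<^sup>2 + V x) / s" for x
    proof -
      have "(\<Sum>i<k. ?w i * (1/2 * (dist x (c i))\<^sup>2)) = V x / s"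
        unfolding V_def sum_divide_distrib by (intro sum.cong) auto
      then show ?thesis by (simp add: quad_test_def add_divide_distrib)
    qed
    obtain p where p: "p \<in> D"
      "\<And>q. u q - quad_test (a / s) k \<rho> ?w c q \<le> u p - quad_test (a / s) k \<rho> ?w c p + \<epsilon>"
      "u p - h p \<le> lam * quad_ham \<sigma> (a / s) k \<rho> ?w c p + \<epsilon>"
      using sub[unfolded quad_subsolution_def, rule_format, of "a / s" k \<rho> ?w c \<epsilon>] apos s k(1) \<rho>(1) w(1) c(1) \<epsilon>(1)
      by auto
    have opt: "s * u q - a/2 * (dist q \<rho>)\<^sup>2 - V q \<le> s * u p - a/2 * (dist p \<rho>)\<^sup>2 - V p + s * \<epsilon>" for q
    proof -
      have "s * (u q - (a/2 * (dist q \<rho>)\<^sup>2 + V q) / s) \<le> s * (u p - (a/2 * (dist p \<rho>)\<^sup>2 + V p) / s + \<epsilon>)"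
        using p(2)[of q, unfolded test_eq] s by (intro mult_left_mono) auto
      moreover have "s * (x - Z / s) = s * x - Z" "s * (x - Z / s + \<epsilon>) = s * x - Z + s * \<epsilon>" for x Z
        using s by (simp_all add: right_diff_distrib distrib_left)
      ultimately show ?thesis by (simp only:)
    qed
    have V0: "0 \<le> V x" for x unfolding V_def using w(1) by (intro sum_nonneg) (auto simp: less_imp_le)
    have wk: "(\<Sum>i<k. w i) \<le> W" by (rule sum_le_of_sums[OF w(1,2)])
    have su: "\<bar>s * u x\<bar> \<le> s * b" "\<bar>s * h x\<bar> \<le> s * b" for x
      using bounds[of x] s by (auto simp: abs_mult intro!: mult_left_mono)
    have V_le: "V x \<le> 1" if "dist x y \<le> R" for x
    proof -
      have "V x \<le> (\<Sum>i<k. w i * T\<^sup>2)"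
        unfolding V_def using dT[OF that] w(1) by (intro sum_mono mult_left_mono power_mono) (auto simp: less_imp_le)
      also have "\<dots> = (\<Sum>i<k. w i) * T\<^sup>2" by (simp add: sum_distrib_right)
      also have "\<dots> \<le> W * T\<^sup>2" using wk by (intro mult_right_mono) auto
      finally show ?thesis using w(3) by (simp add: T_def)
    qed
    \<comment> \<open>Compare with \<rho>: boundedness and the size of \<open>a\<close> put
      \<open>p\<close> in the unit ball around \<rho>, and hence within \<open>R\<close> of
      \<open>y\<close>.\<close>
    have "a/2 * (dist p \<rho>)\<^sup>2 \<le> 2 * (s * b) + 2"
      using opt[of \<rho>] su(1)[of \<rho>] su(1)[of p] V0[of p] V_le[of \<rho>] \<rho>(2) \<epsilon>(3) by (simp add: abs_le_iff)
    also have "\<dots> \<le> a/2 * 1" using a by simp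
    finally have "(dist p \<rho>)\<^sup>2 \<le> 1" using apos by simp
    then have p\<rho>: "dist p \<rho> \<le> 1" by (simp add: power_le_one_iff abs_square_le_1)
    then have pR: "dist p y \<le> R" using dist_triangle[of p y \<rho>] \<rho>(2) by simp
    define \<omega> where "\<omega> = (\<Sum>i<k. 2 * w i)"
    have \<omega>: "0 \<le> \<omega>" "\<omega> \<le> 2 * W"
      unfolding \<omega>_def using wk w(1) by (auto simp: sum_distrib_left[symmetric] less_imp_le intro!: sum_nonneg)
    define Sl where "Sl = (\<Sum>i<k. 2 * w i * dist p (c i))"
    have Sl0: "0 \<le> Sl" unfolding Sl_def using w(1) by (intro sum_nonneg) (auto simp: less_imp_le)
    have "Sl \<le> (\<Sum>i<k. 2 * w i * T)"
      unfolding Sl_def using dT[OF pR] w(1) by (intro sum_mono mult_left_mono) (auto simp: less_imp_le)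
    also have "\<dots> = \<omega> * T" by (simp add: \<omega>_def sum_distrib_right)
    also have "\<dots> \<le> 2 * (W * T)" using \<omega> T by (simp add: mult_right_mono flip: mult.assoc)
    finally have Sl: "Sl \<le> 2 * (W * T)" .
    then have Sl2: "Sl \<le> 2" using WT by simp
    have Slsq: "1/2 * Sl\<^sup>2 \<le> Sl" using Sl0 Sl2 by (simp add: power2_eq_square mult_left_mono)
    define J where "J = (\<Sum>i<k. 2 * w i * (e (c i) - e p - \<kappa>/2 * (dist p (c i))\<^sup>2))"
    have ham_eq: "s * quad_ham \<sigma> (a / s) k \<rho> ?w c p =
        a * (e \<rho> - e p - \<kappa>/2 * (dist p \<rho>)\<^sup>2) + \<sigma> * (a\<^sup>2 / (2 * s) * (dist p \<rho>)\<^sup>2) + J + (1/2 * Sl\<^sup>2 + a * dist p \<rho> * Sl) / s"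
    proof -
      have 1: "quad_slope k ?w c p = Sl / s"
        unfolding quad_slope_def Sl_def by (simp add: sum_divide_distrib)
      have 2: "(\<Sum>i<k. ?w i * (e (c i) - e p - \<kappa>/2 * (dist p (c i))\<^sup>2)) = J / s"
        unfolding J_def by (simp add: sum_divide_distrib)
      have 3: "s * (a / s * x) = a * x" "s * (J / s) = J" "s * (1/2 * (Sl / s)\<^sup>2) = 1/2 * Sl\<^sup>2 / s"
        "s * (\<sigma> * ((a / s)\<^sup>2 / 2 * x)) = \<sigma> * (a\<^sup>2 / (2 * s) * x)" "s * (a / s * x * (Sl / s)) = a * x * Sl / s" for x
        using s by (simp_all add: power2_eq_square)
      show ?thesis unfolding quad_ham_def 1 2 by (simp only: distrib_left 3 add_divide_distrib add.assoc)
    qed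
    have J_le: "J \<le> \<omega> * (N - e p) + \<omega> * (\<bar>\<kappa>\<bar>/2 * T\<^sup>2)"
    proof -
      have "e (c i) - e p - \<kappa>/2 * (dist p (c i))\<^sup>2 \<le> (N - e p) + \<bar>\<kappa>\<bar>/2 * T\<^sup>2" for i
      proof -
        have "- \<kappa>/2 * (dist p (c i))\<^sup>2 \<le> \<bar>\<kappa>\<bar>/2 * T\<^sup>2"
          using dT[OF pR, of i] by (intro mult_mono power_mono) auto
        then show ?thesis using c(2)[of i] by simp
      qed
      then have "J \<le> (\<Sum>i<k. 2 * w i * ((N - e p) + \<bar>\<kappa>\<bar>/2 * T\<^sup>2))"
        unfolding J_def using w(1) by (intro sum_mono mult_left_mono) (auto simp: less_imp_le)
      also have "\<dots> = \<omega> * ((N - e p) + \<bar>\<kappa>\<bar>/2 * T\<^sup>2)" by (simp add: \<omega>_def sum_distrib_right)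
      finally show ?thesis by (simp add: distrib_left)
    qed
    have rest: "(1/2 * Sl\<^sup>2 + a * dist p \<rho> * Sl) / s \<le> (1 + a) * Sl / s"
    proof (rule divide_right_mono)
      have "a * dist p \<rho> * Sl \<le> a * 1 * Sl" using p\<rho> apos Sl0 by (intro mult_mono) auto
      then show "1/2 * Sl\<^sup>2 + a * dist p \<rho> * Sl \<le> (1 + a) * Sl" using Slsq by (simp add: algebra_simps)
    qed (use s in simp)
    have "s * (u p - h p) \<le> s * (lam * quad_ham \<sigma> (a / s) k \<rho> ?w c p + \<epsilon>)"
      using p(3) s by (intro mult_left_mono) auto
    also have "\<dots> = lam * (s * quad_ham \<sigma> (a / s) k \<rho> ?w c p) + s * \<epsilon>" by (simp add: algebra_simps)
    also have "\<dots> = G p (e p) + lam * (J + (1/2 * Sl\<^sup>2 + a * dist p \<rho> * Sl) / s) + s * \<epsilon>"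
      unfolding ham_eq G_def by (simp only: distrib_left add.assoc)
    finally have key: "s * (u p - h p) \<le> G p (e p) + lam * (J + (1/2 * Sl\<^sup>2 + a * dist p \<rho> * Sl) / s) + s * \<epsilon>" .
    \<comment> \<open>The strong maximum is only known on the energy sublevel \<open>N\<close>, and
      the viscosity inequality itself keeps \<open>p\<close> there: its right-hand side contains
      \<open>- (a + \<omega>) * e p\<close> up to the factor \<open>lam\<close>, and the hypothesis
      on \<open>N\<close> dominates the remaining terms.\<close>
    have pN: "e p \<le> N"
    proof -
      define A where "A = a * (e \<rho> - e p - \<kappa>/2 * (dist p \<rho>)\<^sup>2) + \<sigma> * (a\<^sup>2 / (2 * s) * (dist p \<rho>)\<^sup>2)"
      define B where "B = J + (1/2 * Sl\<^sup>2 + a * dist p \<rho> * Sl) / s"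
      have "- (2 * s * b + s) \<le> s * (u p - h p) - s * \<epsilon>"
      proof -
        have "- (s * b) \<le> s * u p" using abs_le_D2[OF su(1)[of p]] by linarith
        moreover have "s * h p \<le> s * b" by (rule abs_le_D1[OF su(2)])
        moreover have "s * \<epsilon> \<le> s" using \<epsilon>(2) s by simp
        moreover have "2 * s * b = s * b + s * b" by simp
        ultimately show ?thesis unfolding right_diff_distrib by linarith
      qed
      also have "\<dots> \<le> lam * (A + B)"
      proof -
        have "G p (e p) = lam * A" by (simp only: G_def A_def)
        then show ?thesis using key unfolding B_def[symmetric] distrib_left by linarith
      qed
      finally have "- (2 * s * b + s) / lam \<le> A + B"
        using lam by (simp only: pos_divide_le_eq mult.commute[of _ lam])
      then have "- ((2 * s * b + s) / lam) \<le> A + B" by (simp only: minus_divide_left)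
      moreover have "A \<le> a * (e \<rho> - e p) + a * \<bar>\<kappa>\<bar> + a\<^sup>2 / (2 * s)"
      proof -
        have d2: "(dist p \<rho>)\<^sup>2 \<le> 1" by fact
        have "- \<kappa>/2 * (dist p \<rho>)\<^sup>2 \<le> \<bar>\<kappa>\<bar> * 1" using d2 by (intro mult_mono) auto
        then have "a * (e \<rho> - e p - \<kappa>/2 * (dist p \<rho>)\<^sup>2) \<le> a * (e \<rho> - e p + \<bar>\<kappa>\<bar>)"
          using apos by (intro mult_left_mono) auto
        moreover have "\<sigma> * (a\<^sup>2 / (2 * s) * (dist p \<rho>)\<^sup>2) \<le> 1 * (a\<^sup>2 / (2 * s) * 1)"
          using \<sigma> d2 s by (intro mult_mono) auto
        moreover have "a * (e \<rho> - e p + \<bar>\<kappa>\<bar>) = a * (e \<rho> - e p) + a * \<bar>\<kappa>\<bar>" by (rule distrib_left)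
        ultimately show ?thesis unfolding A_def mult_1_left mult_1_right by linarith
      qed
      moreover have "B \<le> \<omega> * (N - e p) + \<bar>\<kappa>\<bar> + (2 + 2 * a) / s"
      proof -
        have "\<omega> * (\<bar>\<kappa>\<bar>/2 * T\<^sup>2) \<le> 2 * W * (\<bar>\<kappa>\<bar>/2 * T\<^sup>2)" using \<omega> by (intro mult_right_mono) auto
        also have "\<dots> = \<bar>\<kappa>\<bar> * (W * T\<^sup>2)" by simp
        also have "\<dots> \<le> \<bar>\<kappa>\<bar> * 1" using w(3) by (intro mult_left_mono) (auto simp: T_def)
        finally have "\<omega> * (\<bar>\<kappa>\<bar>/2 * T\<^sup>2) \<le> \<bar>\<kappa>\<bar>" by simp
        moreover have "(1 + a) * Sl / s \<le> (1 + a) * 2 / s"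
          using apos s Sl2 by (intro divide_right_mono mult_left_mono) auto
        moreover have "(1 + a) * 2 / s = (2 + 2 * a) / s" by (simp add: distrib_right)
        ultimately show ?thesis using J_le rest unfolding B_def by linarith
      qed
      ultimately have "- ((2 * s * b + s) / lam) \<le> (a * (e \<rho> - e p) + a * \<bar>\<kappa>\<bar> + a\<^sup>2 / (2 * s)) + (\<omega> * (N - e p) + \<bar>\<kappa>\<bar> + (2 + 2 * a) / s)"
        by linarith
      moreover have "a * (e \<rho> - e p) = a * e \<rho> - a * e p" by (rule right_diff_distrib)
      moreover have "(a + \<omega>) * (N - e p) = a * N - a * e p + \<omega> * (N - e p)" by (simp add: algebra_simps)
      moreover have "0 \<le> x" if "- q1 \<le> (y + k1 + q2) + (z + k2 + q3)" "y = v - t" "x = n - t + z"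
        "v + (q1 + k1 + q2 + k2 + q3) \<le> n" for x y z v t n q1 q2 q3 k1 k2 :: real
        using that by linarith
      ultimately have "0 \<le> (a + \<omega>) * (N - e p)" using N by blast
      then show ?thesis using apos \<omega> by (simp add: zero_le_mult_iff)
    qed
    \<comment> \<open>Two losses must stay below \<open>\<epsilon>\<^sub>0\<close> together: the
      tail cut off after \<open>k\<close> terms is less than \<open>\<epsilon>\<^sub>0 / 2\<close>,
      and the tolerance satisfies
      \<open>s * \<epsilon> \<le> \<epsilon>\<^sub>0 / 2\<close>.\<close>
    have near: "dist p \<pi> < min r 1"
    proof (rule \<epsilon>\<^sub>0(2)[OF p(1) pN pR])
      have summ: "summable (\<lambda>i. w i * (dist x (c i))\<^sup>2)" if "dist x y \<le> R" for x
        by (rule weighted_sq_dist_summable[OF w(1,2) dT[OF that]])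
      have "V \<pi> \<le> (\<Sum>i. w i * (dist \<pi> (c i))\<^sup>2)"
        unfolding V_def using summ[OF \<pi>(2)] w(1) by (intro sum_le_suminf) (auto simp: less_imp_le)
      moreover have "(\<Sum>i. w i * (dist p (c i))\<^sup>2) < V p + \<epsilon>\<^sub>0 / 2"
      proof -
        have "(\<Sum>i. w i * (dist p (c i))\<^sup>2) = (\<Sum>i. w (i + k) * (dist p (c (i + k)))\<^sup>2) + V p"
          unfolding V_def by (rule suminf_split_initial_segment[OF summ[OF pR]])
        moreover have "(\<Sum>i. w (i + k) * (dist p (c (i + k)))\<^sup>2) \<le> (\<Sum>i. w (i + k) * T\<^sup>2)"
        proof (rule suminf_le)
          show "w (i + k) * (dist p (c (i + k)))\<^sup>2 \<le> w (i + k) * T\<^sup>2" for i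
            using dT[OF pR] w(1)[of "i + k"] by (intro mult_left_mono power_mono) auto
          show "summable (\<lambda>i. w (i + k) * (dist p (c (i + k)))\<^sup>2)"
            using summ[OF pR] by (subst summable_iff_shift[where f = "\<lambda>i. w i * (dist p (c i))\<^sup>2"])
          show "summable (\<lambda>i. w (i + k) * T\<^sup>2)"
            using sums_summable[OF sums_mult2[OF w(2), of "T\<^sup>2"]] by (subst summable_iff_shift[where f = "\<lambda>i. w i * T\<^sup>2"])
        qed
        ultimately show ?thesis using k(2) by linarith
      qed
      ultimately show "s * u \<pi> - a/2 * (dist \<pi> \<rho>)\<^sup>2 - (\<Sum>i. w i * (dist \<pi> (c i))\<^sup>2) - \<epsilon>\<^sub>0
          < s * u p - a/2 * (dist p \<rho>)\<^sup>2 - (\<Sum>i. w i * (dist p (c i))\<^sup>2)"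
        using opt[of \<pi>] \<epsilon>(4) by linarith
    qed
    \<comment> \<open>With \<open>e p\<close> now bounded from both sides, everything caused by the
      perturbation is at most \<open>W\<close> times a constant independent of
      \<open>k\<close>.\<close>
    have JC: "lam * (J + (1/2 * Sl\<^sup>2 + a * dist p \<rho> * Sl) / s) \<le> W * C"
    proof -
      have m: "- m \<le> e p" by (rule lower[OF p(1) pR])
      have "\<omega> * (N - e p) + \<omega> * (\<bar>\<kappa>\<bar>/2 * T\<^sup>2) = \<omega> * ((N - e p) + \<bar>\<kappa>\<bar>/2 * T\<^sup>2)"
        by (simp add: distrib_left)
      also have "\<dots> \<le> (2 * W) * ((N + m) + \<bar>\<kappa>\<bar> * T\<^sup>2)"
        using \<omega> pN m by (intro mult_mono add_mono mult_right_mono) auto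
      finally have "J \<le> (2 * W) * ((N + m) + \<bar>\<kappa>\<bar> * T\<^sup>2)" using J_le by linarith
      moreover have "(1 + a) * Sl / s \<le> (1 + a) * (2 * (W * T)) / s"
        using apos s Sl by (intro divide_right_mono mult_left_mono) auto
      ultimately have "J + (1/2 * Sl\<^sup>2 + a * dist p \<rho> * Sl) / s
          \<le> (2 * W) * ((N + m) + \<bar>\<kappa>\<bar> * T\<^sup>2) + (1 + a) * (2 * (W * T)) / s"
        using rest by linarith
      also have "\<dots> = W * (2 * (N + m + \<bar>\<kappa>\<bar> * T\<^sup>2) + (2 + 2 * a) * T / s)"
      proof -
        have "(1 + a) * (2 * (W * T)) / s = W * ((2 + 2 * a) * T / s)" by (simp add: algebra_simps)
        then show ?thesis by (simp only: distrib_left[of W] mult_ac)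
      qed
      finally have "lam * (J + (1/2 * Sl\<^sup>2 + a * dist p \<rho> * Sl) / s)
          \<le> lam * (W * (2 * (N + m + \<bar>\<kappa>\<bar> * T\<^sup>2) + (2 + 2 * a) * T / s))"
        using lam by (intro mult_left_mono) auto
      then show ?thesis by (simp add: C_def T_def mult_ac)
    qed
    have V_lip: "V p \<le> V \<pi> + W * (dist \<pi> p * (1 + 2 * T)) \<and> V \<pi> \<le> V p + W * (dist \<pi> p * (1 + 2 * T))"
    proof -
      have *: "V x \<le> V z + W * (dist x z * (1 + 2 * T))" if xz: "dist x z \<le> 1" "dist z y \<le> R" for x z
      proof -
        have "V x \<le> (\<Sum>i<k. w i * (dist z (c i))\<^sup>2 + w i * (dist x z * (1 + 2 * T)))"
          unfolding V_def
        proof (rule sum_mono)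
          fix i
          have "dist x z * (1 + 2 * dist z (c i)) \<le> dist x z * (1 + 2 * T)"
            using dT[OF xz(2), of i] by (intro mult_left_mono) auto
          then have "w i * (dist x (c i))\<^sup>2 \<le> w i * ((dist z (c i))\<^sup>2 + dist x z * (1 + 2 * T))"
            using sq_dist_le[OF xz(1), of "c i"] w(1)[of i] by (intro mult_left_mono) auto
          then show "w i * (dist x (c i))\<^sup>2 \<le> w i * (dist z (c i))\<^sup>2 + w i * (dist x z * (1 + 2 * T))"
            by (simp add: distrib_left)
        qed
        also have "\<dots> = V z + (\<Sum>i<k. w i) * (dist x z * (1 + 2 * T))"
          by (simp add: V_def sum.distrib sum_distrib_right)
        also have "\<dots> \<le> V z + W * (dist x z * (1 + 2 * T))"
          using wk T by (intro add_left_mono mult_right_mono) auto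
        finally show ?thesis .
      qed
      from *[of p \<pi>] *[of \<pi> p] near pR \<pi>(2) show ?thesis by (simp add: dist_commute)
    qed
    have "s * u \<pi> \<le> s * h p + G p (e p) + W * C + r + a/2 * ((dist \<pi> \<rho>)\<^sup>2 - (dist p \<rho>)\<^sup>2) + W * (dist \<pi> p * (1 + 2 * T))"
    proof -
      have "s * u p - s * h p \<le> G p (e p) + W * C + s * \<epsilon>"
        using key JC unfolding right_diff_distrib[of s] by linarith
      then show ?thesis
        using opt[of \<pi>] conjunct2[OF V_lip] \<epsilon>(5) unfolding right_diff_distrib[of "a/2"] by linarith
    qed
    with p(1) near show ?thesis by auto
  qed
  have "\<exists>p. \<forall>n. p n \<in> D \<and> dist (p n) \<pi> < 1 / real (Suc n) \<and>
      s * u \<pi> \<le> s * h (p n) + G (p n) (e (p n)) + W * C + 1 / real (Suc n)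
        + a/2 * ((dist \<pi> \<rho>)\<^sup>2 - (dist (p n) \<rho>)\<^sup>2) + W * (dist \<pi> (p n) * (1 + 2 * T))"
    using step[of "1 / real (Suc n)" for n] by (intro choice) (auto simp: Bex_def)
  then obtain p where p: "\<And>n. p n \<in> D" "\<And>n. dist (p n) \<pi> < 1 / real (Suc n)"
    "\<And>n. s * u \<pi> \<le> s * h (p n) + G (p n) (e (p n)) + W * C + 1 / real (Suc n)
        + a/2 * ((dist \<pi> \<rho>)\<^sup>2 - (dist (p n) \<rho>)\<^sup>2) + W * (dist \<pi> (p n) * (1 + 2 * T))"
    by blast
  have inv: "(\<lambda>n. 1 / real (Suc n)) \<longlonglongrightarrow> 0" by (rule LIMSEQ_Suc[OF lim_1_over_n])
  have p_lim: "p \<longlonglongrightarrow> \<pi>"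
  proof -
    have "(\<lambda>n. dist (p n) \<pi>) \<longlonglongrightarrow> 0"
      by (rule tendsto_sandwich[OF _ _ tendsto_const inv]) (auto intro!: always_eventually less_imp_le p(2) simp del: of_nat_Suc)
    then show ?thesis by (rule tendsto_dist_iff[THEN iffD2])
  qed
  have "s * u \<pi> \<le> s * h \<pi> + G \<pi> (e \<pi>) + W * C"
  proof (rule field_le_epsilon)
    fix \<delta> :: real assume \<delta>: "0 < \<delta>"
    \<comment> \<open>The energy enters with a negative sign, so near \<pi> it may be replaced by
      \<open>e \<pi> - \<eta>\<close>. What remains is continuous along \<open>p\<close>, and the
      replacement costs exactly \<delta>.\<close>
    define \<eta> where "\<eta> = \<delta> / (lam * a)"
    have \<eta>: "0 < \<eta>" "lam * (a * \<eta>) = \<delta>" using \<delta> lam apos by (simp_all add: \<eta>_def)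
    obtain r where r: "0 < r" "\<And>z. dist z \<pi> < r \<Longrightarrow> ereal (e \<pi> - \<eta>) \<le> E z"
      using lsc_e[OF \<pi>(1) \<eta>(1)] by blast
    have "eventually (\<lambda>n. dist (p n) \<pi> < r) sequentially"
      using p_lim r(1) by (simp add: tendsto_iff)
    then have ev: "eventually (\<lambda>n. s * u \<pi> \<le> s * h (p n) + G (p n) (e \<pi> - \<eta>) + W * C + 1 / real (Suc n)
        + a/2 * ((dist \<pi> \<rho>)\<^sup>2 - (dist (p n) \<rho>)\<^sup>2) + W * (dist \<pi> (p n) * (1 + 2 * T))) sequentially"
    proof eventually_elim
      case (elim n)
      have "e \<pi> - \<eta> \<le> e (p n)" using r(2)[OF elim] E_eq[OF p(1)[of n]] by simp
      then have "G (p n) (e (p n)) \<le> G (p n) (e \<pi> - \<eta>)"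
      proof -
        have "a * (e \<rho> - e (p n) - \<kappa>/2 * (dist (p n) \<rho>)\<^sup>2) \<le> a * (e \<rho> - (e \<pi> - \<eta>) - \<kappa>/2 * (dist (p n) \<rho>)\<^sup>2)"
          using apos \<open>e \<pi> - \<eta> \<le> e (p n)\<close> by (intro mult_left_mono) auto
        then show ?thesis unfolding G_def using lam by (intro mult_left_mono) auto
      qed
      then show ?case using p(3)[of n] by linarith
    qed
    have h_lim: "(\<lambda>n. h (p n)) \<longlonglongrightarrow> h \<pi>"
      using h p_lim by (auto intro: continuous_on_tendsto_compose)
    have "(\<lambda>n. s * h (p n) + G (p n) (e \<pi> - \<eta>) + W * C + 1 / real (Suc n)
        + a/2 * ((dist \<pi> \<rho>)\<^sup>2 - (dist (p n) \<rho>)\<^sup>2) + W * (dist \<pi> (p n) * (1 + 2 * T)))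
      \<longlonglongrightarrow> s * h \<pi> + G \<pi> (e \<pi> - \<eta>) + W * C + 0 + a/2 * ((dist \<pi> \<rho>)\<^sup>2 - (dist \<pi> \<rho>)\<^sup>2) + W * (dist \<pi> \<pi> * (1 + 2 * T))"
      unfolding G_def by (intro tendsto_intros h_lim p_lim inv)
    from tendsto_lowerbound[OF this ev]
    have "s * u \<pi> \<le> s * h \<pi> + G \<pi> (e \<pi> - \<eta>) + W * C" by simp
    also have "G \<pi> (e \<pi> - \<eta>) = G \<pi> (e \<pi>) + \<delta>"
      unfolding G_def \<eta>(2)[symmetric] by (simp add: algebra_simps)
    finally show "s * u \<pi> \<le> s * h \<pi> + G \<pi> (e \<pi>) + W * C + \<delta>" by simp
  qed
  then have "s * u \<pi> - s * h \<pi> \<le> G \<pi> (e \<pi>) + W * C" by simp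
  then have "s * (u \<pi> - h \<pi>) \<le> G \<pi> (e \<pi>) + W * C" by (simp only: right_diff_distrib)
  then show ?thesis by (simp only: G_def C_def)
qed

end

section \<open>Quadrupling of variables\<close>

context evi_space
begin

text \<open>Here the abstract \<open>V\<close> becomes the weighted sum of squared distances. The
  two bounds on \<open>l\<close> are its Lipschitz constant near \<rho> and its growth rate along
  the flow, the latter from \<open>flow_small\<close> for all centres simultaneously. The margins
  \<open>R - 1\<close> and \<open>e \<rho> + 1 \<le> N\<close> make the constraints inactive near
  \<rho>.\<close>

lemma middle_point_estimates:
  assumes reg: "regularized_geodesics_assumption E"
    and dom: "A \<in> D" "B \<in> D" "y \<in> D" "\<rho> \<in> D"
    and par: "0 < a" "0 \<le> L" "0 < \<epsilon>\<^sub>1" "0 \<le> \<epsilon>"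
    and \<rho>: "dist \<rho> y \<le> R - 1" "e \<rho> + 1 \<le> N"
    and lower: "\<And>z. \<lbrakk>z \<in> D; dist z y \<le> R\<rbrakk> \<Longrightarrow> 0 < e z + c"
    and w: "\<And>i. 0 < w i" "w sums W"
    and p: "\<And>i. p i \<in> D" "\<And>i. e (p i) \<le> N" "\<And>i. dist \<rho> (p i) \<le> T"
    and l: "W * (1 + 2 * T) \<le> l" "W * (2 * (N - e \<rho> + \<bar>\<kappa>\<bar> * T\<^sup>2 + 1)) \<le> l"
    and minimal: "\<And>z. \<lbrakk>z \<in> D; dist z y \<le> R; e z \<le> N\<rbrakk> \<Longrightarrow>
      a/2 * (dist \<rho> A)\<^sup>2 + a/2 * (dist \<rho> B)\<^sup>2 + penalty L c \<epsilon>\<^sub>1 \<epsilon> y \<rho> + (\<Sum>i. w i * (dist \<rho> (p i))\<^sup>2)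
        \<le> a/2 * (dist z A)\<^sup>2 + a/2 * (dist z B)\<^sup>2 + penalty L c \<epsilon>\<^sub>1 \<epsilon> y z + (\<Sum>i. w i * (dist z (p i))\<^sup>2)"
  shows "\<rho> \<in> DI"
    and "0 \<le> a * (e A - e \<rho> - \<kappa>/2 * (dist \<rho> A)\<^sup>2) + a * (e B - e \<rho> - \<kappa>/2 * (dist \<rho> B)\<^sup>2)
     - (L / (e \<rho> + c)\<^sup>2 + \<epsilon>\<^sub>1) * ((slope \<rho>)\<^sup>2 / 2)
     + 2 * \<epsilon> / (1 + (dist \<rho> y)\<^sup>2) * (e y - e \<rho> - \<kappa>/2 * (dist \<rho> y)\<^sup>2) + l"
    and "a * dist \<rho> A \<le> a * dist \<rho> B + (L / (e \<rho> + c)\<^sup>2 + \<epsilon>\<^sub>1) * slope \<rho> + \<epsilon> + l"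
proof -
  define V where "V = (\<lambda>z. \<Sum>i. w i * (dist z (p i))\<^sup>2)"
  have T0: "0 \<le> T" using p(3)[of 0] zero_le_dist[of \<rho> "p 0"] by linarith
  have W: "0 < W" using w(1)[of 0] sum_le_of_sums[OF w(1,2), of 1] by simp
  have l0: "0 \<le> l" using l(1) W T0 by (meson add_nonneg_nonneg less_imp_le mult_nonneg_nonneg order_trans zero_le_numeral zero_le_one)
  obtain \<tau>1 where \<tau>1: "0 < \<tau>1" "\<And>t \<sigma>. \<lbrakk>0 \<le> t; t < \<tau>1; \<sigma> \<in> D; dist \<rho> \<sigma> \<le> T\<rbrakk> \<Longrightarrow>
      (dist (S t \<rho>) \<sigma>)\<^sup>2 \<le> (dist \<rho> \<sigma>)\<^sup>2 + 2 * t * (e \<sigma> - e \<rho> - \<kappa>/2 * (dist \<rho> \<sigma>)\<^sup>2 + 1)"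
    using flow_small[OF dom(4) zero_less_one T0] by auto
  obtain \<tau>2 where \<tau>2: "0 < \<tau>2" "\<And>t. \<lbrakk>0 \<le> t; t < \<tau>2\<rbrakk> \<Longrightarrow> dist (S t \<rho>) \<rho> < 1"
    using flow_near[of 1 \<rho>] by auto
  define r\<^sub>0 where "r\<^sub>0 = min 1 (min \<tau>1 \<tau>2)"
  have r\<^sub>0: "0 < r\<^sub>0" "r\<^sub>0 \<le> 1" using \<tau>1 \<tau>2 by (auto simp: r\<^sub>0_def)
  have inR: "dist z y \<le> R" if "dist z \<rho> < r\<^sub>0" for z
    using dist_triangle[of z y \<rho>] that \<rho>(1) r\<^sub>0 by linarith
  have 1: "0 < e z + c" if "z \<in> D" "dist z \<rho> < r\<^sub>0" for z
    using lower[OF that(1) inR[OF that(2)]] .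
  have 2: "V z \<le> V \<rho> + l * dist z \<rho>" if z: "dist z \<rho> < r\<^sub>0" for z
  proof -
    have "V z \<le> V \<rho> + W * (dist z \<rho> * (1 + 2 * T))"
      unfolding V_def using z r\<^sub>0 by (intro weighted_sq_dist_lipschitz[OF w p(3)]) auto
    moreover have "W * (1 + 2 * T) * dist z \<rho> \<le> l * dist z \<rho>" by (intro mult_right_mono l(1)) auto
    ultimately show ?thesis by (simp add: mult_ac)
  qed
  have 3: "V (S t \<rho>) \<le> V \<rho> + t * l" if t: "0 < t" "t < r\<^sub>0" for t
  proof -
    define K where "K = 2 * (N - e \<rho> + \<bar>\<kappa>\<bar> * T\<^sup>2 + 1)"
    have "dist (S t \<rho>) \<rho> < 1" using \<tau>2(2)[of t] t by (simp add: r\<^sub>0_def)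
    then have zT: "dist (S t \<rho>) (p i) \<le> T + 1" for i
      using dist_triangle[of "S t \<rho>" "p i" \<rho>] p(3)[of i] by linarith
    have summ: "summable (\<lambda>i. w i * (dist (S t \<rho>) (p i))\<^sup>2)" "summable (\<lambda>i. w i * (dist \<rho> (p i))\<^sup>2)"
      by (rule weighted_sq_dist_summable[OF w zT]) (rule weighted_sq_dist_summable[OF w p(3)])
    have sW: "(\<lambda>i. w i * (t * K)) sums (W * (t * K))" by (intro sums_mult2 w)
    have "V (S t \<rho>) \<le> (\<Sum>i. w i * (dist \<rho> (p i))\<^sup>2 + w i * (t * K))"
      unfolding V_def
    proof (rule suminf_le)
      fix i
      have "- \<kappa>/2 * (dist \<rho> (p i))\<^sup>2 \<le> \<bar>\<kappa>\<bar> * T\<^sup>2" using p(3) by (intro mult_mono power_mono) auto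
      then have "e (p i) - e \<rho> - \<kappa>/2 * (dist \<rho> (p i))\<^sup>2 + 1 \<le> K / 2" using p(2)[of i] by (simp add: K_def)
      then have "2 * t * (e (p i) - e \<rho> - \<kappa>/2 * (dist \<rho> (p i))\<^sup>2 + 1) \<le> 2 * t * (K / 2)"
        using t by (intro mult_left_mono) auto
      moreover have "(dist (S t \<rho>) (p i))\<^sup>2 \<le> (dist \<rho> (p i))\<^sup>2 + 2 * t * (e (p i) - e \<rho> - \<kappa>/2 * (dist \<rho> (p i))\<^sup>2 + 1)"
        using t p(1,3) by (intro \<tau>1(2)) (auto simp: r\<^sub>0_def)
      moreover have "2 * t * (K / 2) = t * K" by simp
      ultimately have "(dist (S t \<rho>) (p i))\<^sup>2 \<le> (dist \<rho> (p i))\<^sup>2 + t * K" by linarith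
      then have "w i * (dist (S t \<rho>) (p i))\<^sup>2 \<le> w i * ((dist \<rho> (p i))\<^sup>2 + t * K)"
        using w(1)[of i] by (intro mult_left_mono) auto
      then show "w i * (dist (S t \<rho>) (p i))\<^sup>2 \<le> w i * (dist \<rho> (p i))\<^sup>2 + w i * (t * K)"
        by (simp only: distrib_left)
    qed (use summ sW in \<open>auto intro!: summable_add simp: sums_iff\<close>)
    also have "\<dots> = V \<rho> + W * (t * K)"
      unfolding V_def using suminf_add[OF summ(2) sums_summable[OF sW]] sums_unique[OF sW] by simp
    also have "W * (t * K) \<le> t * l"
      using mult_left_mono[OF l(2), of t] t by (simp add: K_def mult_ac)
    finally show ?thesis by simp
  qed
  have 4: "a/2 * (dist \<rho> A)\<^sup>2 + a/2 * (dist \<rho> B)\<^sup>2 + penalty L c \<epsilon>\<^sub>1 \<epsilon> y \<rho> + V \<rho>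
        \<le> a/2 * (dist z A)\<^sup>2 + a/2 * (dist z B)\<^sup>2 + penalty L c \<epsilon>\<^sub>1 \<epsilon> y z + V z"
    if "z \<in> D" "dist z \<rho> < r\<^sub>0" "e z \<le> e \<rho> + r\<^sub>0" for z
    unfolding V_def using that \<rho>(2) r\<^sub>0 by (intro minimal inR) auto
  show "\<rho> \<in> DI"
    by (rule minimizer_information_dom[OF dom par l0 r\<^sub>0(1) 1 2 3 4])
  show "0 \<le> a * (e A - e \<rho> - \<kappa>/2 * (dist \<rho> A)\<^sup>2) + a * (e B - e \<rho> - \<kappa>/2 * (dist \<rho> B)\<^sup>2)
     - (L / (e \<rho> + c)\<^sup>2 + \<epsilon>\<^sub>1) * ((slope \<rho>)\<^sup>2 / 2)
     + 2 * \<epsilon> / (1 + (dist \<rho> y)\<^sup>2) * (e y - e \<rho> - \<kappa>/2 * (dist \<rho> y)\<^sup>2) + l"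
    by (rule minimizer_flow[OF dom par l0 r\<^sub>0(1) 1 2 3 4])
  show "a * dist \<rho> A \<le> a * dist \<rho> B + (L / (e \<rho> + c)\<^sup>2 + \<epsilon>\<^sub>1) * slope \<rho> + \<epsilon> + l"
    by (rule minimizer_geodesic[OF dom par l0 r\<^sub>0(1) 1 2 3 4 reg])
qed

end

text \<open>The product metric is Euclidean, so a perturbation by squared distances of quadruples
  separates into one perturbation per variable.\<close>

lemma sq_dist_quadruple:
  "(dist ((x1, x2), (x3, x4)) ((z1, z2), (z3, z4)))\<^sup>2
    = (dist x1 z1)\<^sup>2 + (dist x2 z2)\<^sup>2 + (dist x3 z3)\<^sup>2 + (dist x4 z4)\<^sup>2"
  by (simp add: dist_Pair_Pair)

lemma dist_quadruple_le:
  "dist ((x1, x2), (x3, x4)) ((z1, z2), (z3, z4)) \<le> dist x1 z1 + dist x2 z2 + dist x3 z3 + dist x4 z4"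
proof -
  have "dist (a, b) (a', b') \<le> dist a a' + dist b b'"
    for a a' :: "'x::metric_space" and b b' :: "'y::metric_space"
    by (simp add: dist_Pair_Pair sqrt_sum_squares_le_sum)
  from this[of "(x1, x2)" "(x3, x4)" "(z1, z2)" "(z3, z4)"] this[of x1 x2 z1 z2] this[of x3 x4 z3 z4]
  show ?thesis by linarith
qed

lemma dist_quadruple_ge:
  "dist x1 z1 \<le> dist ((x1, x2), (x3, x4)) ((z1, z2), (z3, z4))"
  "dist x2 z2 \<le> dist ((x1, x2), (x3, x4)) ((z1, z2), (z3, z4))"
  "dist x3 z3 \<le> dist ((x1, x2), (x3, x4)) ((z1, z2), (z3, z4))"
  "dist x4 z4 \<le> dist ((x1, x2), (x3, x4)) ((z1, z2), (z3, z4))"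
  by (rule power2_le_imp_le; simp add: sq_dist_quadruple)+

text \<open>\<open>v\<close> and \<open>h'\<close> are the negatives of the supersolution and of its
  right-hand side, so both halves are subsolution arguments; \<open>y\<close> is a fixed point of
  finite energy used as origin.\<close>

locale comparison_data = evi_space +
  fixes u v h h' :: "'a \<Rightarrow> real" and lam b :: real and y :: 'a
  assumes reg: "regularized_geodesics_assumption E"
    and lam: "0 < lam"
    and sub_u: "quad_subsolution lam 1 h u" and sub_v: "quad_subsolution lam (- 1) h' v"
    and usc_u: "usc_on UNIV u" and usc_v: "usc_on UNIV v"
    and cont_h: "continuous_on UNIV h" and cont_h': "continuous_on UNIV h'"
    and bounds: "\<bar>u x\<bar> \<le> b" "\<bar>v x\<bar> \<le> b" "\<bar>h x\<bar> \<le> b" "\<bar>h' x\<bar> \<le> b"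
    and y: "y \<in> D"
begin

definition doubled ::
    "real \<Rightarrow> real \<Rightarrow> real \<Rightarrow> real \<Rightarrow> real \<Rightarrow> real \<Rightarrow> real \<Rightarrow> 'a \<Rightarrow> 'a \<Rightarrow> 'a \<Rightarrow> 'a \<Rightarrow> real" where
  "doubled s1 s2 a L c \<epsilon>\<^sub>1 \<epsilon> \<pi> \<rho> \<gamma> \<mu> = s1 * u \<pi> + s2 * v \<mu>
     - a/2 * ((dist \<rho> \<pi>)\<^sup>2 + (dist \<rho> \<gamma>)\<^sup>2 + (dist \<gamma> \<mu>)\<^sup>2)
     - penalty L c \<epsilon>\<^sub>1 \<epsilon> y \<rho> - penalty L c \<epsilon>\<^sub>1 \<epsilon> y \<gamma>"

lemma usc_on_doubled:
  assumes K: "K \<subseteq> D" and pos: "\<And>z. z \<in> K \<Longrightarrow> 0 < e z + c" and L: "0 \<le> L" and \<epsilon>\<^sub>1: "0 \<le> \<epsilon>\<^sub>1"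
    and s: "0 \<le> s1" "0 \<le> s2"
  shows "usc_on ((K \<times> K) \<times> (K \<times> K))
    (\<lambda>x. doubled s1 s2 a L c \<epsilon>\<^sub>1 \<epsilon> (fst (fst x)) (snd (fst x)) (fst (snd x)) (snd (snd x)))"
proof -
  let ?X = "(K \<times> K) \<times> (K \<times> K)"
  have 1: "usc_on ?X (\<lambda>x. s1 * u (fst (fst x)))"
    by (intro usc_on_cmult s usc_on_compose[OF usc_u] continuous_intros) auto
  have 2: "usc_on ?X (\<lambda>x. s2 * v (snd (snd x)))"
    by (intro usc_on_cmult s usc_on_compose[OF usc_v] continuous_intros) auto
  have 3: "usc_on ?X (\<lambda>x. - penalty L c \<epsilon>\<^sub>1 \<epsilon> y (snd (fst x)))"
    by (rule usc_on_compose[OF usc_on_minus_penalty[OF K pos L \<epsilon>\<^sub>1]]) (auto intro!: continuous_intros)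
  have 4: "usc_on ?X (\<lambda>x. - penalty L c \<epsilon>\<^sub>1 \<epsilon> y (fst (snd x)))"
    by (rule usc_on_compose[OF usc_on_minus_penalty[OF K pos L \<epsilon>\<^sub>1]]) (auto intro!: continuous_intros)
  have 5: "usc_on ?X (\<lambda>x. - (a/2 * ((dist (snd (fst x)) (fst (fst x)))\<^sup>2
      + (dist (snd (fst x)) (fst (snd x)))\<^sup>2 + (dist (fst (snd x)) (snd (snd x)))\<^sup>2)))"
    by (intro continuous_on_imp_usc_on continuous_intros)
  from usc_on_add[OF 1 usc_on_add[OF 2 usc_on_add[OF 5 usc_on_add[OF 3 4]]]]
  show ?thesis by (simp add: doubled_def algebra_simps)
qed

text \<open>All inequalities at one optimum, with every effect of the perturbation pushed below
  \<tau>. The hypothesis \<open>conf\<close> keeps \<rho> and \<gamma> away from the boundary of the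
  ball, since their minimality is exploited by free variations; for the points tested near \<pi> and
  \<mu> the size of \<open>a\<close> does the same.\<close>

lemma perturbed_optimum:
  assumes s: "0 < s1" "0 < s2" and a: "4 * s1 * b + 4 \<le> a" "4 * s2 * b + 4 \<le> a"
    and par: "0 \<le> L" "0 < \<epsilon>\<^sub>1" "0 \<le> \<epsilon>" "0 < \<tau>" "1 \<le> R"
    and lower: "\<And>z. \<lbrakk>z \<in> D; dist z y \<le> R\<rbrakk> \<Longrightarrow> 1 \<le> e z + c"
    and comp: "\<pi>' \<in> D" "\<rho>' \<in> D" "\<gamma>' \<in> D" "\<mu>' \<in> D"
      "dist \<pi>' y \<le> R" "dist \<rho>' y \<le> R" "dist \<gamma>' y \<le> R" "dist \<mu>' y \<le> R"
    and conf: "\<And>\<pi> \<rho> \<gamma> \<mu>. \<lbrakk>\<rho> \<in> D; \<gamma> \<in> D; dist \<rho> y \<le> R; dist \<gamma> y \<le> R;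
        doubled s1 s2 a L c \<epsilon>\<^sub>1 \<epsilon> \<pi>' \<rho>' \<gamma>' \<mu>' - \<tau> \<le> doubled s1 s2 a L c \<epsilon>\<^sub>1 \<epsilon> \<pi> \<rho> \<gamma> \<mu>\<rbrakk>
        \<Longrightarrow> dist \<rho> y \<le> R - 1 \<and> dist \<gamma> y \<le> R - 1"
  obtains \<pi> \<rho> \<gamma> \<mu> where "\<pi> \<in> D" "\<rho> \<in> DI" "\<gamma> \<in> DI" "\<mu> \<in> D"
    "dist \<pi> y \<le> R" "dist \<rho> y \<le> R - 1" "dist \<gamma> y \<le> R - 1" "dist \<mu> y \<le> R"
    "doubled s1 s2 a L c \<epsilon>\<^sub>1 \<epsilon> \<pi>' \<rho>' \<gamma>' \<mu>' - \<tau> \<le> doubled s1 s2 a L c \<epsilon>\<^sub>1 \<epsilon> \<pi> \<rho> \<gamma> \<mu>"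
    "s1 * (u \<pi> - h \<pi>) \<le> lam * (a * (e \<rho> - e \<pi> - \<kappa>/2 * (dist \<rho> \<pi>)\<^sup>2) + a\<^sup>2 / (2 * s1) * (dist \<rho> \<pi>)\<^sup>2) + \<tau>"
    "s2 * (v \<mu> - h' \<mu>) \<le> lam * (a * (e \<gamma> - e \<mu> - \<kappa>/2 * (dist \<gamma> \<mu>)\<^sup>2) - a\<^sup>2 / (2 * s2) * (dist \<gamma> \<mu>)\<^sup>2) + \<tau>"
    "0 \<le> a * (e \<pi> - e \<rho> - \<kappa>/2 * (dist \<rho> \<pi>)\<^sup>2) + a * (e \<gamma> - e \<rho> - \<kappa>/2 * (dist \<rho> \<gamma>)\<^sup>2)
     - (L / (e \<rho> + c)\<^sup>2 + \<epsilon>\<^sub>1) * ((slope \<rho>)\<^sup>2 / 2)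
     + 2 * \<epsilon> / (1 + (dist \<rho> y)\<^sup>2) * (e y - e \<rho> - \<kappa>/2 * (dist \<rho> y)\<^sup>2) + \<tau>"
    "0 \<le> a * (e \<rho> - e \<gamma> - \<kappa>/2 * (dist \<rho> \<gamma>)\<^sup>2) + a * (e \<mu> - e \<gamma> - \<kappa>/2 * (dist \<gamma> \<mu>)\<^sup>2)
     - (L / (e \<gamma> + c)\<^sup>2 + \<epsilon>\<^sub>1) * ((slope \<gamma>)\<^sup>2 / 2)
     + 2 * \<epsilon> / (1 + (dist \<gamma> y)\<^sup>2) * (e y - e \<gamma> - \<kappa>/2 * (dist \<gamma> y)\<^sup>2) + \<tau>"
    "a * dist \<rho> \<pi> \<le> a * dist \<rho> \<gamma> + (L / (e \<rho> + c)\<^sup>2 + \<epsilon>\<^sub>1) * slope \<rho> + \<epsilon> + \<tau>"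
    "a * dist \<rho> \<gamma> \<le> a * dist \<gamma> \<mu> + (L / (e \<gamma> + c)\<^sup>2 + \<epsilon>\<^sub>1) * slope \<gamma> + \<epsilon> + \<tau>"
proof -
  let ?F = "doubled s1 s2 a L c \<epsilon>\<^sub>1 \<epsilon>"
  have b0: "0 \<le> b" using bounds(1)[of y] by (meson abs_ge_zero order_trans)
  have apos: "0 < a" using a(1) s b0 mult_nonneg_nonneg[of "4 * s1" b] by linarith
  have pen_ge: "\<epsilon>\<^sub>1 * e z - L \<le> penalty L c \<epsilon>\<^sub>1 \<epsilon> y z" "- \<epsilon>\<^sub>1 * \<bar>c\<bar> \<le> \<epsilon>\<^sub>1 * e z"
    if z: "z \<in> D" "dist z y \<le> R" for z
  proof -
    have "L / (e z + c) \<le> L / 1" using lower[OF z] par by (intro divide_left_mono) auto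
    moreover have "0 \<le> \<epsilon> * ln (1 + (dist z y)\<^sup>2)" using par by (intro mult_nonneg_nonneg ln_ge_zero) auto
    ultimately show "\<epsilon>\<^sub>1 * e z - L \<le> penalty L c \<epsilon>\<^sub>1 \<epsilon> y z" by (simp add: penalty_def)
    have "\<epsilon>\<^sub>1 * (- \<bar>c\<bar>) \<le> \<epsilon>\<^sub>1 * e z" using lower[OF z] par by (intro mult_left_mono) auto
    then show "- \<epsilon>\<^sub>1 * \<bar>c\<bar> \<le> \<epsilon>\<^sub>1 * e z" by simp
  qed
  have su: "s1 * u \<pi> \<le> s1 * b" "s2 * v \<pi> \<le> s2 * b" for \<pi>
    using bounds(1,2)[of \<pi>] s by (auto intro!: mult_left_mono simp: abs_le_iff)
  define K0 where "K0 = s1 * b + s2 * b - ?F \<pi>' \<rho>' \<gamma>' \<mu>' + \<tau> + 2 * L + \<epsilon>\<^sub>1 * \<bar>c\<bar>"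
  have e_bound: "e \<rho> \<le> K0 / \<epsilon>\<^sub>1 \<and> e \<gamma> \<le> K0 / \<epsilon>\<^sub>1"
    if "\<rho> \<in> D" "\<gamma> \<in> D" "dist \<rho> y \<le> R" "dist \<gamma> y \<le> R" "?F \<pi>' \<rho>' \<gamma>' \<mu>' - \<tau> \<le> ?F \<pi> \<rho> \<gamma> \<mu>"
    for \<pi> \<rho> \<gamma> \<mu>
  proof -
    have "0 \<le> a/2 * ((dist \<rho> \<pi>)\<^sup>2 + (dist \<rho> \<gamma>)\<^sup>2 + (dist \<gamma> \<mu>)\<^sup>2)" using apos by simp
    then have "\<epsilon>\<^sub>1 * e \<rho> \<le> K0" "\<epsilon>\<^sub>1 * e \<gamma> \<le> K0"
      using that(5) su(1)[of \<pi>] su(2)[of \<mu>] pen_ge[OF that(1,3)] pen_ge[OF that(2,4)]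
      unfolding K0_def doubled_def by linarith+
    then show ?thesis using par by (simp add: field_simps)
  qed
  define Q where "Q = (\<lambda>s. (2 * s * b + s) / lam + a * \<bar>\<kappa>\<bar> + a\<^sup>2 / (2 * s) + \<bar>\<kappa>\<bar> + (2 + 2 * a) / s)"
  have Q0: "0 \<le> Q s" if "0 < s" for s
    unfolding Q_def using that lam b0 apos by (intro add_nonneg_nonneg divide_nonneg_nonneg mult_nonneg_nonneg) auto
  \<comment> \<open>The cap admits the comparison quadruple, leaves room 1 above the energies of
    near-optimal middle points for competitors, and through the summand with \<open>Q\<close> meets
    the hypothesis on \<open>N\<close> in \<open>subsolution_at_max\<close>.\<close>
  define N where "N = max (max (e \<pi>') (e \<rho>')) (max (max (e \<gamma>') (e \<mu>')) (K0 / \<epsilon>\<^sub>1 + 1 + (Q s1 + Q s2) / a))"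
  have N_ge: "e \<pi>' \<le> N" "e \<rho>' \<le> N" "e \<gamma>' \<le> N" "e \<mu>' \<le> N" "K0 / \<epsilon>\<^sub>1 + 1 + (Q s1 + Q s2) / a \<le> N"
    by (auto simp: N_def)
  have N1: "z + 1 \<le> N" if "z \<le> K0 / \<epsilon>\<^sub>1" for z
    using N_ge(5) that Q0[OF s(1)] Q0[OF s(2)] apos divide_nonneg_pos[of "Q s1 + Q s2" a] by linarith
  have NQ: "a * z + Q s1 \<le> a * N" "a * z + Q s2 \<le> a * N" if "z \<le> K0 / \<epsilon>\<^sub>1" for z
  proof -
    have "z + (Q s1 + Q s2) / a \<le> N" using N_ge(5) that by linarith
    then have "a * (z + (Q s1 + Q s2) / a) \<le> a * N" using apos by (intro mult_left_mono) auto
    moreover have "a * (z + x / a) = a * z + x" for x using apos by (simp add: distrib_left)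
    ultimately have "a * z + (Q s1 + Q s2) \<le> a * N" by (simp only:)
    then show "a * z + Q s1 \<le> a * N" "a * z + Q s2 \<le> a * N"
      using Q0[OF s(1)] Q0[OF s(2)] by linarith+
  qed
  define K where "K = cball y R \<inter> {z. E z \<le> ereal N}"
  have K_iff: "z \<in> K \<longleftrightarrow> z \<in> D \<and> dist z y \<le> R \<and> e z \<le> N" for z
    by (auto simp: K_def E_le_iff dist_commute)
  have lowK: "1 \<le> e z + c" if "z \<in> K" for z using lower that by (simp add: K_iff)
  have cN: "- c \<le> N" using lowK[of \<pi>'] N_ge(1) lower[OF comp(1,5)] by linarith
  define T where "T = 2 * R + 1"
  have T: "1 \<le> T" using par by (simp add: T_def)
  define C where "C = (\<lambda>s. lam * (2 * (N + c + \<bar>\<kappa>\<bar> * T\<^sup>2) + (2 + 2 * a) * T / s))"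
  have C0: "0 \<le> C s" if "0 < s" for s
  proof -
    have "0 \<le> \<bar>\<kappa>\<bar> * T\<^sup>2" by simp
    then have "0 \<le> 2 * (N + c + \<bar>\<kappa>\<bar> * T\<^sup>2)" using cN by simp
    moreover have "0 \<le> (2 + 2 * a) * T / s" using apos T that by simp
    ultimately show ?thesis unfolding C_def using lam by simp
  qed
  \<comment> \<open>The factors by which the total weight enters the estimates, all nonnegative.
    They depend on \<open>N\<close>, so the weight \<open>W\<close> can only be chosen after the
    cap.\<close>
  define Z where "Z = T\<^sup>2 + C s1 + C s2 + (1 + 2 * T) + 2 * (N + c + \<bar>\<kappa>\<bar> * T\<^sup>2 + 1)"
  have Z_ge: "T\<^sup>2 \<le> Z" "C s1 \<le> Z" "C s2 \<le> Z" "1 + 2 * T \<le> Z" "2 * (N + c + \<bar>\<kappa>\<bar> * T\<^sup>2 + 1) \<le> Z"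
  proof -
    have k: "0 \<le> \<bar>\<kappa>\<bar> * T\<^sup>2" by simp
    have nn: "0 \<le> T\<^sup>2" "0 \<le> C s1" "0 \<le> C s2" "0 \<le> 1 + 2 * T" "0 \<le> 2 * (N + c + \<bar>\<kappa>\<bar> * T\<^sup>2 + 1)"
      using C0[OF s(1)] C0[OF s(2)] T cN k by auto
    have "x1 \<le> x1 + x2 + x3 + x4 + x5 \<and> x2 \<le> x1 + x2 + x3 + x4 + x5 \<and> x3 \<le> x1 + x2 + x3 + x4 + x5
        \<and> x4 \<le> x1 + x2 + x3 + x4 + x5 \<and> x5 \<le> x1 + x2 + x3 + x4 + x5"
      if "0 \<le> x1" "0 \<le> x2" "0 \<le> x3" "0 \<le> x4" "0 \<le> x5" for x1 x2 x3 x4 x5 :: real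
      using that by auto
    from this[OF nn] show "T\<^sup>2 \<le> Z" "C s1 \<le> Z" "C s2 \<le> Z" "1 + 2 * T \<le> Z" "2 * (N + c + \<bar>\<kappa>\<bar> * T\<^sup>2 + 1) \<le> Z"
      unfolding Z_def by blast+
  qed
  have Z: "0 < Z" using Z_ge(4) T by linarith
  define W where "W = min 1 \<tau> / Z"
  have W: "0 < W" "W * Z \<le> 1" "W * Z \<le> \<tau>" using Z par by (auto simp: W_def)
  have WZ: "W * x \<le> \<tau>" "W * x \<le> 1" if "x \<le> Z" for x
    using mult_left_mono[OF that, of W] W by linarith+
  let ?X = "(K \<times> K) \<times> (K \<times> K)"
  let ?G = "\<lambda>x. ?F (fst (fst x)) (snd (fst x)) (fst (snd x)) (snd (snd x))"
  \<comment> \<open>Centres need finite information to be admissible in test functions, and energy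
    at most \<open>N\<close> for the flow estimates.\<close>
  define Cs where "Cs = {z. z \<in> DI \<and> e z \<le> N}"
  have KD: "K \<subseteq> D" by (auto simp: K_iff)
  have usc: "usc_on ?X ?G"
    using par s lowK by (intro usc_on_doubled KD) (auto intro: less_le_trans[OF zero_less_one])
  have "closed K" unfolding K_def by (intro closed_Int closed_cball closed_sublevel)
  then have X1: "complete ?X" by (simp add: complete_eq_closed closed_Times)
  have comp_X: "((\<pi>', \<rho>'), (\<gamma>', \<mu>')) \<in> ?X" using comp N_ge by (auto simp: K_iff)
  then have X2: "?X \<noteq> {}" by blast
  have X3: "bounded ?X" unfolding K_def by (intro bounded_Times bounded_Int disjI1 bounded_cball)
  have X4: "?G x \<le> s1 * b + s2 * b + 2 * L + 2 * (\<epsilon>\<^sub>1 * \<bar>c\<bar>)" if x: "x \<in> ?X" for x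
  proof -
    obtain \<pi> \<rho> \<gamma> \<mu> where [simp]: "x = ((\<pi>, \<rho>), (\<gamma>, \<mu>))" by (metis surj_pair)
    have "0 \<le> a/2 * ((dist \<rho> \<pi>)\<^sup>2 + (dist \<rho> \<gamma>)\<^sup>2 + (dist \<gamma> \<mu>)\<^sup>2)" using apos by simp
    moreover have "\<rho> \<in> D" "dist \<rho> y \<le> R" "\<gamma> \<in> D" "dist \<gamma> y \<le> R" using x by (auto simp: K_iff)
    ultimately show ?thesis
      using su(1)[of \<pi>] su(2)[of \<mu>] pen_ge[of \<rho>] pen_ge[of \<gamma>]
      unfolding doubled_def by simp
  qed
  have X6: "\<exists>q\<in>(Cs \<times> Cs) \<times> (Cs \<times> Cs). dist q x < r" if x: "x \<in> ?X" and r: "0 < r" for x r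
  proof -
    obtain \<pi> \<rho> \<gamma> \<mu> where [simp]: "x = ((\<pi>, \<rho>), (\<gamma>, \<mu>))" by (metis surj_pair)
    have near: "\<exists>q\<in>Cs. dist q z < r / 4" if zK: "z \<in> K" for z
    proof -
      have "z \<in> D" "0 < r / 4" using zK r by (simp_all add: K_iff)
      from DI_dense[OF this] obtain \<sigma> where "\<sigma> \<in> DI" "dist \<sigma> z < r / 4" "e \<sigma> \<le> e z"
        by blast
      then show ?thesis using zK by (intro bexI[of _ \<sigma>]) (auto simp: Cs_def K_iff)
    qed
    have "\<pi> \<in> K" "\<rho> \<in> K" "\<gamma> \<in> K" "\<mu> \<in> K" using x by auto
    from near[OF this(1)] near[OF this(2)] near[OF this(3)] near[OF this(4)]
    obtain q1 q2 q3 q4 where q: "q1 \<in> Cs" "q2 \<in> Cs" "q3 \<in> Cs" "q4 \<in> Cs"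
      and "dist q1 \<pi> < r / 4" "dist q2 \<rho> < r / 4" "dist q3 \<gamma> < r / 4" "dist q4 \<mu> < r / 4"
      by (elim bexE)
    then have "dist ((q1, q2), (q3, q4)) x < r"
      using dist_quadruple_le[of q1 q2 q3 q4 \<pi> \<rho> \<gamma> \<mu>] by simp
    with q show ?thesis by (intro bexI[of _ "((q1, q2), (q3, q4))"]) auto
  qed
  obtain w q x0 where w: "\<And>i. 0 < w i" "w sums W" and q: "\<And>i. q i \<in> (Cs \<times> Cs) \<times> (Cs \<times> Cs)"
    and q_near: "\<And>i. \<exists>x\<in>?X. dist (q i) x \<le> 1" and x0: "x0 \<in> ?X"
    and max: "\<And>x. x \<in> ?X \<Longrightarrow>
      ?G x - (\<Sum>i. w i * (dist x (q i))\<^sup>2) \<le> ?G x0 - (\<Sum>i. w i * (dist x0 (q i))\<^sup>2)"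
    and near: "\<And>x. x \<in> ?X \<Longrightarrow> ?G x \<le> ?G x0 + \<tau>"
    and strict: "\<And>r. 0 < r \<Longrightarrow> \<exists>\<epsilon>>0. \<forall>x\<in>?X. ?G x0 - (\<Sum>i. w i * (dist x0 (q i))\<^sup>2) - \<epsilon>
        < ?G x - (\<Sum>i. w i * (dist x (q i))\<^sup>2) \<longrightarrow> dist x x0 < r"
  proof goal_cases
    case prems: 1
    show ?case
      by (rule borwein_preiss[OF X1 X2 X3 X4 usc_onD[OF usc] X6 par(4) W(1)], assumption+) (rule prems; assumption)
  qed
  obtain \<pi> \<rho> \<gamma> \<mu> where x0_eq: "x0 = ((\<pi>, \<rho>), (\<gamma>, \<mu>))" by (metis surj_pair)
  define q1 where "q1 = (\<lambda>i. fst (fst (q i)))"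
  define q2 where "q2 = (\<lambda>i. snd (fst (q i)))"
  define q3 where "q3 = (\<lambda>i. fst (snd (q i)))"
  define q4 where "q4 = (\<lambda>i. snd (snd (q i)))"
  have q_eq: "q i = ((q1 i, q2 i), (q3 i, q4 i))" for i by (simp add: q1_def q2_def q3_def q4_def)
  have Kx: "\<pi> \<in> K" "\<rho> \<in> K" "\<gamma> \<in> K" "\<mu> \<in> K" using x0 by (auto simp: x0_eq)
  have qC: "q1 i \<in> Cs" "q2 i \<in> Cs" "q3 i \<in> Cs" "q4 i \<in> Cs" for i
    using q[of i] by (auto simp: q_eq)
  have qR: "dist (q1 i) y \<le> R + 1" "dist (q2 i) y \<le> R + 1" "dist (q3 i) y \<le> R + 1" "dist (q4 i) y \<le> R + 1" for i
  proof -
    obtain x1 x2 x3 x4 where x: "((x1, x2), (x3, x4)) \<in> ?X" "dist (q i) ((x1, x2), (x3, x4)) \<le> 1"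
      using q_near[of i] by (metis surj_pair)
    have "dist (q1 i) x1 \<le> 1" "dist (q2 i) x2 \<le> 1" "dist (q3 i) x3 \<le> 1" "dist (q4 i) x4 \<le> 1"
      using x(2) unfolding q_eq by (meson dist_quadruple_ge order_trans)+
    then show "dist (q1 i) y \<le> R + 1" "dist (q2 i) y \<le> R + 1" "dist (q3 i) y \<le> R + 1" "dist (q4 i) y \<le> R + 1"
      using x(1) dist_triangle[of "q1 i" y x1] dist_triangle[of "q2 i" y x2]
        dist_triangle[of "q3 i" y x3] dist_triangle[of "q4 i" y x4] by (auto simp: K_iff)
  qed
  have dT: "dist z (q1 i) \<le> T" "dist z (q2 i) \<le> T" "dist z (q3 i) \<le> T" "dist z (q4 i) \<le> T"
    if "dist z y \<le> R" for z i
    using qR[of i] that dist_triangle2[of z "q1 i" y] dist_triangle2[of z "q2 i" y]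
      dist_triangle2[of z "q3 i" y] dist_triangle2[of z "q4 i" y] by (auto simp: T_def)
  define V where "V = (\<lambda>p z. \<Sum>i. w i * (dist z (p i :: 'a))\<^sup>2)"
  have V_eq: "V p z = (\<Sum>i. w i * (dist z (p i))\<^sup>2)" for p z by (simp add: V_def)
  have V_split: "(\<Sum>i. w i * (dist ((x1, x2), (x3, x4)) (q i))\<^sup>2) = V q1 x1 + V q2 x2 + V q3 x3 + V q4 x4"
    if "x1 \<in> K" "x2 \<in> K" "x3 \<in> K" "x4 \<in> K" for x1 x2 x3 x4
  proof -
    have "summable (\<lambda>i. w i * (dist x1 (q1 i))\<^sup>2)" "summable (\<lambda>i. w i * (dist x2 (q2 i))\<^sup>2)"
      "summable (\<lambda>i. w i * (dist x3 (q3 i))\<^sup>2)" "summable (\<lambda>i. w i * (dist x4 (q4 i))\<^sup>2)"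
      by (rule weighted_sq_dist_summable[OF w dT(1)] weighted_sq_dist_summable[OF w dT(2)]
          weighted_sq_dist_summable[OF w dT(3)] weighted_sq_dist_summable[OF w dT(4)];
          use that in \<open>simp add: K_iff\<close>)+
    then show ?thesis
      unfolding V_def q_eq sq_dist_quadruple by (simp add: distrib_left suminf_add[symmetric] summable_add)
  qed
  have opt: "?F x1 x2 x3 x4 - (V q1 x1 + V q2 x2 + V q3 x3 + V q4 x4)
      \<le> ?F \<pi> \<rho> \<gamma> \<mu> - (V q1 \<pi> + V q2 \<rho> + V q3 \<gamma> + V q4 \<mu>)"
    if "x1 \<in> K" "x2 \<in> K" "x3 \<in> K" "x4 \<in> K" for x1 x2 x3 x4
    using max[of "((x1, x2), (x3, x4))"] that Kx by (simp add: x0_eq V_split)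
  have Fnear: "?F \<pi>' \<rho>' \<gamma>' \<mu>' - \<tau> \<le> ?F \<pi> \<rho> \<gamma> \<mu>" using near[OF comp_X] by (simp add: x0_eq)
  have inD: "\<pi> \<in> D" "\<rho> \<in> D" "\<gamma> \<in> D" "\<mu> \<in> D" and inR: "dist \<pi> y \<le> R" "dist \<rho> y \<le> R" "dist \<gamma> y \<le> R" "dist \<mu> y \<le> R"
    using Kx by (auto simp: K_iff)
  have R1: "dist \<rho> y \<le> R - 1" "dist \<gamma> y \<le> R - 1"
    using conf[OF inD(2,3) inR(2,3) Fnear] by auto
  have eb: "e \<rho> \<le> K0 / \<epsilon>\<^sub>1" "e \<gamma> \<le> K0 / \<epsilon>\<^sub>1"
    using e_bound[OF inD(2,3) inR(2,3) Fnear] by auto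
  have pos: "0 < e z + c" if "z \<in> D" "dist z y \<le> R" for z using lower[OF that] by linarith
  have min\<rho>: "a/2 * (dist \<rho> \<pi>)\<^sup>2 + a/2 * (dist \<rho> \<gamma>)\<^sup>2 + penalty L c \<epsilon>\<^sub>1 \<epsilon> y \<rho> + (\<Sum>i. w i * (dist \<rho> (q2 i))\<^sup>2)
        \<le> a/2 * (dist z \<pi>)\<^sup>2 + a/2 * (dist z \<gamma>)\<^sup>2 + penalty L c \<epsilon>\<^sub>1 \<epsilon> y z + (\<Sum>i. w i * (dist z (q2 i))\<^sup>2)"
    if "z \<in> D" "dist z y \<le> R" "e z \<le> N" for z
    unfolding V_eq[symmetric] using opt[of \<pi> z \<gamma> \<mu>] Kx that
    by (simp add: K_iff doubled_def distrib_left)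
  have min\<gamma>: "a/2 * (dist \<gamma> \<rho>)\<^sup>2 + a/2 * (dist \<gamma> \<mu>)\<^sup>2 + penalty L c \<epsilon>\<^sub>1 \<epsilon> y \<gamma> + (\<Sum>i. w i * (dist \<gamma> (q3 i))\<^sup>2)
        \<le> a/2 * (dist z \<rho>)\<^sup>2 + a/2 * (dist z \<mu>)\<^sup>2 + penalty L c \<epsilon>\<^sub>1 \<epsilon> y z + (\<Sum>i. w i * (dist z (q3 i))\<^sup>2)"
    if "z \<in> D" "dist z y \<le> R" "e z \<le> N" for z
    unfolding V_eq[symmetric] using opt[of \<pi> \<rho> z \<mu>] Kx that
    by (simp add: K_iff doubled_def distrib_left dist_commute[of \<rho>])
  have CsD: "z \<in> D" "z \<in> DI" "e z \<le> N" if "z \<in> Cs" for z using that by (auto simp: Cs_def DI_D)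
  have l1: "W * (1 + 2 * T) \<le> \<tau>" by (rule WZ(1)[OF Z_ge(4)])
  have l2: "W * (2 * (N - e z + \<bar>\<kappa>\<bar> * T\<^sup>2 + 1)) \<le> \<tau>" if "z \<in> K" for z
    using lowK[OF that] by (intro WZ(1) order_trans[OF _ Z_ge(5)]) simp
  note mid\<rho> = middle_point_estimates[OF reg inD(1,3) y inD(2) apos par(1-3) R1(1) N1[OF eb(1)] pos w
      CsD(1)[OF qC(2)] CsD(3)[OF qC(2)] dT(2)[OF inR(2)] l1 l2[OF Kx(2)] min\<rho>]
  note mid\<gamma> = middle_point_estimates[OF reg inD(2,4) y inD(3) apos par(1-3) R1(2) N1[OF eb(2)] pos w
      CsD(1)[OF qC(3)] CsD(3)[OF qC(3)] dT(3)[OF inR(3)] l1 l2[OF Kx(3)] min\<gamma>]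
  have lowm: "- c \<le> e z" if "z \<in> D" "dist z y \<le> R" for z using lower[OF that] by linarith
  have WT: "W * (2 * R + 1)\<^sup>2 \<le> 1" using WZ(2)[OF Z_ge(1)] by (simp add: T_def)
  \<comment> \<open>Freezing the other three variables at the optimum passes the strong maximum on
    to the remaining one.\<close>
  have strict_\<pi>: "\<exists>\<delta>>0. \<forall>x\<in>D. e x \<le> N \<and> dist x y \<le> R \<and>
        s1 * u \<pi> - a/2 * (dist \<pi> \<rho>)\<^sup>2 - (\<Sum>i. w i * (dist \<pi> (q1 i))\<^sup>2) - \<delta>
          < s1 * u x - a/2 * (dist x \<rho>)\<^sup>2 - (\<Sum>i. w i * (dist x (q1 i))\<^sup>2) \<longrightarrow> dist x \<pi> < r" if r: "0 < r" for r
  proof -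
    obtain \<delta> where \<delta>: "0 < \<delta>" "\<And>x. \<lbrakk>x \<in> ?X; ?G x0 - (\<Sum>i. w i * (dist x0 (q i))\<^sup>2) - \<delta>
        < ?G x - (\<Sum>i. w i * (dist x (q i))\<^sup>2)\<rbrakk> \<Longrightarrow> dist x x0 < r"
      using strict[OF r] by blast
    have "dist x \<pi> < r" if x: "x \<in> K" and less: "s1 * u \<pi> - a/2 * (dist \<pi> \<rho>)\<^sup>2 - V q1 \<pi> - \<delta>
          < s1 * u x - a/2 * (dist x \<rho>)\<^sup>2 - V q1 x" for x
    proof -
      have "dist ((x, \<rho>), (\<gamma>, \<mu>)) x0 < r"
        using x Kx less by (intro \<delta>(2)) (auto simp: x0_eq V_split doubled_def distrib_left dist_commute[of \<rho>])
      then show ?thesis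
        using dist_quadruple_ge(1)[of x \<pi> \<rho> \<gamma> \<mu> \<rho> \<gamma> \<mu>] by (simp add: x0_eq)
    qed
    with \<delta>(1) show ?thesis unfolding V_def by (intro exI[of _ \<delta>]) (auto simp: K_iff)
  qed
  have strict_\<mu>: "\<exists>\<delta>>0. \<forall>x\<in>D. e x \<le> N \<and> dist x y \<le> R \<and>
        s2 * v \<mu> - a/2 * (dist \<mu> \<gamma>)\<^sup>2 - (\<Sum>i. w i * (dist \<mu> (q4 i))\<^sup>2) - \<delta>
          < s2 * v x - a/2 * (dist x \<gamma>)\<^sup>2 - (\<Sum>i. w i * (dist x (q4 i))\<^sup>2) \<longrightarrow> dist x \<mu> < r" if r: "0 < r" for r
  proof -
    obtain \<delta> where \<delta>: "0 < \<delta>" "\<And>x. \<lbrakk>x \<in> ?X; ?G x0 - (\<Sum>i. w i * (dist x0 (q i))\<^sup>2) - \<delta>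
        < ?G x - (\<Sum>i. w i * (dist x (q i))\<^sup>2)\<rbrakk> \<Longrightarrow> dist x x0 < r"
      using strict[OF r] by blast
    have "dist x \<mu> < r" if x: "x \<in> K" and less: "s2 * v \<mu> - a/2 * (dist \<mu> \<gamma>)\<^sup>2 - V q4 \<mu> - \<delta>
          < s2 * v x - a/2 * (dist x \<gamma>)\<^sup>2 - V q4 x" for x
    proof -
      have "dist ((\<pi>, \<rho>), (\<gamma>, x)) x0 < r"
        using x Kx less by (intro \<delta>(2)) (auto simp: x0_eq V_split doubled_def distrib_left dist_commute[of \<gamma>])
      then show ?thesis
        using dist_quadruple_ge(4)[of x \<mu> \<pi> \<rho> \<gamma> \<pi> \<rho> \<gamma>] by (simp add: x0_eq)
    qed
    with \<delta>(1) show ?thesis unfolding V_def by (intro exI[of _ \<delta>]) (auto simp: K_iff)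
  qed
  have U: "s1 * (u \<pi> - h \<pi>) \<le> lam * (a * (e \<rho> - e \<pi> - \<kappa>/2 * (dist \<pi> \<rho>)\<^sup>2) + 1 * (a\<^sup>2 / (2 * s1) * (dist \<pi> \<rho>)\<^sup>2))
     + W * (lam * (2 * (N + c + \<bar>\<kappa>\<bar> * (2 * R + 1)\<^sup>2) + (2 + 2 * a) * (2 * R + 1) / s1))"
    by (rule subsolution_at_max[OF sub_u lam _ cont_h bounds(1,3) s(1) a(1) mid\<rho>(1) R1(1) w WT
          CsD(2)[OF qC(1)] CsD(3)[OF qC(1)] qR(1) lowm NQ(1)[OF eb(1), unfolded Q_def] inD(1) inR(1) strict_\<pi>]) simp
  have U': "s2 * (v \<mu> - h' \<mu>) \<le> lam * (a * (e \<gamma> - e \<mu> - \<kappa>/2 * (dist \<mu> \<gamma>)\<^sup>2) + (- 1) * (a\<^sup>2 / (2 * s2) * (dist \<mu> \<gamma>)\<^sup>2))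
     + W * (lam * (2 * (N + c + \<bar>\<kappa>\<bar> * (2 * R + 1)\<^sup>2) + (2 + 2 * a) * (2 * R + 1) / s2))"
    by (rule subsolution_at_max[OF sub_v lam _ cont_h' bounds(2,4) s(2) a(2) mid\<gamma>(1) R1(2) w WT
          CsD(2)[OF qC(4)] CsD(3)[OF qC(4)] qR(4) lowm NQ(2)[OF eb(2), unfolded Q_def] inD(4) inR(4) strict_\<mu>]) simp
  show thesis
  proof (rule that[OF inD(1) mid\<rho>(1) mid\<gamma>(1) inD(4) inR(1) R1 inR(4) Fnear _ _ mid\<rho>(2) _ mid\<rho>(3)])
    have "W * C s1 \<le> \<tau>" by (rule WZ(1)[OF Z_ge(2)])
    then show "s1 * (u \<pi> - h \<pi>) \<le> lam * (a * (e \<rho> - e \<pi> - \<kappa>/2 * (dist \<rho> \<pi>)\<^sup>2) + a\<^sup>2 / (2 * s1) * (dist \<rho> \<pi>)\<^sup>2) + \<tau>"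
      using U unfolding C_def T_def dist_commute[of \<pi> \<rho>] mult_1_left by linarith
    have "W * C s2 \<le> \<tau>" by (rule WZ(1)[OF Z_ge(3)])
    then show "s2 * (v \<mu> - h' \<mu>) \<le> lam * (a * (e \<gamma> - e \<mu> - \<kappa>/2 * (dist \<gamma> \<mu>)\<^sup>2) - a\<^sup>2 / (2 * s2) * (dist \<gamma> \<mu>)\<^sup>2) + \<tau>"
      using U' unfolding C_def T_def dist_commute[of \<mu> \<gamma>] minus_mult_left[symmetric] mult_1_left add_uminus_conv_diff by linarith
    show "0 \<le> a * (e \<rho> - e \<gamma> - \<kappa>/2 * (dist \<rho> \<gamma>)\<^sup>2) + a * (e \<mu> - e \<gamma> - \<kappa>/2 * (dist \<gamma> \<mu>)\<^sup>2)
     - (L / (e \<gamma> + c)\<^sup>2 + \<epsilon>\<^sub>1) * ((slope \<gamma>)\<^sup>2 / 2)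
     + 2 * \<epsilon> / (1 + (dist \<gamma> y)\<^sup>2) * (e y - e \<gamma> - \<kappa>/2 * (dist \<gamma> y)\<^sup>2) + \<tau>"
      using mid\<gamma>(2) unfolding dist_commute[of \<gamma> \<rho>] .
    show "a * dist \<rho> \<gamma> \<le> a * dist \<gamma> \<mu> + (L / (e \<gamma> + c)\<^sup>2 + \<epsilon>\<^sub>1) * slope \<gamma> + \<epsilon> + \<tau>"
      using mid\<gamma>(3) unfolding dist_commute[of \<gamma> \<rho>] .
  qed
qed

end

section \<open>The comparison principle\<close>

text \<open>Young's inequality \<open>(y + z)\<^sup>2 \<le> (1 + \<delta>) * (y\<^sup>2 + z\<^sup>2
  / \<delta>)\<close>. With equal weights an excess \<open>z\<close> would leave a cross term
  proportional to \<open>y\<close>, on which no bound is available; unequal weights leave only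
  \<open>z\<^sup>2\<close>.\<close>

lemma weighted_square_diff:
  fixes x y z \<delta> :: real
  assumes \<delta>: "0 < \<delta>" "\<delta> < 1" and le: "x \<le> y + z" and x: "0 \<le> x"
  shows "x\<^sup>2 / (2 * (1 + \<delta>)) - y\<^sup>2 / (2 * (1 - \<delta>)) \<le> z\<^sup>2 / (2 * \<delta>)"
proof -
  have "x\<^sup>2 \<le> (y + z)\<^sup>2" using le x by (intro power_mono)
  also have "\<dots> = (1 + \<delta>) * (y\<^sup>2 + z\<^sup>2 / \<delta>) - (\<delta> * y - z)\<^sup>2 / \<delta>"
    using \<delta> by (simp add: field_simps power2_eq_square)
  also have "\<dots> \<le> (1 + \<delta>) * (y\<^sup>2 + z\<^sup>2 / \<delta>)" using \<delta> by simp
  finally have "x\<^sup>2 / (2 * (1 + \<delta>)) \<le> ((1 + \<delta>) * (y\<^sup>2 + z\<^sup>2 / \<delta>)) / (2 * (1 + \<delta>))"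
    using \<delta> by (intro divide_right_mono) auto
  also have "\<dots> = (y\<^sup>2 + z\<^sup>2 / \<delta>) / 2"
    unfolding mult.commute[of 2] using \<delta> by (subst mult_divide_mult_cancel_left) auto
  also have "\<dots> = y\<^sup>2 / 2 + z\<^sup>2 / (2 * \<delta>)" by (simp add: add_divide_distrib)
  finally have "x\<^sup>2 / (2 * (1 + \<delta>)) \<le> y\<^sup>2 / 2 + z\<^sup>2 / (2 * \<delta>)" .
  moreover have "y\<^sup>2 / 2 \<le> y\<^sup>2 / (2 * (1 - \<delta>))" using \<delta> by (intro divide_left_mono) auto
  ultimately show ?thesis by linarith
qed

text \<open>Adding \<open>lam\<close> times \<open>F1\<close> and \<open>F2\<close> to
  \<open>U\<close> and \<open>V\<close> cancels all four energies. Of the gain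
  \<open>q * S\<^sup>2 / 2\<close> at each inner point, half pays for the squared excess from
  \<open>G1\<close> and \<open>G2\<close>, because \<open>q \<le> \<delta>/8\<close> gives
  \<open>3 * (q * S)\<^sup>2 / (2 * \<delta>) \<le> q * S\<^sup>2 / 4\<close>; the other half is
  kept to bound the energies.\<close>

lemma combined_estimate:
  fixes X r Y :: real
  assumes \<delta>: "0 < \<delta>" "\<delta> < 1" and lam: "0 < lam" and a: "0 < a"
    and U: "U \<le> lam * (a * (e\<rho> - e\<pi> - \<kappa>/2 * X\<^sup>2) + a\<^sup>2 / (2 * (1 + \<delta>)) * X\<^sup>2) + \<tau>"
    and V: "V \<le> lam * (a * (e\<gamma> - e\<mu> - \<kappa>/2 * Y\<^sup>2) - a\<^sup>2 / (2 * (1 - \<delta>)) * Y\<^sup>2) + \<tau>"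
    and F1: "0 \<le> a * (e\<pi> - e\<rho> - \<kappa>/2 * X\<^sup>2) + a * (e\<gamma> - e\<rho> - \<kappa>/2 * r\<^sup>2) - q1 * (S1\<^sup>2 / 2) + P1 + \<tau>"
    and F2: "0 \<le> a * (e\<rho> - e\<gamma> - \<kappa>/2 * r\<^sup>2) + a * (e\<mu> - e\<gamma> - \<kappa>/2 * Y\<^sup>2) - q2 * (S2\<^sup>2 / 2) + P2 + \<tau>"
    and G1: "a * X \<le> a * r + q1 * S1 + \<epsilon> + \<tau>" and G2: "a * r \<le> a * Y + q2 * S2 + \<epsilon> + \<tau>"
    and q: "0 \<le> q1" "q1 \<le> \<delta>/8" "0 \<le> q2" "q2 \<le> \<delta>/8" and X: "0 \<le> X"
  shows "U + V \<le> lam * (\<bar>\<kappa>\<bar> * (a * (X\<^sup>2 + r\<^sup>2 + Y\<^sup>2)) - (q1 * S1\<^sup>2 + q2 * S2\<^sup>2) / 4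
    + 6 * (\<epsilon> + \<tau>)\<^sup>2 / \<delta> + P1 + P2 + 2 * \<tau>) + 2 * \<tau>"
proof -
  define B where "B = q1 * S1 + q2 * S2 + 2 * (\<epsilon> + \<tau>)"
  define Q where "Q = (a * X)\<^sup>2 / (2 * (1 + \<delta>)) - (a * Y)\<^sup>2 / (2 * (1 - \<delta>))"
  have "Q \<le> B\<^sup>2 / (2 * \<delta>)"
    unfolding Q_def using G1 G2 a X by (intro weighted_square_diff \<delta>) (auto simp: B_def)
  also have "\<dots> \<le> (3 * (q1 * S1)\<^sup>2 + 3 * (q2 * S2)\<^sup>2 + 3 * (2 * (\<epsilon> + \<tau>))\<^sup>2) / (2 * \<delta>)"
  proof (rule divide_right_mono)
    have "(x + y + z)\<^sup>2 \<le> 3 * x\<^sup>2 + 3 * y\<^sup>2 + 3 * z\<^sup>2" for x y z :: real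
      using zero_le_power2[of "x - y"] zero_le_power2[of "x - z"] zero_le_power2[of "y - z"]
      by (simp add: power2_eq_square algebra_simps)
    then show "B\<^sup>2 \<le> 3 * (q1 * S1)\<^sup>2 + 3 * (q2 * S2)\<^sup>2 + 3 * (2 * (\<epsilon> + \<tau>))\<^sup>2" unfolding B_def .
  qed (use \<delta> in simp)
  also have "\<dots> = 3 * (q1 * S1)\<^sup>2 / (2 * \<delta>) + 3 * (q2 * S2)\<^sup>2 / (2 * \<delta>) + 6 * (\<epsilon> + \<tau>)\<^sup>2 / \<delta>"
  proof -
    have "3 * (2 * t)\<^sup>2 / (2 * \<delta>) = 6 * t\<^sup>2 / \<delta>" for t by (simp add: power_mult_distrib)
    then show ?thesis by (simp only: add_divide_distrib)
  qed
  also have "\<dots> \<le> q1 * S1\<^sup>2 / 4 + q2 * S2\<^sup>2 / 4 + 6 * (\<epsilon> + \<tau>)\<^sup>2 / \<delta>"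
  proof -
    have "3 * (p * s)\<^sup>2 / (2 * \<delta>) \<le> p * s\<^sup>2 / 4" if p: "0 \<le> p" "p \<le> \<delta>/8" for p s :: real
    proof -
      have "12 * p \<le> 2 * \<delta>" using p by simp
      then have "12 * p * (p * s\<^sup>2) \<le> 2 * \<delta> * (p * s\<^sup>2)" using p by (intro mult_right_mono) auto
      then show ?thesis using \<delta> by (simp add: field_simps power2_eq_square)
    qed
    from this[OF q(1,2), of S1] this[OF q(3,4), of S2] show ?thesis by linarith
  qed
  finally have Q: "Q \<le> q1 * S1\<^sup>2 / 4 + q2 * S2\<^sup>2 / 4 + 6 * (\<epsilon> + \<tau>)\<^sup>2 / \<delta>" .
  define A where "A = (a * (e\<rho> - e\<pi> - \<kappa>/2 * X\<^sup>2) + a\<^sup>2 / (2 * (1 + \<delta>)) * X\<^sup>2)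
    + (a * (e\<gamma> - e\<mu> - \<kappa>/2 * Y\<^sup>2) - a\<^sup>2 / (2 * (1 - \<delta>)) * Y\<^sup>2)"
  have Q_eq: "a\<^sup>2 / (2 * (1 + \<delta>)) * X\<^sup>2 - a\<^sup>2 / (2 * (1 - \<delta>)) * Y\<^sup>2 = Q"
    by (simp add: Q_def power_mult_distrib)
  have "A \<le> A + (a * (e\<pi> - e\<rho> - \<kappa>/2 * X\<^sup>2) + a * (e\<gamma> - e\<rho> - \<kappa>/2 * r\<^sup>2) - q1 * (S1\<^sup>2 / 2) + P1 + \<tau>)
     + (a * (e\<rho> - e\<gamma> - \<kappa>/2 * r\<^sup>2) + a * (e\<mu> - e\<gamma> - \<kappa>/2 * Y\<^sup>2) - q2 * (S2\<^sup>2 / 2) + P2 + \<tau>)"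
    using F1 F2 by linarith
  also have "\<dots> = Q - \<kappa> * (a * (X\<^sup>2 + r\<^sup>2 + Y\<^sup>2)) - (q1 * S1\<^sup>2 + q2 * S2\<^sup>2) / 2 + P1 + P2 + 2 * \<tau>"
    unfolding A_def Q_eq[symmetric] by (simp add: algebra_simps add_divide_distrib)
  also have "- \<kappa> * (a * (X\<^sup>2 + r\<^sup>2 + Y\<^sup>2)) \<le> \<bar>\<kappa>\<bar> * (a * (X\<^sup>2 + r\<^sup>2 + Y\<^sup>2))"
    using a by (intro mult_right_mono) auto
  then have "Q - \<kappa> * (a * (X\<^sup>2 + r\<^sup>2 + Y\<^sup>2)) - (q1 * S1\<^sup>2 + q2 * S2\<^sup>2) / 2 + P1 + P2 + 2 * \<tau>
     \<le> \<bar>\<kappa>\<bar> * (a * (X\<^sup>2 + r\<^sup>2 + Y\<^sup>2)) - (q1 * S1\<^sup>2 + q2 * S2\<^sup>2) / 4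
    + 6 * (\<epsilon> + \<tau>)\<^sup>2 / \<delta> + P1 + P2 + 2 * \<tau>"
    using Q by (simp add: add_divide_distrib)
  finally have "lam * A \<le> lam * (\<bar>\<kappa>\<bar> * (a * (X\<^sup>2 + r\<^sup>2 + Y\<^sup>2)) - (q1 * S1\<^sup>2 + q2 * S2\<^sup>2) / 4
    + 6 * (\<epsilon> + \<tau>)\<^sup>2 / \<delta> + P1 + P2 + 2 * \<tau>)"
    using lam by (intro mult_left_mono) auto
  moreover have "U + V \<le> lam * A + 2 * \<tau>" using U V unfolding A_def distrib_left[of lam] by linarith
  ultimately show ?thesis by linarith
qed

section \<open>Slope growth, and competitors near points of infinite energy\<close>

context evi_space
begin

text \<open>Comparison with \<open>y\<close> along a geodesic. The threshold absorbs the convexity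
  defect and the constants, so that \<open>L / (e z + c)\<^sup>2\<close> times the squared slope is
  at least \<open>L / (4 * R\<^sup>2)\<close>.\<close>

lemma slope_large:
  assumes z: "z \<in> DI" and y: "y \<in> D" and R: "dist z y \<le> R" "0 < R" and c: "0 \<le> c"
    and large: "c + 2 * \<bar>e y\<bar> + \<bar>\<kappa>\<bar> * R\<^sup>2 < e z"
  shows "(e z + c) / (2 * R) \<le> slope z"
proof -
  have "0 \<le> \<bar>\<kappa>\<bar> * R\<^sup>2" by simp
  then have less: "e y < e z" using large c abs_ge_self[of "e y"] by linarith
  then have ne: "z \<noteq> y" by auto
  then have d: "0 < dist z y" by simp
  have "(e z - e y) / R - \<bar>\<kappa>\<bar>/2 * R \<le> (e z - e y) / dist z y - \<bar>\<kappa>\<bar>/2 * dist z y"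
  proof (rule diff_mono)
    show "(e z - e y) / R \<le> (e z - e y) / dist z y"
      by (rule divide_left_mono[OF R(1) _ mult_pos_pos[OF R(2) d]]) (use less in simp)
    show "\<bar>\<kappa>\<bar>/2 * dist z y \<le> \<bar>\<kappa>\<bar>/2 * R" by (rule mult_left_mono[OF R(1)]) simp
  qed
  also have "\<dots> \<le> slope z" by (rule slope_lower_bound[OF z y ne])
  finally have 1: "(e z - e y) / R - \<bar>\<kappa>\<bar>/2 * R \<le> slope z" .
  have "(e z - e y) / R - \<bar>\<kappa>\<bar>/2 * R = (2 * e z - 2 * e y - \<bar>\<kappa>\<bar> * R\<^sup>2) / (2 * R)"
    using R by (simp add: field_simps power2_eq_square)
  moreover have "(e z + c) / (2 * R) \<le> (2 * e z - 2 * e y - \<bar>\<kappa>\<bar> * R\<^sup>2) / (2 * R)"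
    using R large abs_ge_self[of "e y"] by (intro divide_right_mono) auto
  ultimately show ?thesis using 1 by linarith
qed

text \<open>The point \<open>x\<close> may have infinite energy, and upper semicontinuity does not
  give nearby points of \<open>D\<close> comparable values of \<open>u\<close>; the subsolution
  property itself supplies one. Since a cylinder function needs at least one centre, \<rho> is used
  again, and the test function becomes \<open>a * (dist q \<rho>)\<^sup>2 / s\<close>.\<close>

lemma value_near_domain:
  assumes sub: "quad_subsolution lam \<sigma> h u" and bound: "\<And>z. \<bar>u z\<bar> \<le> b"
    and s: "0 < s" and a: "4 * s * b + 4 \<le> a" and \<rho>: "\<rho> \<in> DI" and near: "a * (dist x \<rho>)\<^sup>2 \<le> 1"
    and \<epsilon>: "0 < \<epsilon>" "\<epsilon> \<le> 1"
  obtains p where "p \<in> D" "dist p \<rho> \<le> 1" "s * u x - a * (dist x \<rho>)\<^sup>2 - \<epsilon> \<le> s * u p - a/2 * (dist p \<rho>)\<^sup>2"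
proof -
  have "0 \<le> b" using bound[of x] by (meson abs_ge_zero order_trans)
  then have sb: "0 \<le> s * b" using s by simp
  then have apos: "0 < a" using a by simp
  let ?w = "\<lambda>i::nat. a / s" and ?c = "\<lambda>i::nat. \<rho>"
  have test: "quad_test (a / s) 1 \<rho> ?w ?c q = a * (dist q \<rho>)\<^sup>2 / s" for q
    by (simp add: quad_test_def)
  obtain p where p: "p \<in> D" "\<And>q. u q - quad_test (a / s) 1 \<rho> ?w ?c q \<le> u p - quad_test (a / s) 1 \<rho> ?w ?c p + \<epsilon> / s"
    using sub[unfolded quad_subsolution_def, rule_format, of "a / s" 1 \<rho> ?w ?c "\<epsilon> / s"] apos s \<rho> \<epsilon>(1) by auto
  have "s * (u x - a * (dist x \<rho>)\<^sup>2 / s) \<le> s * (u p - a * (dist p \<rho>)\<^sup>2 / s + \<epsilon> / s)"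
    using p(2)[of x, unfolded test] s by (intro mult_left_mono) auto
  moreover have "s * (A - B / s) = s * A - B" "s * (A - B / s + C / s) = s * A - B + C" for A B C
    using s by (simp_all add: right_diff_distrib distrib_left)
  ultimately have opt: "s * u x - a * (dist x \<rho>)\<^sup>2 \<le> s * u p - a * (dist p \<rho>)\<^sup>2 + \<epsilon>" by (simp only:)
  have su: "\<bar>s * u z\<bar> \<le> s * b" for z using bound[of z] s by (simp add: abs_mult)
  have "a * (dist p \<rho>)\<^sup>2 \<le> 2 * (s * b) + 2"
    using opt abs_le_D1[OF su[of p]] abs_le_D2[OF su[of x]] near \<epsilon> by linarith
  also have "\<dots> \<le> a * 1" using a sb by simp
  finally have "(dist p \<rho>)\<^sup>2 \<le> 1" using apos by simp
  then have "dist p \<rho> \<le> 1" by (simp add: abs_square_le_1)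
  moreover have "s * u x - a * (dist x \<rho>)\<^sup>2 - \<epsilon> \<le> s * u p - a/2 * (dist p \<rho>)\<^sup>2"
  proof -
    have "a/2 * (dist p \<rho>)\<^sup>2 \<le> a * (dist p \<rho>)\<^sup>2" using apos by (intro mult_right_mono) auto
    then show ?thesis using opt by linarith
  qed
  ultimately show thesis using that p(1) by blast
qed

end

section \<open>Choice of constants and conclusion\<close>

context comparison_data
begin

lemma comparison:
  assumes weak: "weak_topology_assumption Wt E" and wh': "continuous_map Wt euclideanreal h'"
    and H: "\<And>z. h z + h' z \<le> H"
  shows "u x + v x \<le> H"
proof (rule field_le_epsilon)
  fix \<eta>\<^sub>0 :: real assume \<eta>\<^sub>0: "0 < \<eta>\<^sub>0"
  \<comment> \<open>Thirteen losses of size \<eta> occur: 3 between \<open>x\<close> and the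
    supremum \<open>SF a\<close>, 1 down to the optimum, 2 from the bounded penalties, 4 in the
    viscosity inequality, 2 in the right-hand sides, and 1 on returning to equal weights at
    \<open>x\<close>.\<close>
  define \<eta> where "\<eta> = min 1 (\<eta>\<^sub>0 / 13)"
  have \<eta>: "0 < \<eta>" "\<eta> \<le> 1" "13 * \<eta> \<le> \<eta>\<^sub>0" using \<eta>\<^sub>0 by (auto simp: \<eta>_def)
  have b0: "0 \<le> b" using bounds(1)[of y] by (meson abs_ge_zero order_trans)
  obtain C where C: "0 < C" "\<And>z. z \<in> D \<Longrightarrow> - C * (1 + (dist z y)\<^sup>2) \<le> e z"
    using quadratic_lower_bound[OF y] by auto
  define CP where "CP = \<bar>e y\<bar> + C + \<bar>\<kappa>\<bar>"
  have CP: "0 \<le> CP" using C(1) by (simp add: CP_def)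
  define \<delta> where "\<delta> = min (1/2) (\<eta> / (2 * b + 1))"
  have \<delta>: "0 < \<delta>" "\<delta> \<le> 1/2"
  proof -
    show "0 < \<delta>" using \<eta> b0 by (auto simp: \<delta>_def)
    show "\<delta> \<le> 1/2" unfolding \<delta>_def by (rule min.cobounded1)
  qed
  have \<delta>b: "\<delta> * (2 * b) \<le> \<eta>"
  proof -
    have "\<delta> * (2 * b) \<le> \<eta> / (2 * b + 1) * (2 * b + 1)" using \<eta> b0 by (intro mult_mono) (auto simp: \<delta>_def)
    then show ?thesis using b0 by simp
  qed
  define l where "l = ln (1 + (dist x y + 1)\<^sup>2)"
  have l: "0 \<le> l" unfolding l_def by (intro ln_ge_zero) simp
  \<comment> \<open>The uses of \<epsilon>: the squared excess with coefficient
    \<open>24 * lam\<close>, the logarithm along the flow at both inner points with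
    \<open>4 * lam * CP\<close>, and the logarithm at the competitor near \<open>x\<close> with
    \<open>2 * l\<close>.\<close>
  define M where "M = 24 * lam + 4 * lam * CP + 2 * l + 1"
  have M: "0 < M" using lam CP l by (auto simp: M_def intro!: add_nonneg_pos add_nonneg_nonneg)
  define \<epsilon> where "\<epsilon> = min \<delta> (\<eta> / M)"
  have \<epsilon>: "0 < \<epsilon>" "\<epsilon> \<le> \<delta>" using \<delta> \<eta> M by (auto simp: \<epsilon>_def)
  have \<epsilon>M: "\<epsilon> * k \<le> \<eta>" if "k \<le> M" for k
  proof -
    have "\<epsilon> * k \<le> \<epsilon> * M" using that \<epsilon> by (intro mult_left_mono) auto
    also have "\<dots> \<le> \<eta> / M * M" using M by (intro mult_right_mono) (auto simp: \<epsilon>_def)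
    also have "\<dots> = \<eta>" using M by simp
    finally show ?thesis .
  qed
  have lamCP: "0 \<le> lam * CP" using lam CP by simp
  have \<epsilon>1: "\<epsilon> * (24 * lam) \<le> \<eta>" "\<epsilon> * (4 * (lam * CP)) \<le> \<eta>" "\<epsilon> * (2 * l) \<le> \<eta>"
    using lam lamCP l by (intro \<epsilon>M; simp add: M_def)+
  \<comment> \<open>Near-optimality and the bounds on \<open>u\<close> and \<open>v\<close> force
    \<epsilon> times the logarithm below \<open>4 * b + 5\<close>; this radius turns that into
    distance at most \<open>R - 1\<close> from \<open>y\<close>.\<close>
  define R where "R = 2 + dist x y + exp ((4 * b + 10) / \<epsilon>)"
  have exp1: "1 \<le> exp ((4 * b + 10) / \<epsilon>)" using b0 \<epsilon> by simp
  have R: "3 \<le> R" "dist x y + 2 \<le> R" unfolding R_def using exp1 zero_le_dist[of x y] by linarith+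
  \<comment> \<open>At an inner point of energy above \<open>K0\<close> the slope gain would be at
    least \<open>L / (4 * R\<^sup>2) * (lam / 4) = 4 * b + 7\<close>, more than the bound
    \<open>4 * b + 4\<close> on the total gain in \<open>D2_le\<close>.\<close>
  define L where "L = 16 * R\<^sup>2 * (4 * b + 7) / lam"
  have L: "0 < L" using R lam b0 by (auto simp: L_def intro!: divide_pos_pos mult_pos_pos)
  \<comment> \<open>On the ball this makes \<open>L / (e z + c)\<close> at most \<eta> and its
    derivative at most \<open>\<delta> / 16\<close>. That is half of the weight
    \<open>\<delta>/8\<close> allowed in \<open>combined_estimate\<close>; the other half is left
    for \<open>\<epsilon>\<^sub>1\<close>.\<close>
  define c where "c = 1 + C * (1 + R\<^sup>2) + L / \<eta> + 16 * L / \<delta>"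
  have cpos: "0 < C * (1 + R\<^sup>2)" "0 < L / \<eta>" "0 < 16 * L / \<delta>"
    using C L \<eta> \<delta> by (auto intro!: mult_pos_pos add_pos_nonneg)
  have c1: "1 \<le> c" using cpos by (simp add: c_def)
  define K where "K = {z \<in> D. dist z y \<le> R}"
  have ec: "1 + L / \<eta> + 16 * L / \<delta> \<le> e z + c" if "z \<in> K" for z
  proof -
    have "C * (1 + (dist z y)\<^sup>2) \<le> C * (1 + R\<^sup>2)"
      using that C(1) by (intro mult_left_mono add_left_mono power_mono) (auto simp: K_def)
    moreover have "- (C * (1 + (dist z y)\<^sup>2)) \<le> e z" using C(2)[of z] that by (simp add: K_def)
    ultimately show ?thesis unfolding c_def by linarith
  qed
  have ec1: "1 \<le> e z + c" and ec2: "L / (e z + c) \<le> \<eta>" and ec3: "0 \<le> L / (e z + c)"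
    and ec4: "L / (e z + c)\<^sup>2 \<le> \<delta> / 16" and ec5: "- c \<le> e z" if z: "z \<in> K" for z
  proof -
    show 1: "1 \<le> e z + c" using ec[OF z] cpos by linarith
    then show "0 \<le> L / (e z + c)" "- c \<le> e z" using L by auto
    have "L / (e z + c) \<le> L / (L / \<eta>)" using ec[OF z] cpos L \<eta> 1 by (intro divide_left_mono) auto
    also have "\<dots> = \<eta>" using L \<eta> by simp
    finally show "L / (e z + c) \<le> \<eta>" .
    have "e z + c \<le> (e z + c)\<^sup>2" using 1 by (simp add: power2_eq_square)
    then have "L / (e z + c)\<^sup>2 \<le> L / (16 * L / \<delta>)"
      using ec[OF z] cpos L 1 by (intro divide_left_mono mult_pos_pos) (auto simp: zero_less_power2)
    also have "\<dots> = \<delta> / 16" using L \<delta> by simp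
    finally show "L / (e z + c)\<^sup>2 \<le> \<delta> / 16" .
  qed
  \<comment> \<open>\<open>K0\<close> will bound the energies of \<rho> and \<gamma>, and
    \<open>K1\<close> those of \<pi> and \<mu>. Neither depends on \<open>a\<close>, so the modulus
    \<open>d\<close> is available when \<open>a\<close> is chosen.\<close>
  define K0 where "K0 = c + 2 * \<bar>e y\<bar> + \<bar>\<kappa>\<bar> * R\<^sup>2"
  define K1 where "K1 = K0 + (4 * b + 1) / lam + 4 * \<bar>\<kappa>\<bar> + 4"
  obtain d where d: "0 < d" "\<And>z z'. \<lbrakk>dist y z \<le> R; E z \<le> ereal K1; dist y z' \<le> R; E z' \<le> ereal K1; dist z z' < d\<rbrakk>
      \<Longrightarrow> \<bar>h' z - h' z'\<bar> < \<eta>"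
    using weakly_continuous_imp_uniformly_continuous[OF weak wh' \<eta>(1), of y R K1] by blast
  define s1 where "s1 = 1 + \<delta>"
  define s2 where "s2 = 1 - \<delta>"
  have s: "0 < s1" "0 < s2" "1 \<le> s1" "s1 \<le> 3/2" "s2 \<le> 1" using \<delta> by (auto simp: s1_def s2_def)
  define a\<^sub>0 where "a\<^sub>0 = 16 * b + 16 + 100 / d\<^sup>2"
  have a\<^sub>0: "16 * b + 16 \<le> a\<^sub>0" "100 / d\<^sup>2 \<le> a\<^sub>0" using b0 by (auto simp: a\<^sub>0_def)
  \<comment> \<open>The term with \<open>\<epsilon>\<^sub>1\<close> is left out: that parameter must
    be small relative to the energies of a near-optimal quadruple, and such a quadruple exists only
    once \<open>a\<close> is fixed.\<close>
  define F where "F = (\<lambda>a \<pi> \<rho> \<gamma> \<mu>. doubled s1 s2 a L c 0 \<epsilon> \<pi> \<rho> \<gamma> \<mu>)"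
  define Fs where "Fs = (\<lambda>a. {F a \<pi> \<rho> \<gamma> \<mu> | \<pi> \<rho> \<gamma> \<mu>. \<pi> \<in> K \<and> \<rho> \<in> K \<and> \<gamma> \<in> K \<and> \<mu> \<in> K})"
  define SF where "SF = (\<lambda>a. Sup (Fs a))"
  have yK: "y \<in> K" using y R by (simp add: K_def)
  have sub: "\<bar>s1 * u z\<bar> \<le> s1 * b" "\<bar>s2 * v z\<bar> \<le> s2 * b" for z
    using bounds(1,2)[of z] s by (simp_all add: abs_mult)
  have s12: "s1 * b + s2 * b = 2 * b" by (simp add: s1_def s2_def algebra_simps)
  have pen0: "penalty L c 0 \<epsilon> y z = - L / (e z + c) + \<epsilon> * ln (1 + (dist z y)\<^sup>2)" for z
    by (simp add: penalty_def)
  have ln0: "0 \<le> \<epsilon> * ln (1 + (dist z y)\<^sup>2)" for z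
    using \<epsilon> by (intro mult_nonneg_nonneg ln_ge_zero) auto
  have pen0_ge: "- \<eta> \<le> penalty L c 0 \<epsilon> y z" if "z \<in> K" for z
    using ec2[OF that] ln0[of z] by (simp add: pen0)
  have F_upper: "F a \<pi> \<rho> \<gamma> \<mu> \<le> s1 * u \<pi> + s2 * v \<mu> + 2 * \<eta>" if "0 \<le> a" "\<rho> \<in> K" "\<gamma> \<in> K" for a \<pi> \<rho> \<gamma> \<mu>
  proof -
    have "0 \<le> a/2 * ((dist \<rho> \<pi>)\<^sup>2 + (dist \<rho> \<gamma>)\<^sup>2 + (dist \<gamma> \<mu>)\<^sup>2)" using that by simp
    then show ?thesis using pen0_ge[OF that(2)] pen0_ge[OF that(3)] unfolding F_def doubled_def by linarith
  qed
  have F_bound: "F a \<pi> \<rho> \<gamma> \<mu> \<le> 2 * b + 2" if "0 \<le> a" "\<rho> \<in> K" "\<gamma> \<in> K" for a \<pi> \<rho> \<gamma> \<mu>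
    using F_upper[OF that, of \<pi> \<mu>] abs_le_D1[OF sub(1)[of \<pi>]] abs_le_D1[OF sub(2)[of \<mu>]] s12 \<eta> by linarith
  have bdd: "bdd_above (Fs a)" if "0 \<le> a" for a
    unfolding Fs_def bdd_above_def using F_bound[OF that] by blast
  have SF_upper: "F a \<pi> \<rho> \<gamma> \<mu> \<le> SF a" if "0 \<le> a" "\<pi> \<in> K" "\<rho> \<in> K" "\<gamma> \<in> K" "\<mu> \<in> K" for a \<pi> \<rho> \<gamma> \<mu>
    unfolding SF_def using that by (intro cSup_upper bdd) (auto simp: Fs_def)
  have SF_lower: "- 2 * b \<le> SF a" if "0 \<le> a" for a
  proof -
    have "- 2 * b \<le> F a y y y y"
      using abs_le_D2[OF sub(1)[of y]] abs_le_D2[OF sub(2)[of y]] s12 ec3[OF yK]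
      unfolding F_def doubled_def pen0 by simp
    also have "\<dots> \<le> SF a" by (rule SF_upper[OF that yK yK yK yK])
    finally show ?thesis .
  qed
  have F_ne: "Fs a \<noteq> {}" for a
  proof -
    have "F a y y y y \<in> Fs a" unfolding Fs_def using yK by blast
    then show ?thesis by blast
  qed
  have SF_antimono: "SF a' \<le> SF a" if "0 \<le> a" "a \<le> a'" for a a'
  proof -
    have "Sup (Fs a') \<le> Sup (Fs a)"
    proof (rule cSup_least[OF F_ne])
      fix t assume "t \<in> Fs a'"
      then obtain \<pi> \<rho> \<gamma> \<mu> where t: "t = F a' \<pi> \<rho> \<gamma> \<mu>" "\<pi> \<in> K" "\<rho> \<in> K" "\<gamma> \<in> K" "\<mu> \<in> K"
        unfolding Fs_def by blast
      have "a/2 * ((dist \<rho> \<pi>)\<^sup>2 + (dist \<rho> \<gamma>)\<^sup>2 + (dist \<gamma> \<mu>)\<^sup>2) \<le> a'/2 * ((dist \<rho> \<pi>)\<^sup>2 + (dist \<rho> \<gamma>)\<^sup>2 + (dist \<gamma> \<mu>)\<^sup>2)"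
        using that by (intro mult_right_mono) auto
      then have "t \<le> F a \<pi> \<rho> \<gamma> \<mu>" unfolding t(1) F_def doubled_def by linarith
      also have "\<dots> \<le> Sup (Fs a)" using SF_upper[OF that(1) t(2-5)] by (simp add: SF_def)
      finally show "t \<le> Sup (Fs a)" .
    qed
    then show ?thesis by (simp add: SF_def)
  qed
  define \<eta>' where "\<eta>' = min \<eta> (\<eta> / (8 * lam * \<bar>\<kappa>\<bar> + 1))"
  have lk: "0 \<le> 8 * lam * \<bar>\<kappa>\<bar>" using lam by simp
  have \<eta>': "0 < \<eta>'" "\<eta>' \<le> \<eta>" using \<eta> lk by (auto simp: \<eta>'_def)
  have \<eta>'k: "lam * \<bar>\<kappa>\<bar> * (8 * \<eta>') \<le> \<eta>"
  proof -
    have "(8 * lam * \<bar>\<kappa>\<bar>) * \<eta>' \<le> (8 * lam * \<bar>\<kappa>\<bar> + 1) * (\<eta> / (8 * lam * \<bar>\<kappa>\<bar> + 1))"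
      using lk \<eta>' by (intro mult_mono) (auto simp: \<eta>'_def)
    also have "\<dots> = \<eta>" using lk by simp
    finally show ?thesis by (simp add: mult_ac)
  qed
  \<comment> \<open>The suprema decrease along doublings of \<open>a\<close> and are bounded below,
    so consecutive differences tend to 0 and some doubling changes the supremum by less than
    \<open>\<eta>'\<close>.\<close>
  define G where "G = (\<lambda>n. SF (2 ^ n * a\<^sub>0))"
  have a\<^sub>0pos: "0 < a\<^sub>0" using a\<^sub>0(1) b0 by linarith
  have "decseq G"
    unfolding G_def decseq_Suc_iff using a\<^sub>0pos by (auto intro!: SF_antimono)
  moreover have "\<forall>i. - 2 * b \<le> G i" unfolding G_def using SF_lower a\<^sub>0pos by simp
  ultimately obtain g where "G \<longlonglongrightarrow> g" using decseq_convergent[of G "- 2 * b"] by metis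
  then have "(\<lambda>n. G n - G (Suc n)) \<longlonglongrightarrow> g - g" by (intro tendsto_diff LIMSEQ_Suc)
  then have "eventually (\<lambda>n. G n - G (Suc n) < \<eta>') sequentially"
    using \<eta>' by (intro order_tendstoD) auto
  then obtain n where n: "G n - G (Suc n) < \<eta>'" by (auto simp: eventually_sequentially)
  define a where "a = 2 ^ Suc n * a\<^sub>0"
  have a_half: "a / 2 = 2 ^ n * a\<^sub>0" by (simp add: a_def)
  have gap: "SF (a / 2) - SF a < \<eta>'" using n by (simp only: G_def a_half[symmetric] a_def[symmetric])
  have "1 * a\<^sub>0 \<le> a" unfolding a_def using a\<^sub>0pos by (intro mult_right_mono one_le_power) auto
  then have a: "16 * b + 16 \<le> a" "100 / d\<^sup>2 \<le> a" "0 < a" using a\<^sub>0 a\<^sub>0pos by linarith+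
  have as: "4 * s1 * b + 4 \<le> a" "4 * s2 * b + 4 \<le> a"
  proof -
    have "s1 * b \<le> 2 * b" "s2 * b \<le> 2 * b" using s b0 by (auto intro!: mult_right_mono)
    then show "4 * s1 * b + 4 \<le> a" "4 * s2 * b + 4 \<le> a" using a(1) b0 by (simp_all only: mult.assoc)
  qed
  \<comment> \<open>The competing quadruple is \<open>p, \<rho>, \<rho>, q\<close>: the flow moves
    \<open>x\<close> into the domain, density gives \<rho> of finite information nearby, and
    \<open>value_near_domain\<close> gives \<open>p\<close> and \<open>q\<close> around this common
    centre.\<close>
  have low_x: "s1 * u x + s2 * v x - 3 * \<eta> \<le> SF a"
  proof -
    define r where "r = min 1 (\<eta> / (2 * a))"
    have r: "0 < r" "r \<le> 1" using \<eta> a by (auto simp: r_def)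
    have ar: "a * r\<^sup>2 \<le> \<eta> / 2"
    proof -
      have "a * r\<^sup>2 \<le> a * (1 * (\<eta> / (2 * a)))"
        unfolding power2_eq_square using r a by (intro mult_left_mono mult_mono) (auto simp: r_def)
      also have "\<dots> = \<eta> / 2" using a by simp
      finally show ?thesis .
    qed
    obtain t where t: "0 < t" "dist (S t x) x < r / 2"
      using flow_near[of "r / 2" x] r by (metis half_gt_zero half_gt_zero_iff field_sum_of_halves less_add_same_cancel1 less_imp_le)
    obtain \<rho> where \<rho>: "\<rho> \<in> DI" "dist \<rho> (S t x) < r / 2"
      using DI_dense[OF flow_dom[OF t(1)], of "r / 2" x] r by auto
    have xr: "dist x \<rho> < r" using dist_triangle[of \<rho> x "S t x"] \<rho> t by (simp add: dist_commute)
    have adx: "a * (dist x \<rho>)\<^sup>2 \<le> \<eta> / 2"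
    proof -
      have "a * (dist x \<rho>)\<^sup>2 \<le> a * r\<^sup>2" using xr a by (intro mult_left_mono power_mono) auto
      then show ?thesis using ar by simp
    qed
    have adx1: "a * (dist x \<rho>)\<^sup>2 \<le> 1" "0 < \<eta> / 2" "\<eta> / 2 \<le> 1" using adx \<eta> by auto
    obtain p where p: "p \<in> D" "dist p \<rho> \<le> 1" "s1 * u x - a * (dist x \<rho>)\<^sup>2 - \<eta>/2 \<le> s1 * u p - a/2 * (dist p \<rho>)\<^sup>2"
      by (rule value_near_domain[OF sub_u bounds(1) s(1) as(1) \<rho>(1) adx1])
    obtain q where q: "q \<in> D" "dist q \<rho> \<le> 1" "s2 * v x - a * (dist x \<rho>)\<^sup>2 - \<eta>/2 \<le> s2 * v q - a/2 * (dist q \<rho>)\<^sup>2"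
      by (rule value_near_domain[OF sub_v bounds(2) s(2) as(2) \<rho>(1) adx1])
    have \<rho>y: "dist \<rho> y \<le> dist x y + 1" using dist_triangle3[of \<rho> y x] xr r by (simp add: dist_commute)
    have inK: "\<rho> \<in> K" "p \<in> K" "q \<in> K"
      using \<rho>y R DI_D[OF \<rho>(1)] p q dist_triangle[of p y \<rho>] dist_triangle[of q y \<rho>] by (auto simp: K_def)
    have "1 + (dist \<rho> y)\<^sup>2 \<le> 1 + (dist x y + 1)\<^sup>2" using \<rho>y by (intro add_left_mono power_mono) auto
    then have "ln (1 + (dist \<rho> y)\<^sup>2) \<le> l" unfolding l_def by (subst ln_le_cancel_iff) (auto intro: add_pos_nonneg)
    then have "\<epsilon> * ln (1 + (dist \<rho> y)\<^sup>2) \<le> \<epsilon> * l" using \<epsilon> by (intro mult_left_mono) auto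
    then have "2 * penalty L c 0 \<epsilon> y \<rho> \<le> \<eta>"
      using \<epsilon>1(3) ec3[OF inK(1)] by (simp add: pen0 mult_ac)
    then have "s1 * u x + s2 * v x - 3 * \<eta> \<le> F a p \<rho> \<rho> q"
      using p(3) q(3) adx unfolding F_def doubled_def
      by (simp add: dist_commute[of \<rho>] distrib_left)
    also have "\<dots> \<le> SF a" using inK a by (intro SF_upper) auto
    finally show ?thesis .
  qed
  have "\<exists>t\<in>Fs a. SF a - \<eta>'/4 < t"
    using less_cSup_iff[OF F_ne bdd, of a "SF a - \<eta>'/4"] a \<eta>' by (simp add: SF_def)
  then obtain \<pi>' \<rho>' \<gamma>' \<mu>' where comp: "\<pi>' \<in> K" "\<rho>' \<in> K" "\<gamma>' \<in> K" "\<mu>' \<in> K"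
    and comp_val: "SF a - \<eta>'/4 < F a \<pi>' \<rho>' \<gamma>' \<mu>'"
    unfolding Fs_def by blast
  \<comment> \<open>Dominates both relevant energy sums: the term with
    \<open>\<epsilon>\<^sub>1\<close> costs at most \<open>\<eta>'/4\<close> at the comparison
    quadruple and raises the value by at most \<open>\<eta>'/4\<close> anywhere in
    \<open>K\<close>.\<close>
  define m where "m = \<bar>e \<rho>'\<bar> + \<bar>e \<gamma>'\<bar> + 2 * c + 1"
  have m: "0 < m" "2 * c \<le> m" "e \<rho>' + e \<gamma>' \<le> m" using c1 by (auto simp: m_def)
  define \<epsilon>\<^sub>1 where "\<epsilon>\<^sub>1 = min (\<delta> / 16) (\<eta>' / (4 * m))"
  have \<epsilon>\<^sub>1: "0 < \<epsilon>\<^sub>1" "\<epsilon>\<^sub>1 \<le> \<delta> / 16" using \<delta> \<eta>' m by (auto simp: \<epsilon>\<^sub>1_def)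
  have \<epsilon>\<^sub>1m: "\<epsilon>\<^sub>1 * k \<le> \<eta>'/4" if "k \<le> m" for k
  proof -
    have "\<epsilon>\<^sub>1 * k \<le> \<epsilon>\<^sub>1 * m" using that \<epsilon>\<^sub>1 by (intro mult_left_mono) auto
    also have "\<dots> \<le> \<eta>' / (4 * m) * m" using m by (intro mult_right_mono) (auto simp: \<epsilon>\<^sub>1_def)
    also have "\<dots> = \<eta>'/4" using m by simp
    finally show ?thesis .
  qed
  define \<tau> where "\<tau> = min (min \<epsilon> (\<eta>'/4)) (\<eta> / (2 * lam + 2))"
  have \<tau>: "0 < \<tau>" "\<tau> \<le> \<epsilon>" "\<tau> \<le> \<eta>'/4"
  proof -
    show "0 < \<tau>" using \<epsilon> \<eta>' \<eta> lam by (auto simp: \<tau>_def)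
    show "\<tau> \<le> \<epsilon>" unfolding \<tau>_def by (intro min.coboundedI1 min.cobounded1)
    show "\<tau> \<le> \<eta>'/4" unfolding \<tau>_def by (intro min.coboundedI1 min.cobounded2)
  qed
  have \<tau>lam: "lam * (2 * \<tau>) + 2 * \<tau> \<le> \<eta>"
  proof -
    have "\<tau> * (2 * lam + 2) \<le> \<eta> / (2 * lam + 2) * (2 * lam + 2)"
      using lam by (intro mult_right_mono) (auto simp: \<tau>_def)
    also have "\<dots> = \<eta>" using lam by simp
    finally show ?thesis by (simp add: algebra_simps)
  qed
  have F_eps: "doubled s1 s2 a L c \<epsilon>\<^sub>1 \<epsilon> \<pi> \<rho> \<gamma> \<mu> = F a \<pi> \<rho> \<gamma> \<mu> - \<epsilon>\<^sub>1 * (e \<rho> + e \<gamma>)" for \<pi> \<rho> \<gamma> \<mu>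
    by (simp add: F_def doubled_def penalty_def algebra_simps)
  have comp_eps: "SF a - \<eta>'/2 \<le> doubled s1 s2 a L c \<epsilon>\<^sub>1 \<epsilon> \<pi>' \<rho>' \<gamma>' \<mu>'"
    using comp_val \<epsilon>\<^sub>1m[OF m(3)] by (simp add: F_eps)
  have energy_sum: "- (\<eta>'/4) \<le> \<epsilon>\<^sub>1 * (e \<rho> + e \<gamma>)" if "\<rho> \<in> K" "\<gamma> \<in> K" for \<rho> \<gamma>
  proof -
    have "\<epsilon>\<^sub>1 * (- (2 * c)) \<le> \<epsilon>\<^sub>1 * (e \<rho> + e \<gamma>)"
      using ec5[OF that(1)] ec5[OF that(2)] \<epsilon>\<^sub>1 by (intro mult_left_mono) auto
    then show ?thesis using \<epsilon>\<^sub>1m[OF m(2)] by simp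
  qed
  have conf: "dist \<rho> y \<le> R - 1 \<and> dist \<gamma> y \<le> R - 1"
    if "\<rho> \<in> D" "\<gamma> \<in> D" "dist \<rho> y \<le> R" "dist \<gamma> y \<le> R"
      and ge: "doubled s1 s2 a L c \<epsilon>\<^sub>1 \<epsilon> \<pi>' \<rho>' \<gamma>' \<mu>' - \<tau> \<le> doubled s1 s2 a L c \<epsilon>\<^sub>1 \<epsilon> \<pi> \<rho> \<gamma> \<mu>"
    for \<pi> \<rho> \<gamma> \<mu>
  proof -
    have inK: "\<rho> \<in> K" "\<gamma> \<in> K" using that by (auto simp: K_def)
    have "- 2 * b - 1 \<le> F a \<pi> \<rho> \<gamma> \<mu> + \<eta>'/4"
      using ge comp_eps SF_lower[of a] a \<tau> \<eta>' \<eta> energy_sum[OF inK] unfolding F_eps[of \<pi>] by linarith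
    moreover have "0 \<le> a/2 * ((dist \<rho> \<pi>)\<^sup>2 + (dist \<rho> \<gamma>)\<^sup>2 + (dist \<gamma> \<mu>)\<^sup>2)" using a by simp
    ultimately have sum: "\<epsilon> * ln (1 + (dist \<rho> y)\<^sup>2) + \<epsilon> * ln (1 + (dist \<gamma> y)\<^sup>2) \<le> 4 * b + 5"
      using abs_le_D1[OF sub(1)[of \<pi>]] abs_le_D1[OF sub(2)[of \<mu>]] s12 ec2[OF inK(1)] ec2[OF inK(2)] \<eta> \<eta>'
      unfolding F_def doubled_def pen0 minus_divide_left[symmetric] by linarith
    have "dist z y \<le> R - 1" if "\<epsilon> * ln (1 + (dist z y)\<^sup>2) \<le> 4 * b + 5" for z
    proof -
      let ?X = "exp ((4 * b + 10) / \<epsilon>)"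
      have "\<epsilon> * ln (1 + (dist z y)\<^sup>2) \<le> 4 * b + 10" using that by simp
      then have "ln (1 + (dist z y)\<^sup>2) \<le> (4 * b + 10) / \<epsilon>" using \<epsilon> by (simp add: field_simps)
      then have "1 + (dist z y)\<^sup>2 \<le> ?X"
        by (metis add_pos_nonneg exp_le_cancel_iff exp_ln zero_le_power2 zero_less_one)
      also have "?X \<le> ?X\<^sup>2" using exp1 by (simp add: power2_eq_square)
      finally have "(dist z y)\<^sup>2 \<le> ?X\<^sup>2" by linarith
      then have "dist z y \<le> ?X" by (rule power2_le_imp_le) simp
      then show ?thesis unfolding R_def using zero_le_dist[of x y] by linarith
    qed
    with sum ln0[of \<rho>] ln0[of \<gamma>] show ?thesis by simp
  qed
  have compD: "\<pi>' \<in> D" "\<rho>' \<in> D" "\<gamma>' \<in> D" "\<mu>' \<in> D"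
      "dist \<pi>' y \<le> R" "dist \<rho>' y \<le> R" "dist \<gamma>' y \<le> R" "dist \<mu>' y \<le> R"
    using comp by (auto simp: K_def)
  have lowerD: "1 \<le> e z + c" if "z \<in> D" "dist z y \<le> R" for z
    using ec1[of z] that by (simp add: K_def)
  have L0: "0 \<le> L" and \<epsilon>0: "0 \<le> \<epsilon>" and R1: "1 \<le> R" using L \<epsilon> R by auto
  obtain \<pi> \<rho> \<gamma> \<mu> where inD: "\<pi> \<in> D" "\<rho> \<in> DI" "\<gamma> \<in> DI" "\<mu> \<in> D"
    and inR: "dist \<pi> y \<le> R" "dist \<rho> y \<le> R - 1" "dist \<gamma> y \<le> R - 1" "dist \<mu> y \<le> R"
    and val: "doubled s1 s2 a L c \<epsilon>\<^sub>1 \<epsilon> \<pi>' \<rho>' \<gamma>' \<mu>' - \<tau> \<le> doubled s1 s2 a L c \<epsilon>\<^sub>1 \<epsilon> \<pi> \<rho> \<gamma> \<mu>"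
    and U: "s1 * (u \<pi> - h \<pi>) \<le> lam * (a * (e \<rho> - e \<pi> - \<kappa>/2 * (dist \<rho> \<pi>)\<^sup>2) + a\<^sup>2 / (2 * s1) * (dist \<rho> \<pi>)\<^sup>2) + \<tau>"
    and V: "s2 * (v \<mu> - h' \<mu>) \<le> lam * (a * (e \<gamma> - e \<mu> - \<kappa>/2 * (dist \<gamma> \<mu>)\<^sup>2) - a\<^sup>2 / (2 * s2) * (dist \<gamma> \<mu>)\<^sup>2) + \<tau>"
    and F1: "0 \<le> a * (e \<pi> - e \<rho> - \<kappa>/2 * (dist \<rho> \<pi>)\<^sup>2) + a * (e \<gamma> - e \<rho> - \<kappa>/2 * (dist \<rho> \<gamma>)\<^sup>2)
     - (L / (e \<rho> + c)\<^sup>2 + \<epsilon>\<^sub>1) * ((slope \<rho>)\<^sup>2 / 2)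
     + 2 * \<epsilon> / (1 + (dist \<rho> y)\<^sup>2) * (e y - e \<rho> - \<kappa>/2 * (dist \<rho> y)\<^sup>2) + \<tau>"
    and F2: "0 \<le> a * (e \<rho> - e \<gamma> - \<kappa>/2 * (dist \<rho> \<gamma>)\<^sup>2) + a * (e \<mu> - e \<gamma> - \<kappa>/2 * (dist \<gamma> \<mu>)\<^sup>2)
     - (L / (e \<gamma> + c)\<^sup>2 + \<epsilon>\<^sub>1) * ((slope \<gamma>)\<^sup>2 / 2)
     + 2 * \<epsilon> / (1 + (dist \<gamma> y)\<^sup>2) * (e y - e \<gamma> - \<kappa>/2 * (dist \<gamma> y)\<^sup>2) + \<tau>"
    and G1: "a * dist \<rho> \<pi> \<le> a * dist \<rho> \<gamma> + (L / (e \<rho> + c)\<^sup>2 + \<epsilon>\<^sub>1) * slope \<rho> + \<epsilon> + \<tau>"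
    and G2: "a * dist \<rho> \<gamma> \<le> a * dist \<gamma> \<mu> + (L / (e \<gamma> + c)\<^sup>2 + \<epsilon>\<^sub>1) * slope \<gamma> + \<epsilon> + \<tau>"
  proof goal_cases
    case prems: 1
    show ?case
      by (rule perturbed_optimum[OF s(1,2) as L0 \<epsilon>\<^sub>1(1) \<epsilon>0 \<tau>(1) R1 lowerD compD conf], assumption+)
        (rule prems; assumption)
  qed
  have inK: "\<pi> \<in> K" "\<rho> \<in> K" "\<gamma> \<in> K" "\<mu> \<in> K" using inD inR DI_D by (auto simp: K_def)
  have F_val: "SF a - \<eta>' \<le> F a \<pi> \<rho> \<gamma> \<mu>"
    using val comp_eps \<tau>(3) energy_sum[OF inK(2,3)] unfolding F_eps[of \<pi>] by linarith
  define Sq where "Sq = (dist \<rho> \<pi>)\<^sup>2 + (dist \<rho> \<gamma>)\<^sup>2 + (dist \<gamma> \<mu>)\<^sup>2"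
  \<comment> \<open>Halving \<open>a\<close> raises the value at the optimum by
    \<open>a / 4 * Sq\<close>, while the supremum rises by less than \<open>\<eta>'\<close> and the
    optimum was within \<open>\<eta>'\<close> of it.\<close>
  have aSq: "a * Sq \<le> 8 * \<eta>'"
  proof -
    have "F (a / 2) \<pi> \<rho> \<gamma> \<mu> = F a \<pi> \<rho> \<gamma> \<mu> + a / 4 * Sq"
      by (simp add: F_def doubled_def Sq_def algebra_simps)
    moreover have "F (a / 2) \<pi> \<rho> \<gamma> \<mu> \<le> SF (a / 2)" using inK a by (intro SF_upper) auto
    ultimately have "a / 4 * Sq \<le> 2 * \<eta>'" using F_val gap by linarith
    then show ?thesis by simp
  qed
  define q1 where "q1 = L / (e \<rho> + c)\<^sup>2 + \<epsilon>\<^sub>1"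
  define q2 where "q2 = L / (e \<gamma> + c)\<^sup>2 + \<epsilon>\<^sub>1"
  have q: "0 \<le> q1" "q1 \<le> \<delta>/8" "0 \<le> q2" "q2 \<le> \<delta>/8"
  proof -
    show "0 \<le> q1" "0 \<le> q2" unfolding q1_def q2_def using \<epsilon>\<^sub>1 L by (intro add_nonneg_nonneg; simp)+
    show "q1 \<le> \<delta>/8" "q2 \<le> \<delta>/8"
      unfolding q1_def q2_def using ec4[OF inK(2)] ec4[OF inK(3)] \<epsilon>\<^sub>1 by linarith+
  qed
  define P where "P = (\<lambda>z. 2 * \<epsilon> / (1 + (dist z y)\<^sup>2) * (e y - e z - \<kappa>/2 * (dist z y)\<^sup>2))"
  have P_eq: "2 * \<epsilon> / (1 + (dist z y)\<^sup>2) * (e y - e z - \<kappa>/2 * (dist z y)\<^sup>2) = P z" for z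
    by (simp only: P_def)
  \<comment> \<open>The bracket grows at most quadratically in the distance, by the lower bound on
    the energy, and the denominator cancels this growth. The result must not involve
    \<open>R\<close>, which was chosen after \<epsilon>.\<close>
  have P_le: "lam * P z \<le> \<eta> / 2" if "z \<in> K" for z
  proof -
    let ?t = "1 + (dist z y)\<^sup>2"
    have t: "1 \<le> ?t" by simp
    have "\<bar>e y\<bar> * 1 \<le> \<bar>e y\<bar> * ?t" by (intro mult_left_mono) auto
    moreover have "- e z \<le> C * ?t" using C(2)[of z] that by (simp add: K_def)
    moreover have "- \<kappa>/2 * (dist z y)\<^sup>2 \<le> \<bar>\<kappa>\<bar> * ?t" by (intro mult_mono) auto
    ultimately have "e y - e z - \<kappa>/2 * (dist z y)\<^sup>2 \<le> CP * ?t"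
      unfolding CP_def distrib_right using abs_ge_self[of "e y"] by simp
    then have "P z \<le> 2 * \<epsilon> / ?t * (CP * ?t)"
      unfolding P_def using \<epsilon> t by (intro mult_left_mono divide_nonneg_nonneg) auto
    also have "\<dots> = 2 * \<epsilon> * CP"
    proof -
      have "2 * \<epsilon> / k * (CP * k) = 2 * \<epsilon> * CP" if "1 \<le> k" for k using that by simp
      from this[OF t] show ?thesis .
    qed
    finally have "lam * P z \<le> lam * (2 * \<epsilon> * CP)" using lam by (intro mult_left_mono) auto
    also have "\<dots> = \<epsilon> * (4 * (lam * CP)) / 2" by simp
    finally show ?thesis using \<epsilon>1(2) by linarith
  qed
  have \<delta>1: "\<delta> < 1" using \<delta> by simp
  define D1 where "D1 = lam * (\<bar>\<kappa>\<bar> * (a * Sq))"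
  define D2 where "D2 = lam * ((q1 * (slope \<rho>)\<^sup>2 + q2 * (slope \<gamma>)\<^sup>2) / 4)"
  define D3 where "D3 = lam * (6 * (\<epsilon> + \<tau>)\<^sup>2 / \<delta>)"
  have "s1 * (u \<pi> - h \<pi>) + s2 * (v \<mu> - h' \<mu>) \<le> lam * (\<bar>\<kappa>\<bar> * (a * Sq) - (q1 * (slope \<rho>)\<^sup>2 + q2 * (slope \<gamma>)\<^sup>2) / 4
    + 6 * (\<epsilon> + \<tau>)\<^sup>2 / \<delta> + P \<rho> + P \<gamma> + 2 * \<tau>) + 2 * \<tau>"
    unfolding Sq_def
    by (rule combined_estimate[OF \<delta>(1) \<delta>1 lam a(3) U[unfolded s1_def] V[unfolded s2_def]
          F1[folded q1_def, unfolded P_eq] F2[folded q2_def, unfolded P_eq] G1[folded q1_def] G2[folded q2_def] q zero_le_dist,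
          folded s1_def s2_def])
  also have "\<dots> = D1 - D2 + D3 + lam * P \<rho> + lam * P \<gamma> + lam * (2 * \<tau>) + 2 * \<tau>"
    unfolding D1_def D2_def D3_def by (simp only: distrib_left right_diff_distrib)
  finally have main: "s1 * (u \<pi> - h \<pi>) + s2 * (v \<mu> - h' \<mu>) \<le> D1 - D2 + D3 + lam * P \<rho> + lam * P \<gamma> + lam * (2 * \<tau>) + 2 * \<tau>" .
  have D1: "D1 \<le> \<eta>"
  proof -
    have "D1 = lam * \<bar>\<kappa>\<bar> * (a * Sq)" by (simp add: D1_def)
    also have "\<dots> \<le> lam * \<bar>\<kappa>\<bar> * (8 * \<eta>')" using aSq lam by (intro mult_left_mono) auto
    finally show ?thesis using \<eta>'k by simp
  qed
  have D2: "0 \<le> D2" using q lam by (simp add: D2_def)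
  have D3: "D3 \<le> \<eta>"
  proof -
    have "(\<epsilon> + \<tau>)\<^sup>2 \<le> (2 * \<epsilon>)\<^sup>2" using \<tau> \<epsilon> by (intro power_mono) auto
    also have "\<dots> = 4 * (\<epsilon> * \<epsilon>)" by (simp add: power2_eq_square)
    also have "\<dots> \<le> 4 * (\<epsilon> * \<delta>)" using \<epsilon> by (intro mult_left_mono) auto
    finally have "6 * (\<epsilon> + \<tau>)\<^sup>2 / \<delta> \<le> 24 * \<epsilon>" using \<delta> by (simp add: field_simps)
    then have "D3 \<le> lam * (24 * \<epsilon>)" unfolding D3_def using lam by (intro mult_left_mono) auto
    also have "\<dots> = \<epsilon> * (24 * lam)" by simp
    finally show ?thesis using \<epsilon>1(1) by linarith
  qed
  have main': "s1 * (u \<pi> - h \<pi>) + s2 * (v \<mu> - h' \<mu>) \<le> 4 * \<eta> - D2"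
    using main D1 D3 P_le[OF inK(2)] P_le[OF inK(3)] \<tau>lam by linarith
  have uh: "- (2 * b) \<le> u z - h z" "- (2 * b) \<le> v z - h' z" for z
    using bounds[of z] by (auto simp: abs_le_iff)
  have suh: "- (s1 * (2 * b)) \<le> s1 * (u \<pi> - h \<pi>)" "- (s2 * (2 * b)) \<le> s2 * (v \<mu> - h' \<mu>)"
    using mult_left_mono[OF uh(1)[of \<pi>], of s1] mult_left_mono[OF uh(2)[of \<mu>], of s2] s by auto
  \<comment> \<open>All other quantities in \<open>main'\<close> are bounded by \<open>b\<close> and
    \<eta>, so the slope gain is bounded independently of \<open>a\<close>.\<close>
  have D2_le: "D2 \<le> 4 * b + 4"
    using main' suh s12 \<eta> by linarith
  have e_bound: "e z \<le> K0" if z: "z \<in> DI" "dist z y \<le> R" and q': "L / (e z + c)\<^sup>2 * (slope z)\<^sup>2 * lam / 4 \<le> D2" for z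
  proof (rule ccontr)
    assume "\<not> ?thesis"
    then have "c + 2 * \<bar>e y\<bar> + \<bar>\<kappa>\<bar> * R\<^sup>2 < e z" by (simp add: K0_def)
    then have sl: "(e z + c) / (2 * R) \<le> slope z" using c1 R by (intro slope_large[OF z(1) y z(2)]) auto
    have zK: "z \<in> K" using z DI_D by (auto simp: K_def)
    have pos: "0 < e z + c" using ec1[OF zK] by simp
    have "L / (4 * R\<^sup>2) = L / (e z + c)\<^sup>2 * ((e z + c) / (2 * R))\<^sup>2"
      using pos R by (simp add: power_divide power_mult_distrib)
    also have "\<dots> \<le> L / (e z + c)\<^sup>2 * (slope z)\<^sup>2"
      using sl pos R L by (intro mult_left_mono power_mono) auto
    finally have "L / (4 * R\<^sup>2) * (lam / 4) \<le> L / (e z + c)\<^sup>2 * (slope z)\<^sup>2 * (lam / 4)"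
      using lam by (intro mult_right_mono) auto
    moreover have "L / (4 * R\<^sup>2) * (lam / 4) = 4 * b + 7" using R lam by (simp add: L_def)
    ultimately show False using q' D2_le by simp
  qed
  have q_le: "L / (e \<rho> + c)\<^sup>2 * (slope \<rho>)\<^sup>2 * lam / 4 \<le> D2" "L / (e \<gamma> + c)\<^sup>2 * (slope \<gamma>)\<^sup>2 * lam / 4 \<le> D2"
  proof -
    have 1: "L / (e \<rho> + c)\<^sup>2 * (slope \<rho>)\<^sup>2 \<le> q1 * (slope \<rho>)\<^sup>2" "L / (e \<gamma> + c)\<^sup>2 * (slope \<gamma>)\<^sup>2 \<le> q2 * (slope \<gamma>)\<^sup>2"
      unfolding q1_def q2_def using \<epsilon>\<^sub>1 by (intro mult_right_mono; simp)+
    have 2: "0 \<le> q1 * (slope \<rho>)\<^sup>2" "0 \<le> q2 * (slope \<gamma>)\<^sup>2" using q by auto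
    have D2_eq: "D2 = (q1 * (slope \<rho>)\<^sup>2 + q2 * (slope \<gamma>)\<^sup>2) * (lam / 4)" by (simp add: D2_def)
    have "L / (e \<rho> + c)\<^sup>2 * (slope \<rho>)\<^sup>2 * (lam / 4) \<le> D2" "L / (e \<gamma> + c)\<^sup>2 * (slope \<gamma>)\<^sup>2 * (lam / 4) \<le> D2"
      unfolding D2_eq using 1 2 lam by (intro mult_right_mono; linarith)+
    then show "L / (e \<rho> + c)\<^sup>2 * (slope \<rho>)\<^sup>2 * lam / 4 \<le> D2" "L / (e \<gamma> + c)\<^sup>2 * (slope \<gamma>)\<^sup>2 * lam / 4 \<le> D2"
      by simp_all
  qed
  have e\<rho>: "e \<rho> \<le> K0" and e\<gamma>: "e \<gamma> \<le> K0"
    using e_bound[OF inD(2) _ q_le(1)] e_bound[OF inD(3) _ q_le(2)] inR by auto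
  have sq_le: "a * (dist \<rho> \<pi>)\<^sup>2 \<le> 8" "a * (dist \<rho> \<gamma>)\<^sup>2 \<le> 8" "a * (dist \<gamma> \<mu>)\<^sup>2 \<le> 8"
  proof -
    have 1: "a * Sq \<le> 8" using aSq \<eta>' \<eta> by linarith
    have "a * (dist \<rho> \<pi>)\<^sup>2 \<le> a * Sq" "a * (dist \<rho> \<gamma>)\<^sup>2 \<le> a * Sq" "a * (dist \<gamma> \<mu>)\<^sup>2 \<le> a * Sq"
      using a by (auto simp: Sq_def intro!: mult_left_mono)
    with 1 show "a * (dist \<rho> \<pi>)\<^sup>2 \<le> 8" "a * (dist \<rho> \<gamma>)\<^sup>2 \<le> 8" "a * (dist \<gamma> \<mu>)\<^sup>2 \<le> 8" by linarith+
  qed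
  have dist_small: "t < d / 3" if "a * t\<^sup>2 \<le> 8" for t
  proof -
    have "100 / d\<^sup>2 * t\<^sup>2 \<le> a * t\<^sup>2" using a by (intro mult_right_mono) auto
    then have "100 / d\<^sup>2 * t\<^sup>2 \<le> 8" using that by linarith
    then have "100 * t\<^sup>2 \<le> 8 * d\<^sup>2" using d(1) by (simp add: field_simps)
    moreover have "0 < d\<^sup>2" using d(1) by simp
    moreover have "(d / 3)\<^sup>2 = d\<^sup>2 / 9" by (simp add: power_divide)
    ultimately have "t\<^sup>2 < (d / 3)\<^sup>2" by linarith
    then show ?thesis by (rule power_less_imp_less_base) (use d(1) in simp)
  qed
  have near: "dist \<pi> \<mu> < d"
    using dist_triangle[of \<pi> \<mu> \<rho>] dist_triangle[of \<rho> \<mu> \<gamma>] dist_small[OF sq_le(1)] dist_small[OF sq_le(2)]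
      dist_small[OF sq_le(3)] dist_commute[of \<pi> \<rho>] by linarith
  \<comment> \<open>The bound is uniform in \<open>a\<close>: because \<open>a * t \<le> 8\<close>,
    the quadratic term \<open>a\<^sup>2 * t\<close> is of order \<open>a\<close>, like the energy
    difference, and the factor \<open>a \<ge> 1\<close> can be divided out against a left-hand side
    that stays bounded.\<close>
  have e_far: "e z' \<le> K1"
    if ge: "- (s' * (2 * b)) \<le> lam * (a * (e z - e z' - \<kappa>/2 * t) + k * (a\<^sup>2 * t)) + \<tau>"
      and z: "e z \<le> K0" and t: "0 \<le> t" "a * t \<le> 8" and s': "s' \<le> 2" and k: "k \<le> 1/2" for z z' s' t k
  proof -
    have a1: "1 \<le> a" using a(1) b0 by linarith
    have "1 * t \<le> a * t" using a1 t by (intro mult_right_mono) auto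
    then have "t \<le> 8" using t by simp
    have \<kappa>t: "- (\<kappa>/2 * t) \<le> 4 * \<bar>\<kappa>\<bar>"
    proof -
      have "- \<kappa>/2 * t \<le> \<bar>\<kappa>\<bar>/2 * 8" using \<open>t \<le> 8\<close> t by (intro mult_mono) auto
      then show ?thesis by simp
    qed
    have k': "k * (a\<^sup>2 * t) \<le> a * 4"
    proof -
      have "k * (a\<^sup>2 * t) \<le> 1/2 * (a\<^sup>2 * t)" using k t by (intro mult_right_mono) auto
      also have "\<dots> = a * (a * t) / 2" by (simp add: power2_eq_square)
      also have "\<dots> \<le> a * 8 / 2" using t a by (intro divide_right_mono mult_left_mono) auto
      finally show ?thesis by simp
    qed
    have "s' * (2 * b) \<le> 2 * (2 * b)" using s' b0 by (intro mult_right_mono) auto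
    moreover have "\<tau> \<le> 1" using \<tau>(3) \<eta>' \<eta> by linarith
    ultimately have "- (4 * b + 1) \<le> lam * (a * (e z - e z' - \<kappa>/2 * t) + k * (a\<^sup>2 * t))" using ge by linarith
    also have "\<dots> \<le> lam * (a * (K0 - e z' + 4 * \<bar>\<kappa>\<bar>) + a * 4)"
      using z \<kappa>t k' lam a by (intro mult_left_mono add_mono) auto
    also have "\<dots> = a * (lam * (K0 - e z' + 4 * \<bar>\<kappa>\<bar> + 4))" by (simp add: algebra_simps)
    finally have ineq: "- (4 * b + 1) \<le> a * (lam * (K0 - e z' + 4 * \<bar>\<kappa>\<bar> + 4))" .
    have "- (4 * b + 1) \<le> lam * (K0 - e z' + 4 * \<bar>\<kappa>\<bar> + 4)"
    proof (cases "0 \<le> lam * (K0 - e z' + 4 * \<bar>\<kappa>\<bar> + 4)")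
      case False
      then have "a * (lam * (K0 - e z' + 4 * \<bar>\<kappa>\<bar> + 4)) \<le> 1 * (lam * (K0 - e z' + 4 * \<bar>\<kappa>\<bar> + 4))"
        using a1 by (intro mult_right_mono_neg) auto
      with ineq show ?thesis by linarith
    qed (use b0 in linarith)
    then have "- (4 * b + 1) / lam \<le> K0 - e z' + 4 * \<bar>\<kappa>\<bar> + 4"
      using lam by (simp only: pos_divide_le_eq mult.commute[of _ lam])
    then show ?thesis unfolding K1_def minus_divide_left[symmetric] by linarith
  qed
  have e\<pi>: "e \<pi> \<le> K1"
  proof (rule e_far[of s1 \<rho> \<pi> "(dist \<rho> \<pi>)\<^sup>2" "1 / (2 * s1)"])
    show "- (s1 * (2 * b)) \<le> lam * (a * (e \<rho> - e \<pi> - \<kappa>/2 * (dist \<rho> \<pi>)\<^sup>2) + 1 / (2 * s1) * (a\<^sup>2 * (dist \<rho> \<pi>)\<^sup>2)) + \<tau>"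
      using order_trans[OF suh(1) U] by simp
    show "1 / (2 * s1) \<le> 1 / 2" using s by (intro divide_left_mono) auto
  qed (use s sq_le e\<rho> in auto)
  have e\<mu>: "e \<mu> \<le> K1"
  proof (rule e_far[of s2 \<gamma> \<mu> "(dist \<gamma> \<mu>)\<^sup>2" "- (1 / (2 * s2))"])
    show "- (s2 * (2 * b)) \<le> lam * (a * (e \<gamma> - e \<mu> - \<kappa>/2 * (dist \<gamma> \<mu>)\<^sup>2) + - (1 / (2 * s2)) * (a\<^sup>2 * (dist \<gamma> \<mu>)\<^sup>2)) + \<tau>"
      using order_trans[OF suh(2) V] by simp
    show "- (1 / (2 * s2)) \<le> 1 / 2" using s by (simp add: divide_nonneg_nonneg order_trans[of _ 0])
  qed (use s sq_le e\<gamma> in auto)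
  have h_close: "\<bar>h' \<pi> - h' \<mu>\<bar> < \<eta>"
    using inD inR near e\<pi> e\<mu> by (intro d(2)) (auto simp: E_le_iff dist_commute)
  have "s1 * u x + s2 * v x \<le> F a \<pi> \<rho> \<gamma> \<mu> + 4 * \<eta>" using low_x F_val \<eta>' by linarith
  also have "\<dots> \<le> s1 * u \<pi> + s2 * v \<mu> + 6 * \<eta>" using F_upper[of a \<rho> \<gamma> \<pi> \<mu>] a inK by simp
  also have "\<dots> \<le> s1 * h \<pi> + s2 * h' \<mu> + 10 * \<eta>"
    using main' D2 unfolding right_diff_distrib by linarith
  also have "\<dots> \<le> H + 12 * \<eta>"
  proof -
    have "\<delta> * h \<pi> - \<delta> * h' \<mu> \<le> \<delta> * (2 * b)"
    proof -
      have "h \<pi> - h' \<mu> \<le> 2 * b" using abs_le_D1[OF bounds(3)[of \<pi>]] abs_le_D2[OF bounds(4)[of \<mu>]] by linarith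
      then have "\<delta> * (h \<pi> - h' \<mu>) \<le> \<delta> * (2 * b)" using \<delta> by (intro mult_left_mono) auto
      then show ?thesis by (simp only: right_diff_distrib)
    qed
    moreover have "s1 * h \<pi> + s2 * h' \<mu> = h \<pi> + h' \<mu> + (\<delta> * h \<pi> - \<delta> * h' \<mu>)"
      by (simp add: s1_def s2_def algebra_simps)
    ultimately show ?thesis using \<delta>b H[of \<pi>] h_close by linarith
  qed
  finally have fin: "s1 * u x + s2 * v x \<le> H + 12 * \<eta>" .
  have "\<delta> * v x - \<delta> * u x \<le> \<delta> * (2 * b)"
  proof -
    have "v x - u x \<le> 2 * b" using abs_le_D2[OF bounds(1)[of x]] abs_le_D1[OF bounds(2)[of x]] by linarith
    then have "\<delta> * (v x - u x) \<le> \<delta> * (2 * b)" using \<delta> by (intro mult_left_mono) auto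
    then show ?thesis by (simp only: right_diff_distrib)
  qed
  moreover have "u x + v x = s1 * u x + s2 * v x + (\<delta> * v x - \<delta> * u x)"
    by (simp add: s1_def s2_def algebra_simps)
  ultimately show "u x + v x \<le> H + \<eta>\<^sub>0" using fin \<delta>b \<eta>(3) by linarith
qed

end

lemma usc_map_imp_usc_on: "usc_map euclidean f \<Longrightarrow> usc_on UNIV f"
  unfolding usc_map_def usc_on_def by (auto simp: open_dist)

theorem corollary3p17:
  fixes E :: "'a::complete_space \<Rightarrow> ereal"
    and \<kappa> lam :: real
    and W :: "'a topology"
    and h_dagger h_ddagger u v :: "'a \<Rightarrow> real"
  assumes "\<And>\<pi>. E \<pi> \<noteq> -\<infinity>"
    and "metric_energy_assumption E"
    and "weak_topology_assumption W E"
    and "\<exists>S. EVI_gradient_flow E \<kappa> S"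
    and "regularized_geodesics_assumption E"
    and "lam > 0"
    and "continuous_on UNIV h_dagger" "bounded (range h_dagger)"
        "continuous_map W euclideanreal h_dagger"
    and "continuous_on UNIV h_ddagger" "bounded (range h_ddagger)"
        "continuous_map W euclideanreal h_ddagger"
    and "viscosity_subsolution (H_dagger E \<kappa>) lam h_dagger u"
    and "viscosity_supersolution (H_ddagger E \<kappa>) lam h_ddagger v"
  shows "(SUP \<pi>. u \<pi> - v \<pi>) \<le> (SUP \<pi>. h_dagger \<pi> - h_ddagger \<pi>)"
proof (rule cSUP_least)
  fix x
  obtain S where "EVI_gradient_flow E \<kappa> S" using assms(4) by blast
  then interpret evi_space E \<kappa> S
    using assms(1,2) by unfold_locales
  obtain y where y: "y \<in> energy_dom E"
    using assms(2) by (auto simp: metric_energy_assumption_def)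
  obtain b1 b2 b3 b4 where b: "\<And>x. \<bar>u x\<bar> \<le> b1" "\<And>x. \<bar>v x\<bar> \<le> b2" "\<And>x. \<bar>h_dagger x\<bar> \<le> b3" "\<And>x. \<bar>h_ddagger x\<bar> \<le> b4"
    using assms(8,11,13,14) unfolding viscosity_subsolution_def viscosity_supersolution_def bounded_iff by auto
  define b where "b = max (max b1 b2) (max b3 b4)"
  have bb: "b1 \<le> b" "b2 \<le> b" "b3 \<le> b" "b4 \<le> b" by (auto simp: b_def)
  have usc: "usc_map euclidean u" "usc_map euclidean (\<lambda>x. - v x)"
  proof -
    show "usc_map euclidean u" using assms(13) by (simp add: viscosity_subsolution_def)
    have "open {x. - c < v x}" for c
      using assms(14) by (simp add: viscosity_supersolution_def lsc_map_def)
    moreover have "{x. - v x < c} = {x. - c < v x}" for c by auto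
    ultimately show "usc_map euclidean (\<lambda>x. - v x)" by (simp add: usc_map_def)
  qed
  interpret comparison_data E \<kappa> S u "\<lambda>x. - v x" h_dagger "\<lambda>x. - h_ddagger x" lam b y
  proof unfold_locales
    show "quad_subsolution lam 1 h_dagger u"
      by (rule viscosity_subsolution_quad[OF assms(13,6)])
    show "quad_subsolution lam (- 1) (\<lambda>x. - h_ddagger x) (\<lambda>x. - v x)"
      by (rule viscosity_supersolution_quad[OF assms(14,6)])
    show "usc_on UNIV u" "usc_on UNIV (\<lambda>x. - v x)"
      by (rule usc_map_imp_usc_on, rule usc)+
    show "continuous_on UNIV (\<lambda>x. - h_ddagger x)" using assms(10) by (intro continuous_intros)
    show "\<bar>u x\<bar> \<le> b" "\<bar>- v x\<bar> \<le> b" "\<bar>h_dagger x\<bar> \<le> b" "\<bar>- h_ddagger x\<bar> \<le> b" for x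
      using b[of x] bb by auto
  qed (use assms y in auto)
  have bdd: "bdd_above (range (\<lambda>\<pi>. h_dagger \<pi> - h_ddagger \<pi>))"
  proof (rule bdd_aboveI2)
    show "h_dagger \<pi> - h_ddagger \<pi> \<le> b3 + b4" for \<pi>
      using abs_le_D1[OF b(3)[of \<pi>]] abs_le_D2[OF b(4)[of \<pi>]] by linarith
  qed
  have "u x + - v x \<le> (SUP \<pi>. h_dagger \<pi> - h_ddagger \<pi>)"
  proof (rule comparison[OF assms(3)])
    show "continuous_map W euclideanreal (\<lambda>x. - h_ddagger x)" using assms(12) by (intro continuous_intros)
    show "h_dagger z + - h_ddagger z \<le> (SUP \<pi>. h_dagger \<pi> - h_ddagger \<pi>)" for z
      using cSUP_upper[OF UNIV_I bdd, of z] by simp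
  qed
  then show "u x - v x \<le> (SUP \<pi>. h_dagger \<pi> - h_ddagger \<pi>)" by simp
qed simp

end
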